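(* Assume the setting described in the context (domains $\Omega,\Omega_\ell,\Omega_{n\ell}\subset\mathbb{R}^N$, number $\delta>0$, kernel $G$, with the properties listed there). Let $s\in(0,1)$ and let $C>0$ be a constant. Let $f\in L^2(\Omega)$ with $\int_\Omega f(x)\,dx=0$, and define, for $u\in H_{Neu}$, $$E_{Neu}(u)=\int_{\Omega_\ell}\frac{|\nabla u(x)|^2}{2}\,dx+\frac12\int_{\Omega_{n\ell}}\int_{\Omega_{n\ell}}\frac{C}{|x-y|^{N+2s}}|u(y)-u(x)|^2\,dy\,dx+\frac12\int_{\Omega_{n\ell}}\int_{\Omega_\ell}G(x,y)|u(y)-u(x)|^2\,dx\,dy-\int_\Omega f(x)u(x)\,dx,$$ where in the third term $x\in\Omega_\ell$ and $y\in\Omega_{n\ell}$. Then there exists a unique minimizer of $E_{Neu}$ in $H_{Neu}$. Moreover, the minimizer $u$ is a weak solution (in the sense defined in the context) of $$\begin{cases}-f(x)=\Delta u(x)+\displaystyle\int_{\Omega_{n\ell}}G(x,y)(u(y)-u(x))\,dy,& x\in\Omega_\ell,\\[4pt] \dfrac{\partial u}{\partial\eta}(x)=0,& x\in\partial\Omega_\ell,\end{cases}$$ and $$-f(x)=2\int_{\Omega_{n\ell}}\frac{C}{|x-y|^{N+2s}}(u(y)-u(x))\,dy+\int_{\Omega_\ell}G(y,x)(u(y)-u(x))\,dy,\qquad x\in\Omega_{n\ell}.$$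
   Context: Setting. $\Omega\subset\mathbb{R}^N$ is a bounded open domain; $\Omega_\ell,\Omega_{n\ell}\subset\Omega$ are disjoint nonempty open sets with $\Omega=(\overline{\Omega_\ell}\cup\overline{\Omega_{n\ell}})^\circ$. A number $\delta>0$ is fixed, the same in all the conditions below. An open set $D\subset\mathbb{R}^N$ is called $\delta$-connected if it cannot be written as a disjoint union of two nonempty (relatively) open sets that are at distance greater than or equal to $\delta$. Assumptions: (1) $\Omega_\ell$ is connected and has Lipschitz boundary. (2) $\Omega_{n\ell}$ is $\delta$-connected. (G1) $G:\Omega_\ell\times\Omega_{n\ell}\to\mathbb{R}$ is nonnegative and measurable, and there is $c_G>0$ such that for all $(x,y)\in\Omega_\ell\times\Omega_{n\ell}$, $G(x,y)>c_G$ whenever $\|x-y\|\le2\delta$. (P1) $\mathrm{dist}(\Omega_\ell,\Omega_{n\ell})<\delta$. Function space: $H_{Neu}=\{u:\ u|_{\Omega_\ell}\in H^1(\Omega_\ell),\ u|_{\Omega_{n\ell}}\in H^s(\Omega_{n\ell}),\ \int_\Omega u(x)\,dx=0\}$, where $H^s(\Omega_{n\ell})$ is the fractional Sobolev space of functions in $L^2(\Omega_{n\ell})$ with $\int_{\Omega_{n\ell}}\int_{\Omega_{n\ell}}\frac{|u(x)-u(y)|^2}{|x-y|^{N+2s}}\,dy\,dx<\infty$. The functional takes values in $(-\infty,+\infty]$. $\eta$ denotes the outward unit normal to $\partial\Omega_\ell$. Weak solution: $u\in H_{Neu}$ (with finite energy) is a weak solution of the coupled problem if for every smooth $\varphi$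 (restriction to $\Omega$ of a $C^\infty(\mathbb{R}^N)$ function) with $\int_\Omega\varphi=0$, and for which the quadratic part of the energy is finite, $$\int_\Omega f\varphi=\int_{\Omega_\ell}\nabla u\cdot\nabla\varphi+\int_{\Omega_{n\ell}}\int_{\Omega_{n\ell}}\frac{C}{|x-y|^{N+2s}}(u(y)-u(x))(\varphi(y)-\varphi(x))\,dy\,dx+\int_{\Omega_{n\ell}}\int_{\Omega_\ell}G(x,y)(u(y)-u(x))(\varphi(y)-\varphi(x))\,dx\,dy,$$ with $x\in\Omega_\ell$, $y\in\Omega_{n\ell}$ in the last integral.
   Formalization: The formal theorem additionally assumes that Ω minus the union of Ω_ℓ and Ω_nℓ has Lebesgue measure zero; otherwise (e.g. Ω_nℓ an interval minus a fat Cantor set, f = 0) functions in H_Neu are unconstrained on that set and uniqueness of the minimizer fails. *)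

theory Defs
  imports "HOL-Analysis.Analysis"
begin

section \<open>Domains\<close>

definition delta_connected :: "real \<Rightarrow> 'a::euclidean_space set \<Rightarrow> bool" where
  "delta_connected \<delta> D \<longleftrightarrow>
     \<not> (\<exists>A B. openin (top_of_set D) A \<and> openin (top_of_set D) B \<and> A \<noteq> {} \<and> B \<noteq> {} \<and>
            A \<inter> B = {} \<and> A \<union> B = D \<and> \<delta> \<le> setdist A B)"

text \<open>Near each boundary point, \<open>U\<close> is the strict supergraph, in the direction of a unit vector
  \<open>e\<close>, of a Lipschitz function on the hyperplane orthogonal to \<open>e\<close>.\<close>

definition lipschitz_boundary :: "'a::euclidean_space set \<Rightarrow> bool" where
  "lipschitz_boundary U \<longleftrightarrow>
     (\<forall>p\<in>frontier U. \<exists>r>0. \<exists>e. norm e = 1 \<and>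
        (\<exists>\<gamma>::'a \<Rightarrow> real. (\<exists>L. L-lipschitz_on {y. y \<bullet> e = 0} \<gamma>) \<and>
          U \<inter> ball p r = {x \<in> ball p r. \<gamma> (x - (x \<bullet> e) *\<^sub>R e) < x \<bullet> e}))"

section \<open>Smooth functions\<close>

fun C_k :: "nat \<Rightarrow> ('a::euclidean_space \<Rightarrow> real) \<Rightarrow> bool" where
  "C_k 0 \<phi> = continuous_on UNIV \<phi>"
| "C_k (Suc k) \<phi> = ((\<forall>x. \<phi> differentiable (at x)) \<and>
     (\<forall>b\<in>Basis. C_k k (\<lambda>x. frechet_derivative \<phi> (at x) b)))"

definition smooth :: "('a::euclidean_space \<Rightarrow> real) \<Rightarrow> bool" where
  "smooth \<phi> \<longleftrightarrow> (\<forall>k. C_k k \<phi>)"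

definition grad :: "('a::euclidean_space \<Rightarrow> real) \<Rightarrow> 'a \<Rightarrow> 'a" where
  "grad \<phi> x = (\<Sum>b\<in>Basis. frechet_derivative \<phi> (at x) b *\<^sub>R b)"

definition test_function :: "'a::euclidean_space set \<Rightarrow> ('a \<Rightarrow> real) \<Rightarrow> bool" where
  "test_function U \<psi> \<longleftrightarrow>
     smooth \<psi> \<and> compact (closure {x. \<psi> x \<noteq> 0}) \<and> closure {x. \<psi> x \<noteq> 0} \<subseteq> U"

section \<open>Function spaces\<close>

text \<open>Elements of the spaces below are total functions of which only the values almost everywhere
  on \<open>U\<close> matter; equality in these spaces is equality almost everywhere.\<close>

definition L2 :: "'a::euclidean_space set \<Rightarrow> ('a \<Rightarrow> 'b::euclidean_space) \<Rightarrow> bool" where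
  "L2 U u \<longleftrightarrow> u \<in> borel_measurable (lebesgue_on U) \<and>
     integrable (lebesgue_on U) (\<lambda>x. (norm (u x))\<^sup>2)"

definition locally_integrable_on ::
    "('a::euclidean_space \<Rightarrow> 'b::euclidean_space) \<Rightarrow> 'a set \<Rightarrow> bool" (infixr "locally'_integrable'_on" 46)
  where "u locally_integrable_on U \<longleftrightarrow>
     (\<forall>K. compact K \<and> K \<subseteq> U \<longrightarrow> u absolutely_integrable_on K)"

definition has_weak_gradient ::
    "'a::euclidean_space set \<Rightarrow> ('a \<Rightarrow> real) \<Rightarrow> ('a \<Rightarrow> 'a) \<Rightarrow> bool" where
  "has_weak_gradient U u g \<longleftrightarrow>
     u locally_integrable_on U \<and> g locally_integrable_on U \<and>
     (\<forall>\<psi>. test_function U \<psi> \<longrightarrow> (\<forall>b\<in>Basis.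
        (\<integral>x. u x * frechet_derivative \<psi> (at x) b \<partial>lebesgue_on U)
          = - (\<integral>x. (g x \<bullet> b) * \<psi> x \<partial>lebesgue_on U)))"

text \<open>On an open set the weak gradient is determined up to a null set.\<close>

definition weak_gradient :: "'a::euclidean_space set \<Rightarrow> ('a \<Rightarrow> real) \<Rightarrow> 'a \<Rightarrow> 'a" where
  "weak_gradient U u = (SOME g. has_weak_gradient U u g)"

definition H1 :: "'a::euclidean_space set \<Rightarrow> ('a \<Rightarrow> real) set" where
  "H1 U = {u. L2 U u \<and> (\<exists>g. has_weak_gradient U u g \<and> L2 U g)}"

definition Hs :: "real \<Rightarrow> 'a::euclidean_space set \<Rightarrow> ('a \<Rightarrow> real) set" where
  "Hs s U = {u. L2 U u \<and>
     (\<integral>\<^sup>+x. (\<integral>\<^sup>+y. ennreal (\<bar>u x - u y\<bar>\<^sup>2 / norm (x - y) powr (real DIM('a) + 2 * s))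
        \<partial>lebesgue_on U) \<partial>lebesgue_on U) < \<infinity>}"

definition H_Neu ::
    "'a::euclidean_space set \<Rightarrow> 'a set \<Rightarrow> 'a set \<Rightarrow> real \<Rightarrow> ('a \<Rightarrow> real) set" where
  "H_Neu \<Omega> \<Omega>l \<Omega>nl s = {u. u \<in> H1 \<Omega>l \<and> u \<in> Hs s \<Omega>nl \<and> (\<integral>x. u x \<partial>lebesgue_on \<Omega>) = 0}"

section \<open>Energy and weak solutions\<close>

definition quadratic_energy ::
    "'a::euclidean_space set \<Rightarrow> 'a set \<Rightarrow> real \<Rightarrow> real \<Rightarrow> ('a \<Rightarrow> 'a \<Rightarrow> real) \<Rightarrow> ('a \<Rightarrow> real) \<Rightarrow> ennreal"
  where
  "quadratic_energy \<Omega>l \<Omega>nl s C G u =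
     (\<integral>\<^sup>+x. ennreal ((norm (weak_gradient \<Omega>l u x))\<^sup>2 / 2) \<partial>lebesgue_on \<Omega>l)
     + ennreal (1/2) * (\<integral>\<^sup>+x. (\<integral>\<^sup>+y.
         ennreal (C / norm (x - y) powr (real DIM('a) + 2 * s) * \<bar>u y - u x\<bar>\<^sup>2)
         \<partial>lebesgue_on \<Omega>nl) \<partial>lebesgue_on \<Omega>nl)
     + ennreal (1/2) * (\<integral>\<^sup>+y. (\<integral>\<^sup>+x.
         ennreal (G x y * \<bar>u y - u x\<bar>\<^sup>2) \<partial>lebesgue_on \<Omega>l) \<partial>lebesgue_on \<Omega>nl)"

definition E_Neu ::
    "'a::euclidean_space set \<Rightarrow> 'a set \<Rightarrow> 'a set \<Rightarrow> real \<Rightarrow> real \<Rightarrow> ('a \<Rightarrow> 'a \<Rightarrow> real) \<Rightarrow>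
     ('a \<Rightarrow> real) \<Rightarrow> ('a \<Rightarrow> real) \<Rightarrow> ereal" where
  "E_Neu \<Omega> \<Omega>l \<Omega>nl s C G f u =
     enn2ereal (quadratic_energy \<Omega>l \<Omega>nl s C G u) - ereal (\<integral>x. f x * u x \<partial>lebesgue_on \<Omega>)"

definition weak_solution_Neu ::
    "'a::euclidean_space set \<Rightarrow> 'a set \<Rightarrow> 'a set \<Rightarrow> real \<Rightarrow> real \<Rightarrow> ('a \<Rightarrow> 'a \<Rightarrow> real) \<Rightarrow>
     ('a \<Rightarrow> real) \<Rightarrow> ('a \<Rightarrow> real) \<Rightarrow> bool" where
  "weak_solution_Neu \<Omega> \<Omega>l \<Omega>nl s C G f u \<longleftrightarrow>
     u \<in> H_Neu \<Omega> \<Omega>l \<Omega>nl s \<and> quadratic_energy \<Omega>l \<Omega>nl s C G u < \<infinity> \<and>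
     (\<forall>\<phi>. smooth \<phi> \<and> (\<integral>x. \<phi> x \<partial>lebesgue_on \<Omega>) = 0 \<and>
          quadratic_energy \<Omega>l \<Omega>nl s C G \<phi> < \<infinity> \<longrightarrow>
        (\<integral>x. f x * \<phi> x \<partial>lebesgue_on \<Omega>) =
          (\<integral>x. weak_gradient \<Omega>l u x \<bullet> grad \<phi> x \<partial>lebesgue_on \<Omega>l)
          + (\<integral>x. (\<integral>y. C / norm (x - y) powr (real DIM('a) + 2 * s)
                     * (u y - u x) * (\<phi> y - \<phi> x) \<partial>lebesgue_on \<Omega>nl) \<partial>lebesgue_on \<Omega>nl)
          + (\<integral>y. (\<integral>x. G x y * (u y - u x) * (\<phi> y - \<phi> x)
                     \<partial>lebesgue_on \<Omega>l) \<partial>lebesgue_on \<Omega>nl))"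

end

theory Submission
  imports Defs
begin

text \<open>
  The functional is a nonnegative quadratic form minus a linear one, so the theorem follows from
  coercivity: on functions of mean zero the quadratic form controls the \<open>L\<^sup>2\<close> norm
  (\<open>poincare_coupled\<close>). Given this, the parallelogram identity (\<open>qform_diff_le\<close>) makes every minimising
  sequence Cauchy for the form, the form is complete (\<open>energy_space_complete\<close>), and the limit is a
  minimiser. The same identity shows that two minimisers differ by a function of zero energy, hence
  agree almost everywhere by coercivity. Varying a minimiser in the direction of a test function
  gives the weak equation (\<open>Euler_Lagrange\<close>, \<open>bform_eq_iterated\<close>).

  To prove coercivity, bound the spread of \<open>u\<close> over two regions, that is, the double integral of
  \<open>(u x - u y)\<^sup>2\<close> with \<open>x\<close> in the first region and \<open>y\<close> in the second: over \<open>\<Omega> \<times> \<Omega>\<close> it equals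
  \<open>2 |\<Omega>| \<parallel>u\<parallel>\<^sup>2\<close> when \<open>u\<close> has mean zero. Spreads can be chained: inserting a third point \<open>z\<close> into
  \<open>u x - u y\<close> and averaging over \<open>z\<close> in a region \<open>A\<close> bounds the spread over \<open>V \<times> W\<close> by those over
  \<open>V \<times> A\<close> and \<open>W \<times> A\<close> (\<open>spread_link\<close>). So local estimates suffice. On the nonlocal part
  the kernel is bounded below, because the domain is bounded, and the spread is dominated at once. Across
  the interface the coupling kernel is bounded below on the product of two small open sets, one on either
  side. On the local part the spread is dominated by the gradient as follows.

  For a fixed vector \<open>h\<close>, the difference \<open>u (x + h) - u x\<close> is the average of \<open>g \<bullet> h\<close> over the segment from
  \<open>x\<close> to \<open>x + h\<close>, where \<open>g\<close> is the weak gradient (\<open>weak_gradient_along_segment\<close>). Substituting \<open>y = x + h\<close>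
  bounds the spread over a convex set by the gradient. A piece of the domain near a boundary point need
  not be convex, but by the graph condition it can be slid inside the domain into a ball, and the slide is
  again a difference along segments. Finitely many such pieces cover the domain, and as it is connected,
  chaining glues them together (\<open>poincare_on_lipschitz_domain\<close>).

  The identity along segments is obtained by duality from the definition of a weak gradient, tested with
  translates of a test function, and from the fundamental lemma of the calculus of variations. The
  fundamental lemma also makes weak gradients unique almost everywhere, hence
  linear in the function, and identifies them with classical gradients on smooth functions.
\<close>

section \<open>Smooth functions and bumps on boxes\<close>

abbreviation partial :: "'a::euclidean_space \<Rightarrow> ('a \<Rightarrow> real) \<Rightarrow> 'a \<Rightarrow> real" where
  "partial b \<phi> \<equiv> \<lambda>x. frechet_derivative \<phi> (at x) b"

lemma C_k_differentiable: "C_k (Suc k) \<phi> \<Longrightarrow> \<phi> differentiable (at x)"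
  by simp

lemma C_k_continuous: "C_k k \<phi> \<Longrightarrow> continuous_on UNIV \<phi>"
  by (cases k) (auto intro!: continuous_at_imp_continuous_on differentiable_imp_continuous_within)

lemma C_k_Suc_D: "C_k (Suc k) \<phi> \<Longrightarrow> C_k k \<phi>"
proof (induction k arbitrary: \<phi>)
  case 0
  then show ?case using C_k_continuous by fastforce
qed auto

lemma C_k_const: "C_k k (\<lambda>x::'a::euclidean_space. c)"
  by (induction k arbitrary: c) simp_all

lemma C_k_add: "C_k k \<phi> \<Longrightarrow> C_k k \<psi> \<Longrightarrow> C_k k (\<lambda>x. \<phi> x + \<psi> x)"
proof (induction k arbitrary: \<phi> \<psi>)
  case 0
  then show ?case by (auto intro: continuous_intros)
next
  case (Suc k)
  have "partial b (\<lambda>x. \<phi> x + \<psi> x) = (\<lambda>x. partial b \<phi> x + partial b \<psi> x)" for b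
  proof
    fix x
    have "((\<lambda>x. \<phi> x + \<psi> x) has_derivative
        (\<lambda>h. frechet_derivative \<phi> (at x) h + frechet_derivative \<psi> (at x) h)) (at x)"
      by (intro has_derivative_add)
         (use Suc.prems in \<open>simp_all add: frechet_derivative_works[symmetric]\<close>)
    from frechet_derivative_at[OF this]
    show "partial b (\<lambda>x. \<phi> x + \<psi> x) x = partial b \<phi> x + partial b \<psi> x"
      by metis
  qed
  then show ?case using Suc by simp
qed

lemma frechet_derivative_mult_apply:
  fixes \<phi> \<psi> :: "'a::euclidean_space \<Rightarrow> real"
  assumes "\<phi> differentiable (at x)" "\<psi> differentiable (at x)"
  shows "frechet_derivative (\<lambda>x. \<phi> x * \<psi> x) (at x) b =
    \<phi> x * frechet_derivative \<psi> (at x) b + frechet_derivative \<phi> (at x) b * \<psi> x"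
proof -
  have "((\<lambda>x. \<phi> x * \<psi> x) has_derivative
      (\<lambda>h. \<phi> x * frechet_derivative \<psi> (at x) h + frechet_derivative \<phi> (at x) h * \<psi> x)) (at x)"
    by (intro has_derivative_mult) (use assms in \<open>simp_all add: frechet_derivative_works[symmetric]\<close>)
  from frechet_derivative_at[OF this] show ?thesis
    by metis
qed

lemma C_k_mult: "C_k k \<phi> \<Longrightarrow> C_k k \<psi> \<Longrightarrow> C_k k (\<lambda>x. \<phi> x * \<psi> x)"
proof (induction k arbitrary: \<phi> \<psi>)
  case 0
  then show ?case by (auto intro: continuous_intros)
next
  case (Suc k)
  have "partial b (\<lambda>x. \<phi> x * \<psi> x) = (\<lambda>x. \<phi> x * partial b \<psi> x + partial b \<phi> x * \<psi> x)" for b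
    using Suc.prems by (simp add: frechet_derivative_mult_apply fun_eq_iff)
  moreover have "C_k k \<phi>" "C_k k \<psi>"
    using Suc.prems C_k_Suc_D by blast+
  ultimately show ?case using Suc by (auto intro!: C_k_add)
qed

lemma C_k_prod: "finite I \<Longrightarrow> (\<And>i. i \<in> I \<Longrightarrow> C_k k (\<phi> i)) \<Longrightarrow> C_k k (\<lambda>x. \<Prod>i\<in>I. \<phi> i x)"
  by (induction I rule: finite_induct) (auto intro: C_k_const C_k_mult)

lemma frechet_derivative_translate:
  fixes \<phi> :: "'a::euclidean_space \<Rightarrow> real"
  assumes "\<phi> differentiable (at (x + a))"
  shows "((\<lambda>x. \<phi> (x + a)) has_derivative frechet_derivative \<phi> (at (x + a))) (at x)"
proof -
  have "((\<lambda>x. x + a) has_derivative (\<lambda>h. h)) (at x)"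
    by (auto intro!: derivative_eq_intros)
  moreover have "(\<phi> has_derivative frechet_derivative \<phi> (at (x + a))) (at (x + a))"
    using assms frechet_derivative_works by blast
  ultimately show ?thesis
    using has_derivative_compose by fastforce
qed

lemma partial_translate:
  assumes "\<And>x. \<phi> differentiable (at x)"
  shows "partial b (\<lambda>x. \<phi> (x + a)) x = partial b \<phi> (x + a)"
  using frechet_derivative_at[OF frechet_derivative_translate[OF assms]] by metis

lemma C_k_translate: "C_k k \<phi> \<Longrightarrow> C_k k (\<lambda>x. \<phi> (x + a))"
proof (induction k arbitrary: \<phi>)
  case 0
  then have "continuous_on UNIV \<phi>" by simp
  then have "continuous_on UNIV (\<phi> \<circ> (\<lambda>x. x + a))"
    by (intro continuous_on_compose continuous_intros) (auto intro: continuous_on_subset)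
  then show ?case by (simp add: o_def)
next
  case (Suc k)
  then have d: "\<And>x. \<phi> differentiable (at x)" by auto
  have "(\<lambda>x. \<phi> (x + a)) differentiable (at x)" for x
    using frechet_derivative_translate[OF d] differentiable_def by blast
  moreover have "C_k k (partial b (\<lambda>x. \<phi> (x + a)))" if "b \<in> Basis" for b
    unfolding partial_translate[OF d] using Suc.IH[of "partial b \<phi>"] Suc.prems that by simp
  ultimately show ?case by simp
qed

lemma smooth_differentiable: "smooth \<phi> \<Longrightarrow> \<phi> differentiable (at x)"
  unfolding smooth_def using C_k_differentiable by blast

lemma smooth_continuous: "smooth \<phi> \<Longrightarrow> continuous_on S \<phi>"
  unfolding smooth_def by (meson C_k_continuous continuous_on_subset subset_UNIV)

lemma smooth_partial: "smooth \<phi> \<Longrightarrow> b \<in> Basis \<Longrightarrow> smooth (partial b \<phi>)"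
  unfolding smooth_def using C_k.simps(2) by blast

lemma smooth_mult: "smooth \<phi> \<Longrightarrow> smooth \<psi> \<Longrightarrow> smooth (\<lambda>x. \<phi> x * \<psi> x)"
  unfolding smooth_def by (blast intro: C_k_mult)

lemma smooth_prod: "finite I \<Longrightarrow> (\<And>i. i \<in> I \<Longrightarrow> smooth (\<phi> i)) \<Longrightarrow> smooth (\<lambda>x. \<Prod>i\<in>I. \<phi> i x)"
  unfolding smooth_def by (blast intro: C_k_prod)

lemma smooth_translate: "smooth \<phi> \<Longrightarrow> smooth (\<lambda>x. \<phi> (x + a))"
  unfolding smooth_def by (blast intro: C_k_translate)

text \<open>Derivatives stay in the span of this family, which is why the powers of \<open>1 / t\<close> are carried
  along; the bumps are built from \<open>m = 0\<close>.\<close>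

definition exp_flat :: "nat \<Rightarrow> real \<Rightarrow> real" where
  "exp_flat m t = (if t > 0 then (1 / t) ^ m * exp (- 1 / t) else 0)"

lemma exp_flat_tendsto_0: "(exp_flat m \<longlongrightarrow> 0) (at_right 0)"
proof -
  have "((\<lambda>x::real. x ^ m / exp x) \<longlongrightarrow> 0) at_top"
    by (rule tendsto_power_div_exp_0)
  then have "((\<lambda>t::real. (inverse t) ^ m / exp (inverse t)) \<longlongrightarrow> 0) (at_right 0)"
    by (rule filterlim_compose) (rule filterlim_inverse_at_top_right)
  moreover have "\<forall>\<^sub>F t in at_right (0::real). (inverse t) ^ m / exp (inverse t) = exp_flat m t"
    unfolding eventually_at_right_field exp_flat_def
    by (intro exI[of _ 1]) (auto simp: exp_minus field_simps)
  ultimately show ?thesis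
    using Lim_transform_eventually by blast
qed

lemma exp_flat_has_derivative:
  "(exp_flat m has_real_derivative (exp_flat (m + 2) t - m * exp_flat (m + 1) t)) (at t)"
proof -
  consider "t > 0" | "t < 0" | "t = 0" by linarith
  then show ?thesis
  proof cases
    case 1
    have i: "((\<lambda>t. inverse t) has_real_derivative - (inverse t * inverse t)) (at t)"
      using DERIV_inverse'[OF DERIV_ident, of t] 1 by simp
    have p: "((\<lambda>t. inverse t ^ m) has_real_derivative - (m * inverse t ^ (m + 1))) (at t)"
      using DERIV_power[OF i, of m] by (cases m) (simp_all add: algebra_simps)
    have e: "((\<lambda>t. exp (- inverse t)) has_real_derivative exp (- inverse t) * (inverse t * inverse t)) (at t)"
      using DERIV_fun_exp[OF DERIV_minus[OF i]] by simp
    have "((\<lambda>t. (1 / t) ^ m * exp (- 1 / t)) has_real_derivative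
        (exp_flat (m + 2) t - m * exp_flat (m + 1) t)) (at t)"
      using DERIV_mult[OF p e] 1
      by (simp add: exp_flat_def inverse_eq_divide algebra_simps)
    then show ?thesis
      by (rule has_field_derivative_transform_within_open[where S = "{0<..}"])
         (use 1 in \<open>auto simp: exp_flat_def\<close>)
  next
    case 2
    have "((\<lambda>t. 0) has_real_derivative
        (exp_flat (m + 2) t - m * exp_flat (m + 1) t)) (at t)"
      using 2 by (simp add: exp_flat_def)
    then show ?thesis
      by (rule has_field_derivative_transform_within_open[where S = "{..<0}"])
         (use 2 in \<open>auto simp: exp_flat_def\<close>)
  next
    case 3
    have "((\<lambda>y. exp_flat m y / y) \<longlongrightarrow> 0) (at_right 0)"
    proof (rule Lim_transform_eventually[OF exp_flat_tendsto_0[of "m + 1"]])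
      show "\<forall>\<^sub>F t in at_right 0. exp_flat (m + 1) t = exp_flat m t / t"
        unfolding eventually_at_right_field
        by (intro exI[of _ 1]) (auto simp: exp_flat_def)
    qed
    moreover have "((\<lambda>y. exp_flat m y / y) \<longlongrightarrow> 0) (at_left 0)"
      by (rule tendsto_eventually, unfold eventually_at_left_field)
         (auto intro!: exI[of _ "-1"] simp: exp_flat_def)
    ultimately have "((\<lambda>y. exp_flat m y / y) \<longlongrightarrow> 0) (at 0)"
      by (simp add: filterlim_split_at)
    then show ?thesis
      using 3 by (simp add: has_field_derivative_iff exp_flat_def)
  qed
qed

lemma C_k_exp_flat_affine: "C_k k (\<lambda>x::'a::euclidean_space. exp_flat m (x \<bullet> c + d))"
proof (induction k arbitrary: m)
  have D: "((\<lambda>x::'a. exp_flat m (x \<bullet> c + d)) has_derivative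
     (\<lambda>h. (h \<bullet> c) * (exp_flat (m + 2) (x \<bullet> c + d) + (- real m) * exp_flat (m + 1) (x \<bullet> c + d)))) (at x)"
    for m x
  proof -
    have "((\<lambda>x::'a. x \<bullet> c + d) has_derivative (\<lambda>h. h \<bullet> c)) (at x)"
      by (auto intro!: derivative_eq_intros)
    from has_derivative_compose[OF this
        exp_flat_has_derivative[of m "x \<bullet> c + d", unfolded has_field_derivative_def]]
    show ?thesis by (simp add: mult.commute)
  qed
  {
    case 0
    have "continuous (at x) (\<lambda>x::'a. exp_flat m (x \<bullet> c + d))" for x
      using D has_derivative_continuous by blast
    then show ?case by (simp add: continuous_at_imp_continuous_on)
  next
    case (Suc k)
    have "(\<lambda>x::'a. exp_flat m (x \<bullet> c + d)) differentiable (at x)" for x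
      using D differentiable_def by blast
    moreover have "partial b (\<lambda>x::'a. exp_flat m (x \<bullet> c + d)) = (\<lambda>x. (b \<bullet> c) *
        (exp_flat (m + 2) (x \<bullet> c + d) + (- real m) * exp_flat (m + 1) (x \<bullet> c + d)))" for b
      using frechet_derivative_at[OF D] by (metis (no_types, lifting))
    moreover have "C_k k (\<lambda>x. (b \<bullet> c) *
        (exp_flat (m + 2) (x \<bullet> c + d) + (- real m) * exp_flat (m + 1) (x \<bullet> c + d)))" for b
      by (intro C_k_mult C_k_add C_k_const Suc)
    ultimately show ?case
      unfolding C_k.simps(2) by (metis (no_types, lifting))
  }
qed

lemma smooth_exp_flat_affine: "smooth (\<lambda>x::'a::euclidean_space. exp_flat m (x \<bullet> c + d))"
  by (simp add: smooth_def C_k_exp_flat_affine)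

text \<open>As \<open>n\<close> grows this increases to the indicator of the open box, each factor tending to \<open>1\<close>
  where its argument is positive; the shift by one keeps the scale positive at \<open>n = 0\<close>.\<close>

definition box_bump :: "'a::euclidean_space \<Rightarrow> 'a \<Rightarrow> nat \<Rightarrow> 'a \<Rightarrow> real" where
  "box_bump a b n x = (\<Prod>i\<in>Basis. exp_flat 0 (Suc n * (x \<bullet> i - a \<bullet> i)) * exp_flat 0 (Suc n * (b \<bullet> i - x \<bullet> i)))"

lemma smooth_box_bump: "smooth (box_bump a b n)"
proof -
  have "smooth (\<lambda>x. exp_flat 0 (Suc n * (x \<bullet> i - a \<bullet> i)) * exp_flat 0 (Suc n * (b \<bullet> i - x \<bullet> i)))" for i
    using smooth_mult[OF smooth_exp_flat_affine[of 0 "real (Suc n) *\<^sub>R i" "- (Suc n * (a \<bullet> i))"]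
       smooth_exp_flat_affine[of 0 "(- real (Suc n)) *\<^sub>R i" "Suc n * (b \<bullet> i)"]]
    by (simp add: algebra_simps)
  then show ?thesis
    unfolding box_bump_def by (intro smooth_prod) auto
qed

lemma exp_flat_0_bounds: "0 \<le> exp_flat 0 t" "exp_flat 0 t \<le> 1"
  by (auto simp: exp_flat_def)

lemma box_bump_bounds: "0 \<le> box_bump a b n x" "box_bump a b n x \<le> 1"
  unfolding box_bump_def
  by (auto intro!: prod_nonneg prod_le_1 mult_le_one simp: exp_flat_0_bounds)

lemma box_bump_eq_0: "x \<notin> box a b \<Longrightarrow> box_bump a b n x = 0"
  unfolding box_bump_def mem_box by (auto intro!: prod_zero simp: exp_flat_def mult_less_0_iff zero_less_mult_iff)

lemma exp_flat_scaled_tendsto: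
  assumes t: "t > 0"
  shows "(\<lambda>n. exp_flat 0 (real (Suc n) * t)) \<longlonglongrightarrow> 1"
proof -
  have "(\<lambda>n. exp (- (inverse t * inverse (real (Suc n))))) \<longlonglongrightarrow> exp (- (inverse t * 0))"
    by (intro tendsto_intros LIMSEQ_inverse_real_of_nat)
  moreover have "exp_flat 0 (Suc n * t) = exp (- (inverse t * inverse (real (Suc n))))" for n
    using t mult_pos_pos[of "real (Suc n)" t]
    by (simp add: exp_flat_def inverse_eq_divide del: of_nat_Suc)
  ultimately show ?thesis by simp
qed

lemma box_bump_tendsto: "(\<lambda>n. box_bump a b n x) \<longlonglongrightarrow> indicator (box a b) x"
proof (cases "x \<in> box a b")
  case True
  have "(\<lambda>n. box_bump a b n x) \<longlonglongrightarrow> (\<Prod>i\<in>(Basis::'a set). 1 * 1)"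
    unfolding box_bump_def using True
    by (intro tendsto_prod tendsto_mult exp_flat_scaled_tendsto) (simp_all add: mem_box)
  then show ?thesis using True by simp
qed (simp add: box_bump_eq_0)

lemma test_function_box_bump:
  assumes "box a b \<subseteq> cbox c d" "cbox c d \<subseteq> V"
  shows "test_function V (box_bump a b n)"
proof -
  have "{x. box_bump a b n x \<noteq> 0} \<subseteq> cbox c d"
    using box_bump_eq_0 assms(1) by blast
  then have "closure {x. box_bump a b n x \<noteq> 0} \<subseteq> cbox c d"
    by (simp add: closure_minimal closed_cbox)
  then show ?thesis
    using assms(2) smooth_box_bump
    by (auto simp: test_function_def intro: compact_cbox closed_closure
        dest: bounded_subset[OF bounded_cbox] simp: compact_eq_bounded_closed)
qed

section \<open>Test functions\<close>

lemma bounded_if_compact_support: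
  fixes \<phi> :: "'a::euclidean_space \<Rightarrow> real"
  assumes "continuous_on UNIV \<phi>" "compact K" "\<And>x. x \<notin> K \<Longrightarrow> \<phi> x = 0"
  shows "\<exists>C\<ge>0. \<forall>x. \<bar>\<phi> x\<bar> \<le> C"
proof -
  have "compact (\<phi> ` K)"
    using assms by (intro compact_continuous_image) (auto intro: continuous_on_subset)
  then have "bounded (\<phi> ` K)"
    by (rule compact_imp_bounded)
  then obtain C where C: "\<And>y. y \<in> \<phi> ` K \<Longrightarrow> \<bar>y\<bar> \<le> C"
    unfolding bounded_real by auto
  have "\<bar>\<phi> x\<bar> \<le> max C 0" for x
    using C[of "\<phi> x"] assms(3)[of x] by (cases "x \<in> K") auto
  then show ?thesis
    by (intro exI[of _ "max C 0"]) auto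
qed

lemma frechet_derivative_eq_0_outside:
  fixes \<phi> :: "'a::euclidean_space \<Rightarrow> real"
  assumes "closed K" "\<And>x. x \<notin> K \<Longrightarrow> \<phi> x = 0" "x \<notin> K"
  shows "frechet_derivative \<phi> (at x) b = 0"
proof -
  have "((\<lambda>x. 0) has_derivative (\<lambda>h. 0)) (at x)"
    by simp
  then have "(\<phi> has_derivative (\<lambda>h. 0)) (at x)"
    by (rule has_derivative_transform_within_open[where s = "- K"])
       (use assms in auto)
  from frechet_derivative_at[OF this] show ?thesis
    by metis
qed

lemma test_function_support:
  assumes "test_function U \<psi>"
  shows "\<exists>K. compact K \<and> K \<subseteq> U \<and>
    (\<forall>x. x \<notin> K \<longrightarrow> \<psi> x = 0 \<and> (\<forall>b. frechet_derivative \<psi> (at x) b = 0))"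
proof -
  let ?K = "closure {x. \<psi> x \<noteq> 0}"
  have z: "\<psi> x = 0" if "x \<notin> ?K" for x
    using that closure_subset[of "{x. \<psi> x \<noteq> 0}"] by auto
  have d: "frechet_derivative \<psi> (at x) b = 0" if "x \<notin> ?K" for x b
    by (rule frechet_derivative_eq_0_outside[OF closed_closure z that])
  have "compact ?K" "?K \<subseteq> U"
    using assms by (simp_all add: test_function_def)
  then show ?thesis
    by (intro exI[of _ ?K] conjI allI impI z d)
qed

lemma test_function_smooth: "test_function U \<psi> \<Longrightarrow> smooth \<psi>"
  by (simp add: test_function_def)

lemma test_function_bounded:
  assumes "test_function U \<psi>"
  shows "\<exists>C\<ge>0. \<forall>x. \<bar>\<psi> x\<bar> \<le> C"
proof -
  obtain K where K: "compact K" "K \<subseteq> U"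
      "\<forall>x. x \<notin> K \<longrightarrow> \<psi> x = 0 \<and> (\<forall>b. frechet_derivative \<psi> (at x) b = 0)"
    using test_function_support[OF assms] by blast
  show ?thesis
    by (rule bounded_if_compact_support[OF smooth_continuous[OF test_function_smooth[OF assms]] K(1)])
       (simp add: K(3))
qed

lemma test_function_partial_bounded:
  assumes "test_function U \<psi>" "b \<in> Basis"
  shows "\<exists>C\<ge>0. \<forall>x. \<bar>partial b \<psi> x\<bar> \<le> C"
proof -
  obtain K where K: "compact K" "K \<subseteq> U"
      "\<forall>x. x \<notin> K \<longrightarrow> \<psi> x = 0 \<and> (\<forall>b. frechet_derivative \<psi> (at x) b = 0)"
    using test_function_support[OF assms(1)] by blast
  show ?thesis
    by (rule bounded_if_compact_support[OF smooth_continuous[OF smooth_partial[OF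
            test_function_smooth[OF assms(1)] assms(2)]] K(1)])
       (simp add: K(3))
qed

lemma borel_measurable_lebesgueI: "f \<in> borel_measurable borel \<Longrightarrow> f \<in> borel_measurable lebesgue"
  by (rule measurable_completion) simp

lemma borel_measurable_smooth:
  "smooth \<phi> \<Longrightarrow> \<phi> \<in> borel_measurable borel"
  by (intro borel_measurable_continuous_onI smooth_continuous)

lemma integrable_lebesgue_on_mult_compact_support:
  fixes h \<rho> :: "'a::euclidean_space \<Rightarrow> real"
  assumes h: "h locally_integrable_on V" and V: "open V"
    and \<rho>: "continuous_on UNIV \<rho>" and K: "compact K" "K \<subseteq> V" "\<And>x. x \<notin> K \<Longrightarrow> \<rho> x = 0"
  shows "integrable (lebesgue_on V) (\<lambda>x. h x * \<rho> x)"
proof -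
  obtain C where C: "C \<ge> 0" "\<And>x. \<bar>\<rho> x\<bar> \<le> C"
    using bounded_if_compact_support[OF \<rho> K(1,3)] by auto
  have h': "integrable lebesgue (\<lambda>x. indicator K x * h x)"
    using h K by (simp add: locally_integrable_on_def set_integrable_def)
  have m: "\<rho> \<in> borel_measurable lebesgue"
    using \<rho> by (intro borel_measurable_lebesgueI borel_measurable_continuous_onI)
  have "integrable lebesgue (\<lambda>x. (indicator K x * h x) * \<rho> x)"
  proof (rule Bochner_Integration.integrable_bound)
    show "integrable lebesgue (\<lambda>x. C * (indicator K x * h x))"
      using h' by simp
    show "(\<lambda>x. indicator K x * h x * \<rho> x) \<in> borel_measurable lebesgue"
      using h' m by measurable
    show "AE x in lebesgue. norm (indicator K x * h x * \<rho> x) \<le> norm (C * (indicator K x * h x))"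
    proof (intro AE_I2)
      fix x
      have "\<bar>indicator K x * h x\<bar> * \<bar>\<rho> x\<bar> \<le> \<bar>indicator K x * h x\<bar> * C"
        by (intro mult_left_mono C) simp
      then show "norm (indicator K x * h x * \<rho> x) \<le> norm (C * (indicator K x * h x))"
        using C(1) by (simp add: abs_mult mult.commute)
    qed
  qed
  moreover have "(indicator K x * h x) * \<rho> x = indicator V x *\<^sub>R (h x * \<rho> x)" for x
    using K by (auto split: split_indicator)
  ultimately show ?thesis
    using V by (simp add: integrable_restrict_space)
qed

lemma integral_lebesgue_on_eq:
  fixes \<phi> :: "'a::euclidean_space \<Rightarrow> 'b::{banach, second_countable_topology}"
  assumes "open V"
  shows "(\<integral>x. \<phi> x \<partial>lebesgue_on V) = (\<integral>x. indicator V x *\<^sub>R \<phi> x \<partial>lebesgue)"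
  using assms by (subst integral_restrict_space) auto

lemma AE_lebesgue_on_iff:
  "open V \<Longrightarrow> (AE x in lebesgue_on V. P x) \<longleftrightarrow> (AE x in lebesgue. x \<in> V \<longrightarrow> P x)"
  by (subst AE_restrict_space_iff) auto

section \<open>The fundamental lemma of the calculus of variations\<close>

text \<open>Boxes generate the Borel sets and are closed under intersection, so the finite measures with
  densities the positive and the negative part of \<open>h\<close> coincide.\<close>

lemma AE_eq_0_if_integral_boxes_0:
  fixes h :: "'a::euclidean_space \<Rightarrow> real"
  assumes h: "integrable lborel h"
    and box: "\<And>a b. (\<integral>x\<in>box a b. h x \<partial>lborel) = 0"
  shows "AE x in lborel. h x = 0"
proof -
  have [measurable]: "h \<in> borel_measurable borel"
    using h by auto
  define M where "M = density lborel (\<lambda>x. ennreal (h x))"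
  define N where "N = density lborel (\<lambda>x. ennreal (- h x))"
  have fin: "(\<integral>\<^sup>+x. ennreal (h x) \<partial>lborel) < \<infinity>" "(\<integral>\<^sup>+x. ennreal (- h x) \<partial>lborel) < \<infinity>"
    using h by (auto simp: real_integrable_def less_top[symmetric])
  have eq: "emeasure M (box a b) = emeasure N (box a b)" for a b
  proof -
    let ?h = "\<lambda>x. indicator (box a b) x * h x"
    have i: "integrable lborel ?h"
      using integrable_mult_indicator[OF _ h, of "box a b"] by simp
    have 1: "(\<integral>\<^sup>+x. ennreal (?h x) \<partial>lborel) = emeasure M (box a b)"
         "(\<integral>\<^sup>+x. ennreal (- ?h x) \<partial>lborel) = emeasure N (box a b)"
      by (auto simp: M_def N_def emeasure_density intro!: nn_integral_cong split: split_indicator)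
    have "(\<integral>x. ?h x \<partial>lborel) = 0"
      using box[of a b] by (simp add: set_lebesgue_integral_def)
    then have "enn2real (emeasure M (box a b)) = enn2real (emeasure N (box a b))"
      using real_lebesgue_integral_def[OF i] 1 by simp
    moreover have "emeasure M (box a b) < \<infinity>" "emeasure N (box a b) < \<infinity>"
      using i 1 by (auto simp: real_integrable_def less_top[symmetric])
    ultimately show ?thesis
      by (metis ennreal_enn2real infinity_ennreal_def)
  qed
  have "M = N"
  proof (rule measure_eqI_generator_eq[where E = "range (\<lambda>(a, b). box a b)" and \<Omega> = UNIV
        and A = "\<lambda>n. box (- (real n *\<^sub>R One)) (real n *\<^sub>R One)"])
    show "Int_stable (range (\<lambda>(a, b). box a b :: 'a set))"
      by (auto simp: Int_stable_def box_Int_box)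
    show "sets M = sigma_sets UNIV (range (\<lambda>(a, b). box a b))"
         "sets N = sigma_sets UNIV (range (\<lambda>(a, b). box a b))"
      by (simp_all add: M_def N_def borel_eq_box)
    show "(\<Union>n. box (- (real n *\<^sub>R One)) (real n *\<^sub>R One)) = (UNIV::'a set)"
      unfolding UN_box_eq_UNIV ..
    have "emeasure M UNIV < \<infinity>"
      using fin by (simp add: M_def emeasure_density)
    moreover have "emeasure M (box (- (real n *\<^sub>R One)) (real n *\<^sub>R One)) \<le> emeasure M UNIV" for n
      by (intro emeasure_mono) (auto simp: M_def)
    ultimately show "emeasure M (box (- (real n *\<^sub>R One)) (real n *\<^sub>R One)) \<noteq> \<infinity>" for n
      by (metis infinity_ennreal_def leD top.not_eq_extremum)
  qed (use eq in auto)
  then have "AE x in lborel. ennreal (h x) = ennreal (- h x)"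
    unfolding M_def N_def by (intro sigma_finite_measure.density_unique[OF sigma_finite_lborel]) auto
  then show ?thesis
    by eventually_elim (metis (no_types) ennreal_eq_0_iff ennreal_neg linorder_le_cases neg_le_0_iff_le
        order_antisym)
qed

text \<open>Test functions exhaust the indicator of every box that is compactly inside \<open>V\<close>, so \<open>h\<close>
  integrates to 0 over all of them.\<close>

theorem fundamental_lemma_calculus_of_variations:
  fixes h :: "'a::euclidean_space \<Rightarrow> real"
  assumes V: "open V" and h: "h locally_integrable_on V"
    and zero: "\<And>\<psi>. test_function V \<psi> \<Longrightarrow> (\<integral>x. h x * \<psi> x \<partial>lebesgue_on V) = 0"
  shows "AE x in lebesgue_on V. h x = 0"
proof -
  obtain D where D: "countable D" "\<And>X. X \<in> D \<Longrightarrow> X \<subseteq> V" "\<And>X. X \<in> D \<Longrightarrow> \<exists>c d. X = cbox c d" "\<Union>D = V"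
    by (rule open_countable_Union_open_cbox[OF V]) (auto simp: Pow_def)
  have loc: "AE x in lebesgue. x \<in> cbox c d \<longrightarrow> h x = 0" if cd: "cbox c d \<subseteq> V" for c d
  proof -
    define H where "H x = indicator (cbox c d) x * h x" for x
    have H: "integrable lebesgue H"
      using h cd by (simp add: locally_integrable_on_def set_integrable_def H_def[abs_def])
    then have "H \<in> borel_measurable lebesgue" by auto
    then obtain h' where h' [measurable]: "h' \<in> borel_measurable lborel" and hh: "AE x in lborel. H x = h' x"
      using completion_ex_borel_measurable_real by blast
    have hh': "AE x in lebesgue. H x = h' x"
      using AE_completion[OF hh] .
    have "integrable lebesgue h' \<longleftrightarrow> integrable lebesgue H"
      using hh' \<open>H \<in> borel_measurable lebesgue\<close> measurable_completion[OF h']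
      by (intro integrable_cong_AE) auto
    then have i': "integrable lborel h'"
      using H integrable_completion[OF h'] by simp
    have "AE x in lborel. h' x = 0"
    proof (rule AE_eq_0_if_integral_boxes_0[OF i'])
      fix a b :: 'a
      obtain a' b' where ab': "box a b \<inter> box c d = box a' b'"
        using box_Int_box[of a b c d] by auto
      have "box a' b' \<subseteq> box c d"
        unfolding ab'[symmetric] by (rule Int_lower2)
      then have sub: "box a' b' \<subseteq> cbox c d"
        using box_subset_cbox[of c d] by (rule subset_trans)
      have "(\<lambda>n. \<integral>x. h' x * box_bump a' b' n x \<partial>lborel) \<longlonglongrightarrow> (\<integral>x. h' x * indicator (box a' b') x \<partial>lborel)"
      proof (rule integral_dominated_convergence)
        show "integrable lborel (\<lambda>x. norm (h' x))" using i' by auto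
        show "AE x in lborel. (\<lambda>n. h' x * box_bump a' b' n x) \<longlonglongrightarrow> h' x * indicator (box a' b') x"
          by (auto intro!: tendsto_mult box_bump_tendsto)
        show "AE x in lborel. norm (h' x * box_bump a' b' n x) \<le> norm (h' x)" for n
          using box_bump_bounds[of a' b' n] by (intro AE_I2) (simp add: abs_mult mult_left_le)
        show "(\<lambda>x. h' x * box_bump a' b' n x) \<in> borel_measurable lborel" for n
          using borel_measurable_smooth[OF smooth_box_bump[of a' b' n]] by measurable
      qed simp
      moreover have "(\<integral>x. h' x * box_bump a' b' n x \<partial>lborel) = 0" for n
      proof -
        have [measurable]: "box_bump a' b' n \<in> borel_measurable borel"
          using borel_measurable_smooth[OF smooth_box_bump] .
        have m: "box_bump a' b' n \<in> borel_measurable lebesgue"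
          by (rule borel_measurable_lebesgueI) fact
        have "(\<integral>x. h' x * box_bump a' b' n x \<partial>lborel) = (\<integral>x. h' x * box_bump a' b' n x \<partial>lebesgue)"
          by (intro integral_completion[symmetric]) measurable
        also have "\<dots> = (\<integral>x. H x * box_bump a' b' n x \<partial>lebesgue)"
          using hh' m \<open>H \<in> borel_measurable lebesgue\<close> measurable_completion[OF h']
          by (intro integral_cong_AE) auto
        also have "\<dots> = (\<integral>x. h x * box_bump a' b' n x \<partial>lebesgue_on V)"
          unfolding integral_lebesgue_on_eq[OF V]
          using cd sub box_bump_eq_0[of _ a' b' n]
          by (intro Bochner_Integration.integral_cong) (auto simp: H_def split: split_indicator)
        also have "\<dots> = 0"
          by (intro zero test_function_box_bump[OF sub cd])
        finally show ?thesis .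
      qed
      ultimately have "(\<integral>x. h' x * indicator (box a' b') x \<partial>lborel) = 0"
        by (simp add: LIMSEQ_const_iff)
      moreover have "(\<integral>x. h' x * indicator (box a' b') x \<partial>lborel) = (\<integral>x\<in>box a b. h' x \<partial>lborel)"
        unfolding set_lebesgue_integral_def
      proof (intro integral_cong_AE)
        have "AE x in lborel. x \<notin> cbox c d - box c d"
          using null_sets_cbox_Diff_box AE_not_in by blast
        with hh show "AE x in lborel. h' x * indicator (box a' b') x = indicator (box a b) x *\<^sub>R h' x"
        proof eventually_elim
          case (elim x)
          have "indicator (box a' b') x = (indicator (box a b) x * indicator (box c d) x :: real)"
            using ab' by (auto split: split_indicator)
          then show ?case
            using elim by (auto simp: H_def split: split_indicator_asm split_indicator)
        qed
      qed auto
      ultimately show "(\<integral>x\<in>box a b. h' x \<partial>lborel) = 0"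
        by simp
    qed
    then have "AE x in lebesgue. h' x = 0"
      by (rule AE_completion)
    with hh' show ?thesis
      by eventually_elim (auto simp: H_def)
  qed
  have "AE x in lebesgue. \<forall>X\<in>D. x \<in> X \<longrightarrow> h x = 0"
    unfolding AE_ball_countable[OF D(1)]
    using loc D(2,3) by metis
  then have "AE x in lebesgue. x \<in> V \<longrightarrow> h x = 0"
    by eventually_elim (use D(4) in auto)
  then show ?thesis
    by (simp add: AE_lebesgue_on_iff[OF V])
qed

section \<open>Weak gradients\<close>

lemma locally_integrable_on_inner:
  assumes "g locally_integrable_on U"
  shows "(\<lambda>x. g x \<bullet> b) locally_integrable_on U"
proof -
  have "integrable lebesgue (\<lambda>x. (indicator K x *\<^sub>R g x) \<bullet> b)" if "compact K" "K \<subseteq> U" for K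
    using assms that by (intro integrable_inner_left) (auto simp: locally_integrable_on_def set_integrable_def)
  then show ?thesis
    by (simp add: locally_integrable_on_def set_integrable_def)
qed

lemma locally_integrable_on_add_scaled:
  assumes "u locally_integrable_on U" "v locally_integrable_on U"
  shows "(\<lambda>x. u x + c *\<^sub>R v x) locally_integrable_on U"
proof -
  have "integrable lebesgue (\<lambda>x. indicator K x *\<^sub>R u x + c *\<^sub>R indicator K x *\<^sub>R v x)"
    if "compact K" "K \<subseteq> U" for K
    using assms that
    by (intro Bochner_Integration.integrable_add integrable_scaleR_right)
       (auto simp: locally_integrable_on_def set_integrable_def)
  moreover have "indicator K x *\<^sub>R (u x + c *\<^sub>R v x) = indicator K x *\<^sub>R u x + c *\<^sub>R indicator K x *\<^sub>R v x"
    for K :: "'a set" and x by (simp add: scaleR_add_right)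
  ultimately show ?thesis
    by (simp add: locally_integrable_on_def set_integrable_def)
qed

lemma integrable_weak_gradient_terms:
  assumes U: "open U" and g: "g locally_integrable_on U" and \<psi>: "test_function U \<psi>"
  shows "integrable (lebesgue_on U) (\<lambda>x. (g x \<bullet> b) * \<psi> x)"
proof -
  obtain K where K: "compact K" "K \<subseteq> U"
      "\<forall>x. x \<notin> K \<longrightarrow> \<psi> x = 0 \<and> (\<forall>b. frechet_derivative \<psi> (at x) b = 0)"
    using test_function_support[OF \<psi>] by blast
  have "(\<lambda>x. g x \<bullet> b) locally_integrable_on U"
    by (rule locally_integrable_on_inner[OF g])
  from integrable_lebesgue_on_mult_compact_support[OF this U
      smooth_continuous[OF test_function_smooth[OF \<psi>]] K(1,2)] K(3)
  show ?thesis by simp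
qed

lemma integrable_weak_gradient_terms':
  assumes U: "open U" and u: "u locally_integrable_on U" and \<psi>: "test_function U \<psi>" and b: "b \<in> Basis"
  shows "integrable (lebesgue_on U) (\<lambda>x. u x * partial b \<psi> x)"
proof -
  obtain K where K: "compact K" "K \<subseteq> U"
      "\<forall>x. x \<notin> K \<longrightarrow> \<psi> x = 0 \<and> (\<forall>b. frechet_derivative \<psi> (at x) b = 0)"
    using test_function_support[OF \<psi>] by blast
  from integrable_lebesgue_on_mult_compact_support[OF u U
      smooth_continuous[OF smooth_partial[OF test_function_smooth[OF \<psi>] b]] K(1,2)] K(3)
  show ?thesis by simp
qed

lemma AE_eq_if_AE_inner_Basis_eq:
  fixes g g' :: "'c \<Rightarrow> 'a::euclidean_space"
  assumes "\<And>b. b \<in> Basis \<Longrightarrow> AE x in M. (g x - g' x) \<bullet> b = 0"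
  shows "AE x in M. g x = g' x"
proof -
  have "AE x in M. \<forall>b\<in>Basis. (g x - g' x) \<bullet> b = 0"
    using assms countable_finite[OF finite_Basis] by (subst AE_ball_countable) auto
  then show ?thesis
    by eventually_elim (simp add: euclidean_eq_iff[of "g _"] inner_diff_left)
qed

lemma has_weak_gradient_unique:
  assumes U: "open U" and g: "has_weak_gradient U u g" "has_weak_gradient U u g'"
  shows "AE x in lebesgue_on U. g x = g' x"
proof (rule AE_eq_if_AE_inner_Basis_eq, rule fundamental_lemma_calculus_of_variations[OF U])
  fix b :: 'a assume b: "b \<in> Basis"
  have loc: "g locally_integrable_on U" "g' locally_integrable_on U"
    using g by (auto simp: has_weak_gradient_def)
  then show "(\<lambda>x. (g x - g' x) \<bullet> b) locally_integrable_on U"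
    using locally_integrable_on_inner[OF locally_integrable_on_add_scaled[of g U g' "-1"]] by simp
  fix \<psi> assume \<psi>: "test_function U \<psi>"
  show "(\<integral>x. (g x - g' x) \<bullet> b * \<psi> x \<partial>lebesgue_on U) = 0"
    using integrable_weak_gradient_terms[OF U loc(1) \<psi>, of b]
      integrable_weak_gradient_terms[OF U loc(2) \<psi>, of b] g \<psi> b
    by (simp add: inner_diff_left left_diff_distrib has_weak_gradient_def)
qed

lemma has_weak_gradient_weak_gradient:
  "has_weak_gradient U u g \<Longrightarrow> has_weak_gradient U u (weak_gradient U u)"
  unfolding weak_gradient_def by (rule someI[of "has_weak_gradient U u"])

lemma AE_weak_gradient_eq:
  "open U \<Longrightarrow> has_weak_gradient U u g \<Longrightarrow> AE x in lebesgue_on U. weak_gradient U u x = g x"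
  using has_weak_gradient_unique has_weak_gradient_weak_gradient by blast

lemma has_weak_gradient_add_scaled:
  assumes U: "open U" and u: "has_weak_gradient U u g" and v: "has_weak_gradient U v k"
  shows "has_weak_gradient U (\<lambda>x. u x + c * v x) (\<lambda>x. g x + c *\<^sub>R k x)"
  unfolding has_weak_gradient_def
proof (intro conjI allI impI ballI)
  have loc: "u locally_integrable_on U" "v locally_integrable_on U"
     "g locally_integrable_on U" "k locally_integrable_on U"
    using u v by (auto simp: has_weak_gradient_def)
  show "(\<lambda>x. u x + c * v x) locally_integrable_on U" "(\<lambda>x. g x + c *\<^sub>R k x) locally_integrable_on U"
    using locally_integrable_on_add_scaled[of u U v c] locally_integrable_on_add_scaled[of g U k c] loc
    by auto
  fix \<psi> and b :: 'a assume \<psi>: "test_function U \<psi>" and b: "b \<in> Basis"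
  have eq: "(u x + c * v x) * partial b \<psi> x = u x * partial b \<psi> x + c * (v x * partial b \<psi> x)"
      "((g x + c *\<^sub>R k x) \<bullet> b) * \<psi> x = (g x \<bullet> b) * \<psi> x + c * ((k x \<bullet> b) * \<psi> x)" for x
    by (simp_all add: algebra_simps inner_add_left)
  show "(\<integral>x. (u x + c * v x) * partial b \<psi> x \<partial>lebesgue_on U) = - (\<integral>x. ((g x + c *\<^sub>R k x) \<bullet> b) * \<psi> x \<partial>lebesgue_on U)"
    unfolding eq
    using integrable_weak_gradient_terms'[OF U loc(1) \<psi> b] integrable_weak_gradient_terms'[OF U loc(2) \<psi> b]
      integrable_weak_gradient_terms[OF U loc(3) \<psi>, of b] integrable_weak_gradient_terms[OF U loc(4) \<psi>, of b]
      u v \<psi> b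
    by (simp add: has_weak_gradient_def)
qed

section \<open>The unit interval as a probability space\<close>

definition unit_measure :: "real measure" where
  "unit_measure = density lborel (\<lambda>t. ennreal (indicator {0..1} t))"

lemma sets_unit_measure [measurable_cong, simp]: "sets unit_measure = sets borel"
  and space_unit_measure [simp]: "space unit_measure = UNIV"
  by (simp_all add: unit_measure_def)

lemma emeasure_unit_measure [simp]: "emeasure unit_measure UNIV = 1"
  by (simp add: unit_measure_def emeasure_density ennreal_indicator)

lemma sigma_finite_unit_measure: "sigma_finite_measure unit_measure"
proof -
  interpret finite_measure unit_measure
    by standard simp
  show ?thesis by unfold_locales
qed

lemma pair_sigma_finite_unit_measure: "pair_sigma_finite unit_measure lborel"
  by (intro pair_sigma_finite.intro sigma_finite_unit_measure sigma_finite_lborel)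

lemma AE_unit_measure: "AE t in unit_measure. 0 \<le> t \<and> t \<le> 1"
  unfolding unit_measure_def by (subst AE_density) (auto split: split_indicator)

text \<open>Jensen's inequality for the square. If \<open>F\<close> is not integrable, the left side is \<open>0\<close> by convention.\<close>

lemma integral_unit_measure_square_le:
  fixes F :: "real \<Rightarrow> real"
  assumes [measurable]: "F \<in> borel_measurable borel"
  shows "ennreal ((\<integral>t. F t \<partial>unit_measure)\<^sup>2) \<le> (\<integral>\<^sup>+t. ennreal ((F t)\<^sup>2) \<partial>unit_measure)"
proof -
  have "ennreal \<bar>\<integral>t. F t \<partial>unit_measure\<bar> \<le> (\<integral>\<^sup>+t. ennreal \<bar>F t\<bar> \<partial>unit_measure)"
    using integral_norm_bound_ennreal[of unit_measure F]
    by (cases "integrable unit_measure F") (auto simp: not_integrable_integral_eq)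
  then have "(ennreal \<bar>\<integral>t. F t \<partial>unit_measure\<bar>)\<^sup>2 \<le> (\<integral>\<^sup>+t. ennreal \<bar>F t\<bar> * 1 \<partial>unit_measure)\<^sup>2"
    by (simp add: power_mono)
  also have "\<dots> \<le> (\<integral>\<^sup>+t. (ennreal \<bar>F t\<bar>)\<^sup>2 \<partial>unit_measure) * (\<integral>\<^sup>+t. 1\<^sup>2 \<partial>unit_measure)"
    by (rule Cauchy_Schwarz_nn_integral) auto
  finally show ?thesis
    by (simp add: ennreal_power)
qed

section \<open>Differences along segments\<close>

lemma nn_integral_lborel_translate:
  fixes a :: "'a::euclidean_space"
  assumes [measurable]: "F \<in> borel_measurable borel"
  shows "(\<integral>\<^sup>+x. F (x + a) \<partial>lborel) = (\<integral>\<^sup>+x. F x \<partial>lborel)"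
proof -
  have "(\<integral>\<^sup>+x. F x \<partial>lborel) = (\<integral>\<^sup>+x. F x \<partial>distr lborel borel ((+) a))"
    by (simp add: lborel_distr_plus)
  also have "\<dots> = (\<integral>\<^sup>+x. F (x + a) \<partial>lborel)"
    by (subst nn_integral_distr) (auto simp: add.commute)
  finally show ?thesis ..
qed

lemma integral_lborel_translate:
  fixes a :: "'a::euclidean_space" and F :: "'a \<Rightarrow> real"
  assumes [measurable]: "F \<in> borel_measurable borel"
  shows "(\<integral>x. F (x + a) \<partial>lborel) = (\<integral>x. F x \<partial>lborel)"
proof -
  have "(\<integral>x. F x \<partial>lborel) = (\<integral>x. F x \<partial>distr lborel borel ((+) a))"
    by (simp add: lborel_distr_plus)
  also have "\<dots> = (\<integral>x. F (x + a) \<partial>lborel)"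
    by (subst integral_distr) (auto simp: add.commute)
  finally show ?thesis ..
qed

lemma integrable_lborel_translate:
  fixes a :: "'a::euclidean_space" and F :: "'a \<Rightarrow> 'b::{banach, second_countable_topology}"
  assumes "integrable lborel F"
  shows "integrable lborel (\<lambda>x. F (x + a))"
proof -
  have "F \<in> borel_measurable borel"
    using assms by auto
  note this[measurable]
  have "(\<lambda>x. F (x + a)) \<in> borel_measurable borel"
    by measurable
  then show ?thesis
    using assms nn_integral_lborel_translate[of "\<lambda>x. ennreal (norm (F x))" a]
    by (simp add: integrable_iff_bounded)
qed

lemma frechet_derivative_eq_sum:
  fixes \<psi> :: "'a::euclidean_space \<Rightarrow> real"
  assumes "smooth \<psi>"
  shows "frechet_derivative \<psi> (at y) h = (\<Sum>b\<in>Basis. (h \<bullet> b) * partial b \<psi> y)"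
proof -
  interpret linear "frechet_derivative \<psi> (at y)"
    using smooth_differentiable[OF assms] by (rule linear_frechet_derivative)
  have "frechet_derivative \<psi> (at y) h = frechet_derivative \<psi> (at y) (\<Sum>b\<in>Basis. (h \<bullet> b) *\<^sub>R b)"
    by (simp add: euclidean_representation)
  then show ?thesis
    by (simp add: sum scale)
qed

lemma continuous_frechet_derivative:
  fixes \<psi> :: "'a::euclidean_space \<Rightarrow> real"
  assumes "smooth \<psi>"
  shows "continuous_on S (\<lambda>y. frechet_derivative \<psi> (at y) h)"
proof -
  have "continuous_on S (\<lambda>y. (h \<bullet> b) * partial b \<psi> y)" if "b \<in> Basis" for b
    using smooth_continuous[OF smooth_partial[OF assms that]] by (rule continuous_on_mult_left)
  then have "continuous_on S (\<lambda>y. \<Sum>b\<in>Basis. (h \<bullet> b) * partial b \<psi> y)"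
    by (rule continuous_on_sum)
  moreover have "(\<lambda>y. frechet_derivative \<psi> (at y) h) = (\<lambda>y. \<Sum>b\<in>Basis. (h \<bullet> b) * partial b \<psi> y)"
    by (intro ext frechet_derivative_eq_sum assms)
  ultimately show ?thesis
    by (simp only:)
qed

lemma integral_directional_derivative:
  fixes \<psi> :: "'a::euclidean_space \<Rightarrow> real"
  assumes \<psi>: "smooth \<psi>"
  shows "(\<integral>t. frechet_derivative \<psi> (at (x + t *\<^sub>R h)) h \<partial>unit_measure) = \<psi> (x + h) - \<psi> x"
proof -
  let ?d = "\<lambda>t. frechet_derivative \<psi> (at (x + t *\<^sub>R h)) h"
  have cont: "continuous_on S ?d" for S
    by (rule continuous_on_compose2[OF continuous_frechet_derivative[OF \<psi>, of UNIV]])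
       (auto intro!: continuous_intros)
  have "((\<lambda>t. \<psi> (x + t *\<^sub>R h)) has_vector_derivative ?d t) (at t within A)" for t A
  proof -
    have 1: "((\<lambda>t. x + t *\<^sub>R h) has_derivative (\<lambda>s. s *\<^sub>R h)) (at t within A)"
      by (auto intro!: derivative_eq_intros)
    have 2: "(\<psi> has_derivative frechet_derivative \<psi> (at (x + t *\<^sub>R h))) (at (x + t *\<^sub>R h))"
      using smooth_differentiable[OF \<psi>] by (simp add: frechet_derivative_works[symmetric])
    have "linear (frechet_derivative \<psi> (at (x + t *\<^sub>R h)))"
      using smooth_differentiable[OF \<psi>] by (rule linear_frechet_derivative)
    then show ?thesis
      unfolding has_vector_derivative_def using has_derivative_compose[OF 1 2]
      by (simp add: linear_cmul)
  qed
  from integral_FTC_atLeastAtMost[of 0 1 "\<lambda>t. \<psi> (x + t *\<^sub>R h)" ?d, OF _ this cont]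
  have "(\<integral>t. indicator {0..1} t *\<^sub>R ?d t \<partial>lborel) = \<psi> (x + h) - \<psi> x"
    by simp
  moreover have [measurable]: "?d \<in> borel_measurable borel"
    using cont by (rule borel_measurable_continuous_onI)
  ultimately show ?thesis
    unfolding unit_measure_def by (subst integral_density) auto
qed

text \<open>The integrands below are translated along a segment by \<open>t\<close>; translation invariance and the
  boundedness of test functions bound their slices uniformly in \<open>t\<close>, which is enough for Fubini.\<close>

lemma integrable_unit_measure_pair:
  fixes F :: "real \<times> 'a::euclidean_space \<Rightarrow> real"
  assumes [measurable]: "F \<in> borel_measurable (borel \<Otimes>\<^sub>M borel)"
    and bound: "\<And>t. (\<integral>\<^sup>+x. ennreal \<bar>F (t, x)\<bar> \<partial>lborel) \<le> ennreal B"
  shows "integrable (unit_measure \<Otimes>\<^sub>M lborel) F"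
proof (rule integrableI_bounded)
  interpret pair_sigma_finite unit_measure "lborel :: 'a measure"
    by (rule pair_sigma_finite_unit_measure)
  show [measurable]: "F \<in> borel_measurable (unit_measure \<Otimes>\<^sub>M lborel)"
    by measurable
  have "(\<integral>\<^sup>+p. ennreal (norm (F p)) \<partial>(unit_measure \<Otimes>\<^sub>M lborel))
      = (\<integral>\<^sup>+t. \<integral>\<^sup>+x. ennreal \<bar>F (t, x)\<bar> \<partial>lborel \<partial>unit_measure)"
    by (subst sigma_finite_measure.nn_integral_fst[OF sigma_finite_lborel, symmetric]) auto
  also have "\<dots> \<le> (\<integral>\<^sup>+t. ennreal B \<partial>unit_measure)"
    by (intro nn_integral_mono bound)
  finally show "(\<integral>\<^sup>+p. ennreal (norm (F p)) \<partial>(unit_measure \<Otimes>\<^sub>M lborel)) < \<infinity>"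
    by (simp add: order_le_less_trans)
qed

text \<open>A Borel representative of a Sobolev pair, extended by 0, so that Fubini and translations
  are available on the whole space.\<close>

definition borel_weak_gradient :: "'a::euclidean_space set \<Rightarrow> ('a \<Rightarrow> real) \<Rightarrow> ('a \<Rightarrow> 'a) \<Rightarrow> bool" where
  "borel_weak_gradient U u g \<longleftrightarrow>
     integrable lborel u \<and> integrable lborel g \<and> (\<forall>x. x \<notin> U \<longrightarrow> u x = 0 \<and> g x = 0) \<and>
     (\<forall>\<psi> b. test_function U \<psi> \<longrightarrow> b \<in> Basis \<longrightarrow>
        (\<integral>x. u x * partial b \<psi> x \<partial>lborel) = - (\<integral>x. (g x \<bullet> b) * \<psi> x \<partial>lborel))"

lemma test_function_translate:
  assumes \<psi>: "test_function V \<psi>" and sub: "\<And>x. x \<in> V \<Longrightarrow> x - a \<in> U"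
  shows "test_function U (\<lambda>x. \<psi> (x + a))"
proof -
  have "{x. \<psi> (x + a) \<noteq> 0} = (\<lambda>x. - a + x) ` {x. \<psi> x \<noteq> 0}"
  proof (intro set_eqI iffI)
    fix x assume "x \<in> {x. \<psi> (x + a) \<noteq> 0}"
    then show "x \<in> (\<lambda>x. - a + x) ` {x. \<psi> x \<noteq> 0}"
      by (intro image_eqI[of _ _ "x + a"]) auto
  qed auto
  then have *: "closure {x. \<psi> (x + a) \<noteq> 0} = (\<lambda>x. - a + x) ` closure {x. \<psi> x \<noteq> 0}"
    by (simp only: closure_translation)
  show ?thesis
    unfolding test_function_def *
  proof (intro conjI)
    show "smooth (\<lambda>x. \<psi> (x + a))"
      using \<psi> by (simp add: test_function_def smooth_translate)
    show "compact ((+) (- a) ` closure {x. \<psi> x \<noteq> 0})"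
      using \<psi> by (intro compact_translation) (simp add: test_function_def)
    have "closure {x. \<psi> x \<noteq> 0} \<subseteq> V"
      using \<psi> by (simp add: test_function_def)
    then show "(+) (- a) ` closure {x. \<psi> x \<noteq> 0} \<subseteq> U"
      using sub by fastforce
  qed
qed

lemma integrable_mult_bounded:
  fixes u \<rho> :: "'c \<Rightarrow> real"
  assumes u: "integrable M u" and \<rho>: "\<rho> \<in> borel_measurable M" "\<And>x. \<bar>\<rho> x\<bar> \<le> C"
  shows "integrable M (\<lambda>x. u x * \<rho> x)"
proof (rule Bochner_Integration.integrable_bound)
  show "integrable M (\<lambda>x. C * u x)" using u by simp
  show "(\<lambda>x. u x * \<rho> x) \<in> borel_measurable M" using u \<rho> by measurable
  show "AE x in M. norm (u x * \<rho> x) \<le> norm (C * u x)"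
  proof (intro AE_I2)
    fix x
    have "\<bar>u x\<bar> * \<bar>\<rho> x\<bar> \<le> \<bar>u x\<bar> * \<bar>C\<bar>"
      using \<rho>(2)[of x] by (intro mult_left_mono) auto
    then show "norm (u x * \<rho> x) \<le> norm (C * u x)"
      by (simp add: abs_mult mult.commute)
  qed
qed

text \<open>Integrating the definition of the weak gradient along the translates of a test function
  identifies the difference along \<open>h\<close> with the average of the gradient over the segment.\<close>

theorem weak_gradient_along_segment:
  fixes u :: "'a::euclidean_space \<Rightarrow> real"
  assumes bw: "borel_weak_gradient U u g" and V: "open V"
    and seg: "\<And>x t. x \<in> V \<Longrightarrow> 0 \<le> t \<Longrightarrow> t \<le> 1 \<Longrightarrow> x + t *\<^sub>R h \<in> U"
  shows "AE x in lborel. x \<in> V \<longrightarrow> u (x + h) - u x = (\<integral>t. g (x + t *\<^sub>R h) \<bullet> h \<partial>unit_measure)"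
proof -
  interpret pair_sigma_finite unit_measure "lborel :: 'a measure"
    by (rule pair_sigma_finite_unit_measure)
  have iu: "integrable lborel u" and ig: "integrable lborel g"
    and wg: "\<And>\<psi> b. test_function U \<psi> \<Longrightarrow> b \<in> Basis \<Longrightarrow>
      (\<integral>x. u x * partial b \<psi> x \<partial>lborel) = - (\<integral>x. (g x \<bullet> b) * \<psi> x \<partial>lborel)"
    using bw unfolding borel_weak_gradient_def by blast+
  have [measurable]: "u \<in> borel_measurable borel" "g \<in> borel_measurable borel"
    using iu ig by auto
  define N where "N = (\<integral>x. norm (g x) \<partial>lborel)"
  have N: "(\<integral>\<^sup>+x. ennreal (norm (g x)) \<partial>lborel) = ennreal N" "N \<ge> 0"
    using ig by (auto simp: N_def nn_integral_eq_integral)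
  have gt: "(\<integral>\<^sup>+x. ennreal (norm (g (x + t *\<^sub>R h))) \<partial>lborel) = ennreal N" for t
    using nn_integral_lborel_translate[of "\<lambda>x. ennreal (norm (g x))" "t *\<^sub>R h"] N by simp
  let ?F = "\<lambda>(t, x). g (x + t *\<^sub>R h) \<bullet> h"
  have F: "integrable (unit_measure \<Otimes>\<^sub>M lborel) ?F"
  proof (rule integrable_unit_measure_pair)
    fix t
    have "(\<integral>\<^sup>+x. ennreal \<bar>g (x + t *\<^sub>R h) \<bullet> h\<bar> \<partial>lborel)
        \<le> (\<integral>\<^sup>+x. ennreal (norm h) * ennreal (norm (g (x + t *\<^sub>R h))) \<partial>lborel)"
      by (intro nn_integral_mono)
         (simp add: ennreal_mult[symmetric] Cauchy_Schwarz_ineq2 mult.commute[of "norm h"])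
    also have "\<dots> = ennreal (norm h * N)"
      using N by (simp add: nn_integral_cmult gt ennreal_mult)
    finally show "(\<integral>\<^sup>+x. ennreal \<bar>?F (t, x)\<bar> \<partial>lborel) \<le> ennreal (norm h * N)"
      by simp
  qed measurable
  define G where "G x = (\<integral>t. g (x + t *\<^sub>R h) \<bullet> h \<partial>unit_measure)" for x
  have iG: "integrable lborel G"
    using integrable_snd[OF F] by (simp add: G_def[abs_def])
  define w where "w x = u (x + h) - u x - G x" for x
  have iw: "integrable lborel w"
    unfolding w_def using iu iG integrable_lborel_translate[OF iu] by auto
  have "AE x in lebesgue_on V. w x = 0"
  proof (rule fundamental_lemma_calculus_of_variations[OF V])
    have "integrable lebesgue w"
      using iw integrable_completion[of w lborel] by auto
    then show "w locally_integrable_on V"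
      unfolding locally_integrable_on_def set_integrable_def
      by (intro allI impI integrable_mult_indicator fmeasurableD lmeasurable_compact) auto
    fix \<psi> assume \<psi>: "test_function V \<psi>"
    have s: "smooth \<psi>" using \<psi> by (rule test_function_smooth)
    have [measurable]: "\<psi> \<in> borel_measurable borel"
      using s by (rule borel_measurable_smooth)
    have [measurable]: "(\<lambda>y. frechet_derivative \<psi> (at y) k) \<in> borel_measurable borel" for k
      by (intro borel_measurable_continuous_onI continuous_frechet_derivative s)
    obtain C where C: "C \<ge> 0" "\<forall>x. \<bar>\<psi> x\<bar> \<le> C"
      using test_function_bounded[OF \<psi>] by blast
    \<comment> \<open>The derivative is taken in direction \<open>- h\<close> because moving \<open>u\<close> by \<open>h\<close> moves the test function by \<open>- h\<close>.\<close>
    have "\<exists>C'\<ge>0. \<forall>x. \<bar>frechet_derivative \<psi> (at x) (- h)\<bar> \<le> C'"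
    proof -
      obtain K where K: "compact K" "K \<subseteq> V"
          "\<forall>x. x \<notin> K \<longrightarrow> \<psi> x = 0 \<and> (\<forall>b. frechet_derivative \<psi> (at x) b = 0)"
        using test_function_support[OF \<psi>] by blast
      show ?thesis
        by (rule bounded_if_compact_support[OF continuous_frechet_derivative[OF s] K(1)])
           (simp add: K(3))
    qed
    then obtain C' where C': "C' \<ge> 0" "\<forall>x. \<bar>frechet_derivative \<psi> (at x) (- h)\<bar> \<le> C'"
      by blast
    let ?A = "\<lambda>(t, y). u y * frechet_derivative \<psi> (at (y + t *\<^sub>R (- h))) (- h)"
    let ?B = "\<lambda>(t, x). (g (x + t *\<^sub>R h) \<bullet> h) * \<psi> x"
    have A: "integrable (unit_measure \<Otimes>\<^sub>M lborel) ?A"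
    proof (rule integrable_unit_measure_pair)
      fix t
      have "(\<integral>\<^sup>+y. ennreal \<bar>?A (t, y)\<bar> \<partial>lborel) \<le> (\<integral>\<^sup>+y. ennreal (C' * \<bar>u y\<bar>) \<partial>lborel)"
        using C' by (intro nn_integral_mono ennreal_leI) (simp add: abs_mult mult.commute[of C'] mult_left_mono)
      also have "\<dots> = ennreal (\<integral>y. C' * \<bar>u y\<bar> \<partial>lborel)"
        using iu C' by (intro nn_integral_eq_integral) auto
      finally show "(\<integral>\<^sup>+y. ennreal \<bar>?A (t, y)\<bar> \<partial>lborel) \<le> ennreal (\<integral>y. C' * \<bar>u y\<bar> \<partial>lborel)" .
    qed measurable
    have B: "integrable (unit_measure \<Otimes>\<^sub>M lborel) ?B"
    proof (rule integrable_unit_measure_pair)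
      fix t
      have "(\<integral>\<^sup>+x. ennreal \<bar>?B (t, x)\<bar> \<partial>lborel)
          \<le> (\<integral>\<^sup>+x. ennreal (norm h * C) * ennreal (norm (g (x + t *\<^sub>R h))) \<partial>lborel)"
      proof (intro nn_integral_mono)
        fix x
        have "\<bar>g (x + t *\<^sub>R h) \<bullet> h\<bar> * \<bar>\<psi> x\<bar> \<le> (norm (g (x + t *\<^sub>R h)) * norm h) * C"
          using C by (intro mult_mono Cauchy_Schwarz_ineq2) auto
        then show "ennreal \<bar>?B (t, x)\<bar> \<le> ennreal (norm h * C) * ennreal (norm (g (x + t *\<^sub>R h)))"
          using C(1) by (simp add: ennreal_mult[symmetric] abs_mult algebra_simps)
      qed
      also have "\<dots> = ennreal (norm h * C * N)"
        using N C by (simp add: nn_integral_cmult gt ennreal_mult)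
      finally show "(\<integral>\<^sup>+x. ennreal \<bar>?B (t, x)\<bar> \<partial>lborel) \<le> ennreal (norm h * C * N)" .
    qed measurable
    \<comment> \<open>For fixed \<open>t\<close> the translate of \<open>\<psi>\<close> is a test function on \<open>U\<close>, and this is the weak gradient identity for it.\<close>
    have AB: "(\<integral>y. ?A (t, y) \<partial>lborel) = (\<integral>x. ?B (t, x) \<partial>lborel)" if t: "0 \<le> t \<and> t \<le> 1" for t
    proof -
      let ?\<psi>t = "\<lambda>y. \<psi> (y + t *\<^sub>R (- h))"
      have tt: "test_function U ?\<psi>t"
        using \<psi> by (rule test_function_translate) (use seg t in auto)
      have st: "smooth ?\<psi>t" using tt by (rule test_function_smooth)
      have [measurable]: "?\<psi>t \<in> borel_measurable borel"
        using st by (rule borel_measurable_smooth)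
      have d: "frechet_derivative \<psi> (at (y + t *\<^sub>R (- h))) (- h) = frechet_derivative ?\<psi>t (at y) (- h)" for y
        using partial_translate[OF smooth_differentiable[OF s], where b = "- h" and a = "t *\<^sub>R (- h)" and x = y] by simp
      have i1: "integrable lborel (\<lambda>y. u y * partial b ?\<psi>t y)" if b: "b \<in> Basis" for b
      proof -
        obtain D where "D \<ge> 0" "\<forall>x. \<bar>partial b ?\<psi>t x\<bar> \<le> D"
          using test_function_partial_bounded[OF tt b] by blast
        then show ?thesis
          using iu borel_measurable_smooth[OF smooth_partial[OF st b]]
          by (intro integrable_mult_bounded[where C = D]) auto
      qed
      have i2: "integrable lborel (\<lambda>y. (g y \<bullet> b) * ?\<psi>t y)" for b
        using ig C by (intro integrable_mult_bounded[where C = C]) auto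
      have "?A (t, y) = (\<Sum>b\<in>Basis. (- (h \<bullet> b)) * (u y * partial b ?\<psi>t y))" for y
        using frechet_derivative_eq_sum[OF st, of y "- h"]
        unfolding prod.case d by (simp only: sum_distrib_left inner_minus_left mult.left_commute)
      then have "(\<integral>y. ?A (t, y) \<partial>lborel) = (\<integral>y. (\<Sum>b\<in>Basis. (- (h \<bullet> b)) * (u y * partial b ?\<psi>t y)) \<partial>lborel)"
        by (simp only:)
      also have "\<dots> = (\<Sum>b\<in>Basis. (- (h \<bullet> b)) * (\<integral>y. u y * partial b ?\<psi>t y \<partial>lborel))"
        using i1 by (subst Bochner_Integration.integral_sum) auto
      also have "\<dots> = (\<Sum>b\<in>Basis. (h \<bullet> b) * (\<integral>y. (g y \<bullet> b) * ?\<psi>t y \<partial>lborel))"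
        using wg[OF tt] by (intro sum.cong) auto
      also have "\<dots> = (\<integral>y. (\<Sum>b\<in>Basis. (h \<bullet> b) * ((g y \<bullet> b) * ?\<psi>t y)) \<partial>lborel)"
        using i2 by (subst Bochner_Integration.integral_sum) auto
      also have "\<dots> = (\<integral>y. (g y \<bullet> h) * ?\<psi>t y \<partial>lborel)"
        by (simp add: euclidean_inner[of "g _" h] sum_distrib_right sum_distrib_left algebra_simps)
      also have "\<dots> = (\<integral>x. (g (x + t *\<^sub>R h) \<bullet> h) * ?\<psi>t (x + t *\<^sub>R h) \<partial>lborel)"
        by (rule integral_lborel_translate[symmetric]) measurable
      finally show ?thesis by simp
    qed
    have [measurable]: "(\<lambda>x. \<psi> (x + - h)) \<in> borel_measurable borel"
      by measurable
    have bnd: "\<bar>\<psi> (x + - h)\<bar> \<le> C" for x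
      using C by auto
    have i3: "integrable lborel (\<lambda>y. u y * \<psi> (y + - h))" "integrable lborel (\<lambda>y. u y * \<psi> y)"
      using iu C bnd by (auto intro!: integrable_mult_bounded[where C = C])
    have i4: "integrable lborel (\<lambda>x. u (x + h) * \<psi> x)"
      using integrable_lborel_translate[OF i3(1), of h] by simp
    have i5: "integrable lborel (\<lambda>x. G x * \<psi> x)"
      using iG C by (intro integrable_mult_bounded[where C = C]) auto
    have "(\<integral>x. u (x + h) * \<psi> x \<partial>lborel) = (\<integral>y. u y * \<psi> (y + - h) \<partial>lborel)"
      using integral_lborel_translate[of "\<lambda>y. u y * \<psi> (y + - h)" h] by simp
    then have "(\<integral>x. u (x + h) * \<psi> x \<partial>lborel) - (\<integral>x. u x * \<psi> x \<partial>lborel)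
        = (\<integral>y. u y * (\<psi> (y + - h) - \<psi> y) \<partial>lborel)"
      using i3 by (simp add: right_diff_distrib)
    also have "\<dots> = (\<integral>y. (\<integral>t. ?A (t, y) \<partial>unit_measure) \<partial>lborel)"
      unfolding integral_directional_derivative[OF s, symmetric] by simp
    also have "\<dots> = (\<integral>t. (\<integral>y. ?A (t, y) \<partial>lborel) \<partial>unit_measure)"
      using Fubini_integral[OF A] by simp
    also have "\<dots> = (\<integral>t. (\<integral>x. ?B (t, x) \<partial>lborel) \<partial>unit_measure)"
    proof (rule integral_cong_AE)
      show "AE t in unit_measure. (\<integral>y. ?A (t, y) \<partial>lborel) = (\<integral>x. ?B (t, x) \<partial>lborel)"
        using AE_unit_measure by eventually_elim (rule AB)
    qed measurable
    also have "\<dots> = (\<integral>x. (\<integral>t. ?B (t, x) \<partial>unit_measure) \<partial>lborel)"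
      using Fubini_integral[OF B] by simp
    also have "\<dots> = (\<integral>x. G x * \<psi> x \<partial>lborel)"
      by (simp add: G_def)
    finally have "(\<integral>x. w x * \<psi> x \<partial>lborel) = 0"
      using i3 i4 i5 by (simp add: w_def left_diff_distrib)
    moreover have "(\<integral>x. w x * \<psi> x \<partial>lebesgue_on V) = (\<integral>x. w x * \<psi> x \<partial>lborel)"
    proof -
      obtain K where K: "compact K" "K \<subseteq> V"
          "\<forall>x. x \<notin> K \<longrightarrow> \<psi> x = 0 \<and> (\<forall>b. frechet_derivative \<psi> (at x) b = 0)"
        using test_function_support[OF \<psi>] by blast
      then have z: "indicator V x *\<^sub>R (w x * \<psi> x) = w x * \<psi> x" for x
        by (cases "x \<in> K") (auto split: split_indicator)
      have [measurable]: "w \<in> borel_measurable borel" using iw by auto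
      show ?thesis
        unfolding integral_lebesgue_on_eq[OF V] z by (rule integral_completion) measurable
    qed
    ultimately show "(\<integral>x. w x * \<psi> x \<partial>lebesgue_on V) = 0"
      by simp
  qed
  then have "AE x in lebesgue. x \<in> V \<longrightarrow> w x = 0"
    by (simp add: AE_lebesgue_on_iff[OF V])
  then have "AE x in lborel. x \<in> V \<longrightarrow> w x = 0"
    by (simp add: AE_completion_iff)
  then show ?thesis
    by eventually_elim (simp add: w_def G_def)
qed

text \<open>Every translate \<open>t *\<^sub>R h\<close> along the segment contributes the same integral of the squared
  gradient, so the average over \<open>t\<close> costs nothing.\<close>

corollary nn_integral_difference_square_le:
  fixes u :: "'a::euclidean_space \<Rightarrow> real"
  assumes bw: "borel_weak_gradient U u g" and V: "open V"
    and seg: "\<And>x t. x \<in> V \<Longrightarrow> 0 \<le> t \<Longrightarrow> t \<le> 1 \<Longrightarrow> x + t *\<^sub>R h \<in> U"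
  shows "(\<integral>\<^sup>+x\<in>V. ennreal ((u (x + h) - u x)\<^sup>2) \<partial>lborel)
    \<le> ennreal ((norm h)\<^sup>2) * (\<integral>\<^sup>+x. ennreal ((norm (g x))\<^sup>2) \<partial>lborel)"
proof -
  interpret pair_sigma_finite unit_measure "lborel :: 'a measure"
    by (rule pair_sigma_finite_unit_measure)
  have [measurable]: "u \<in> borel_measurable borel" "g \<in> borel_measurable borel"
    using bw unfolding borel_weak_gradient_def by auto
  have along: "AE x in lborel. x \<in> V \<longrightarrow> u (x + h) - u x = (\<integral>t. g (x + t *\<^sub>R h) \<bullet> h \<partial>unit_measure)"
    by (rule weak_gradient_along_segment[OF bw V]) (rule seg)
  have "(\<integral>\<^sup>+x\<in>V. ennreal ((u (x + h) - u x)\<^sup>2) \<partial>lborel)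
      \<le> (\<integral>\<^sup>+x. (\<integral>\<^sup>+t. ennreal ((norm h)\<^sup>2) * ennreal ((norm (g (x + t *\<^sub>R h)))\<^sup>2) \<partial>unit_measure) \<partial>lborel)"
  proof (rule nn_integral_mono_AE)
    show "AE x in lborel. ennreal ((u (x + h) - u x)\<^sup>2) * indicator V x
      \<le> (\<integral>\<^sup>+t. ennreal ((norm h)\<^sup>2) * ennreal ((norm (g (x + t *\<^sub>R h)))\<^sup>2) \<partial>unit_measure)"
      using along
    proof eventually_elim
      case (elim x)
      show ?case
      proof (cases "x \<in> V")
        case True
        have "ennreal ((u (x + h) - u x)\<^sup>2) \<le> (\<integral>\<^sup>+t. ennreal ((g (x + t *\<^sub>R h) \<bullet> h)\<^sup>2) \<partial>unit_measure)"
          using True elim integral_unit_measure_square_le[of "\<lambda>t. g (x + t *\<^sub>R h) \<bullet> h"] by simp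
        also have "\<dots> \<le> (\<integral>\<^sup>+t. ennreal ((norm h)\<^sup>2) * ennreal ((norm (g (x + t *\<^sub>R h)))\<^sup>2) \<partial>unit_measure)"
        proof (intro nn_integral_mono)
          fix t
          have "\<bar>g (x + t *\<^sub>R h) \<bullet> h\<bar>\<^sup>2 \<le> (norm (g (x + t *\<^sub>R h)) * norm h)\<^sup>2"
            by (intro power_mono Cauchy_Schwarz_ineq2) auto
          then show "ennreal ((g (x + t *\<^sub>R h) \<bullet> h)\<^sup>2) \<le> ennreal ((norm h)\<^sup>2) * ennreal ((norm (g (x + t *\<^sub>R h)))\<^sup>2)"
            by (simp add: ennreal_mult[symmetric] power_mult_distrib mult.commute)
        qed
        finally show ?thesis using True by simp
      qed simp
    qed
  qed
  also have "\<dots> = (\<integral>\<^sup>+t. (\<integral>\<^sup>+x. ennreal ((norm h)\<^sup>2) * ennreal ((norm (g (x + t *\<^sub>R h)))\<^sup>2) \<partial>lborel) \<partial>unit_measure)"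
    by (rule Fubini') measurable
  also have "\<dots> = (\<integral>\<^sup>+t. ennreal ((norm h)\<^sup>2) * (\<integral>\<^sup>+x. ennreal ((norm (g x))\<^sup>2) \<partial>lborel) \<partial>unit_measure)"
    using nn_integral_lborel_translate[of "\<lambda>x. ennreal ((norm (g x))\<^sup>2)"]
    by (simp add: nn_integral_cmult)
  finally show ?thesis by simp
qed

section \<open>Smooth functions have a weak gradient\<close>

text \<open>Translation invariance gives \<open>\<integral>\<zeta> (x + b) - \<zeta> x = 0\<close>, and the left side is the integral of the
  derivative in direction \<open>b\<close>, averaged over translates that all have the same integral.\<close>

lemma integral_partial_compact_support:
  fixes \<zeta> :: "'a::euclidean_space \<Rightarrow> real"
  assumes s: "smooth \<zeta>" and K: "compact K" "\<And>x. x \<notin> K \<Longrightarrow> \<zeta> x = 0"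
  shows "(\<integral>x. partial b \<zeta> x \<partial>lborel) = 0"
proof -
  interpret pair_sigma_finite unit_measure "lborel :: 'a measure"
    by (rule pair_sigma_finite_unit_measure)
  let ?d = "\<lambda>y. frechet_derivative \<zeta> (at y) b"
  have cd: "continuous_on S ?d" for S by (rule continuous_frechet_derivative[OF s])
  then have [measurable]: "?d \<in> borel_measurable borel"
    by (rule borel_measurable_continuous_onI)
  have z: "?d x = 0" if "x \<notin> K" for x
    by (rule frechet_derivative_eq_0_outside[OF compact_imp_closed[OF K(1)] K(2) that])
  have int: "integrable lborel F" if F: "continuous_on UNIV F" "\<And>x. x \<notin> K \<Longrightarrow> F x = 0" for F :: "'a \<Rightarrow> real"
  proof -
    have "integrable lborel (\<lambda>x. indicator K x *\<^sub>R F x)"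
      using K F by (intro borel_integrable_compact) (auto intro: continuous_on_subset)
    also have "(\<lambda>x. indicator K x *\<^sub>R F x) = F"
      using F by (auto simp: fun_eq_iff split: split_indicator)
    finally show ?thesis .
  qed
  have id: "integrable lborel ?d" and iz: "integrable lborel \<zeta>"
    using int[OF cd z] int[OF smooth_continuous[OF s] K(2)] by auto
  have A: "integrable (unit_measure \<Otimes>\<^sub>M lborel) (\<lambda>(t, x). ?d (x + t *\<^sub>R b))"
  proof (rule integrable_unit_measure_pair)
    fix t
    have "(\<integral>\<^sup>+x. ennreal \<bar>?d (x + t *\<^sub>R b)\<bar> \<partial>lborel) = ennreal (\<integral>x. \<bar>?d x\<bar> \<partial>lborel)"
      using nn_integral_lborel_translate[of "\<lambda>x. ennreal \<bar>?d x\<bar>" "t *\<^sub>R b"] id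
      by (simp add: nn_integral_eq_integral)
    then show "(\<integral>\<^sup>+x. ennreal \<bar>(\<lambda>(t, x). ?d (x + t *\<^sub>R b)) (t, x)\<bar> \<partial>lborel) \<le> ennreal (\<integral>x. \<bar>?d x\<bar> \<partial>lborel)"
      by simp
  qed measurable
  have "0 = (\<integral>x. \<zeta> (x + b) \<partial>lborel) - (\<integral>x. \<zeta> x \<partial>lborel)"
    using integral_lborel_translate[of \<zeta> b] borel_measurable_smooth[OF s] by simp
  also have "\<dots> = (\<integral>x. \<zeta> (x + b) - \<zeta> x \<partial>lborel)"
    using iz integrable_lborel_translate[OF iz] by simp
  also have "\<dots> = (\<integral>x. (\<integral>t. ?d (x + t *\<^sub>R b) \<partial>unit_measure) \<partial>lborel)"
    unfolding integral_directional_derivative[OF s] ..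
  also have "\<dots> = (\<integral>t. (\<integral>x. ?d (x + t *\<^sub>R b) \<partial>lborel) \<partial>unit_measure)"
    using Fubini_integral[OF A] by simp
  also have "\<dots> = (\<integral>t. (\<integral>x. ?d x \<partial>lborel) \<partial>unit_measure)"
    by (intro Bochner_Integration.integral_cong refl integral_lborel_translate) measurable
  also have "\<dots> = (\<integral>x. ?d x \<partial>lborel)"
    by (simp add: measure_def)
  finally show ?thesis ..
qed

text \<open>Integration by parts is the preceding lemma for the product of \<open>\<phi>\<close> and the test function.\<close>

lemma smooth_has_weak_gradient:
  fixes \<phi> :: "'a::euclidean_space \<Rightarrow> real"
  assumes U: "open U" and s: "smooth \<phi>"
  shows "has_weak_gradient U \<phi> (grad \<phi>)"
proof -
  have cg: "continuous_on S (grad \<phi>)" for S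
    unfolding grad_def
    by (intro continuous_on_sum continuous_on_scaleR continuous_on_const
        smooth_continuous[OF smooth_partial[OF s]])
  have loc: "F locally_integrable_on U" if "\<And>S. continuous_on S F" for F :: "'a \<Rightarrow> 'b::euclidean_space"
    unfolding locally_integrable_on_def set_integrable_def
  proof (intro allI impI)
    fix K assume K: "compact K \<and> K \<subseteq> U"
    then have "integrable lborel (\<lambda>x. indicator K x *\<^sub>R F x)"
      using that by (intro borel_integrable_compact) auto
    then show "integrable lebesgue (\<lambda>x. indicator K x *\<^sub>R F x)"
      using integrable_completion[of "\<lambda>x. indicator K x *\<^sub>R F x" lborel]
        borel_measurable_integrable by blast
  qed
  have l: "\<phi> locally_integrable_on U" "grad \<phi> locally_integrable_on U"
    using loc[of \<phi>] loc[of "grad \<phi>"] smooth_continuous[OF s] cg by auto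
  show ?thesis
    unfolding has_weak_gradient_def
  proof (intro conjI allI impI ballI l)
    fix \<psi> and b :: 'a assume \<psi>: "test_function U \<psi>" and b: "b \<in> Basis"
    obtain K where K: "compact K" "K \<subseteq> U"
        "\<forall>x. x \<notin> K \<longrightarrow> \<psi> x = 0 \<and> (\<forall>b. frechet_derivative \<psi> (at x) b = 0)"
      using test_function_support[OF \<psi>] by blast
    have s\<psi>: "smooth \<psi>" using \<psi> by (rule test_function_smooth)
    have g: "grad \<phi> x \<bullet> b = partial b \<phi> x" for x
      using b by (simp add: grad_def inner_sum_left inner_Basis if_distrib sum.delta cong: if_cong)
    have "(\<integral>x. \<phi> x * partial b \<psi> x \<partial>lebesgue_on U) + (\<integral>x. (grad \<phi> x \<bullet> b) * \<psi> x \<partial>lebesgue_on U)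
       = (\<integral>x. \<phi> x * partial b \<psi> x + (grad \<phi> x \<bullet> b) * \<psi> x \<partial>lebesgue_on U)"
      using integrable_weak_gradient_terms[OF U l(2) \<psi>] integrable_weak_gradient_terms'[OF U l(1) \<psi> b]
      by simp
    also have "\<dots> = (\<integral>x. partial b (\<lambda>x. \<phi> x * \<psi> x) x \<partial>lebesgue_on U)"
      using s s\<psi> by (simp add: g frechet_derivative_mult_apply smooth_differentiable)
    also have "\<dots> = (\<integral>x. partial b (\<lambda>x. \<phi> x * \<psi> x) x \<partial>lebesgue)"
      unfolding integral_lebesgue_on_eq[OF U]
    proof (intro Bochner_Integration.integral_cong refl)
      fix x
      show "indicator U x *\<^sub>R partial b (\<lambda>x. \<phi> x * \<psi> x) x = partial b (\<lambda>x. \<phi> x * \<psi> x) x"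
        using K frechet_derivative_mult_apply[of \<phi> x \<psi> b] s s\<psi>
        by (cases "x \<in> K") (auto simp: smooth_differentiable)
    qed
    also have "\<dots> = (\<integral>x. partial b (\<lambda>x. \<phi> x * \<psi> x) x \<partial>lborel)"
      using borel_measurable_smooth[OF smooth_partial[OF smooth_mult[OF s s\<psi>] b]]
      by (intro integral_completion) auto
    also have "\<dots> = 0"
      by (rule integral_partial_compact_support[OF smooth_mult[OF s s\<psi>] K(1)]) (simp add: K(3))
    finally show "(\<integral>x. \<phi> x * partial b \<psi> x \<partial>lebesgue_on U) = - (\<integral>x. (grad \<phi> x \<bullet> b) * \<psi> x \<partial>lebesgue_on U)"
      by simp
  qed
qed

section \<open>Spreads\<close>

text \<open>The measure-theoretic form of \<open>\<integral>\<integral>(u x - u y)\<^sup>2\<close>: both variables range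
  freely, so it makes sense for every measurable \<open>u\<close> and is monotone and subadditive in the regions.\<close>

definition spread :: "('a \<Rightarrow> real) \<Rightarrow> 'a measure \<Rightarrow> 'a measure \<Rightarrow> ennreal" where
  "spread u M N = (\<integral>\<^sup>+x. \<integral>\<^sup>+y. ennreal ((u x - u y)\<^sup>2) \<partial>N \<partial>M)"

lemma square_sum_le:
  fixes a b :: real
  shows "(a + b)\<^sup>2 \<le> 2 * a\<^sup>2 + 2 * b\<^sup>2"
  using sum_squares_bound[of a b] by (simp add: power2_sum)

lemma square_sum3_le:
  fixes a b c :: real
  shows "(a + b + c)\<^sup>2 \<le> 3 * a\<^sup>2 + 3 * b\<^sup>2 + 3 * c\<^sup>2"
proof -
  have "3 * a\<^sup>2 + 3 * b\<^sup>2 + 3 * c\<^sup>2 - (a + b + c)\<^sup>2 = (a - b)\<^sup>2 + (b - c)\<^sup>2 + (a - c)\<^sup>2"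
    by (simp add: power2_eq_square algebra_simps)
  then show ?thesis
    by (smt (verit) zero_le_power2)
qed

text \<open>Insert \<open>z\<close> between \<open>x\<close> and \<open>y\<close>, use \<open>(a + b)\<^sup>2 \<le> 2 a\<^sup>2 + 2 b\<^sup>2\<close>, and integrate over \<open>z\<close> in \<open>P\<close>. This
  is how estimates travel from one region to another.\<close>

lemma spread_link:
  assumes [measurable]: "u \<in> borel_measurable M" "u \<in> borel_measurable N" "u \<in> borel_measurable P"
    and "sigma_finite_measure N" "sigma_finite_measure P"
  shows "emeasure P (space P) * spread u M N \<le>
    2 * (emeasure N (space N) * spread u M P + emeasure M (space M) * spread u N P)"
proof -
  interpret N: sigma_finite_measure N by fact
  interpret P: sigma_finite_measure P by fact
  let ?c = "\<lambda>x y. ennreal ((u x - u y)\<^sup>2)"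
  have cP: "(\<lambda>x. \<integral>\<^sup>+z. ?c x z \<partial>P) \<in> borel_measurable Q" if [measurable]: "u \<in> borel_measurable Q" for Q
    by measurable
  note [measurable] = cP[OF assms(1)] cP[OF assms(2)]
  have 1: "emeasure P (space P) * ?c x y \<le> 2 * (\<integral>\<^sup>+z. ?c x z \<partial>P) + 2 * (\<integral>\<^sup>+z. ?c y z \<partial>P)"
    if "x \<in> space M" "y \<in> space N" for x y
  proof -
    have "emeasure P (space P) * ?c x y = (\<integral>\<^sup>+z. ?c x y \<partial>P)"
      by (simp add: mult.commute)
    also have "\<dots> \<le> (\<integral>\<^sup>+z. 2 * ?c x z + 2 * ?c y z \<partial>P)"
    proof (intro nn_integral_mono)
      fix z
      have "(u x - u y)\<^sup>2 \<le> 2 * (u x - u z)\<^sup>2 + 2 * (u y - u z)\<^sup>2"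
        using square_sum_le[of "u x - u z" "u z - u y"] by (simp add: power2_commute)
      then have "?c x y \<le> ennreal (2 * (u x - u z)\<^sup>2 + 2 * (u y - u z)\<^sup>2)"
        by (rule ennreal_leI)
      also have "\<dots> = 2 * ?c x z + 2 * ?c y z"
        by (simp add: ennreal_plus ennreal_mult)
      finally show "?c x y \<le> 2 * ?c x z + 2 * ?c y z" .
    qed
    also have "\<dots> = 2 * (\<integral>\<^sup>+z. ?c x z \<partial>P) + 2 * (\<integral>\<^sup>+z. ?c y z \<partial>P)"
      by (simp add: nn_integral_add nn_integral_cmult)
    finally show ?thesis .
  qed
  have 2: "emeasure P (space P) * (\<integral>\<^sup>+y. ?c x y \<partial>N)
      \<le> 2 * (\<integral>\<^sup>+z. ?c x z \<partial>P) * emeasure N (space N) + 2 * spread u N P" if "x \<in> space M" for x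
  proof -
    have "emeasure P (space P) * (\<integral>\<^sup>+y. ?c x y \<partial>N) = (\<integral>\<^sup>+y. emeasure P (space P) * ?c x y \<partial>N)"
      by (simp add: nn_integral_cmult)
    also have "\<dots> \<le> (\<integral>\<^sup>+y. 2 * (\<integral>\<^sup>+z. ?c x z \<partial>P) + 2 * (\<integral>\<^sup>+z. ?c y z \<partial>P) \<partial>N)"
      using 1 that by (intro nn_integral_mono) auto
    also have "\<dots> = 2 * (\<integral>\<^sup>+z. ?c x z \<partial>P) * emeasure N (space N) + 2 * spread u N P"
      by (simp add: nn_integral_add nn_integral_cmult spread_def)
    finally show ?thesis .
  qed
  have [measurable]: "(\<lambda>x. \<integral>\<^sup>+y. ?c x y \<partial>N) \<in> borel_measurable M"
    by measurable
  have "emeasure P (space P) * spread u M N = (\<integral>\<^sup>+x. emeasure P (space P) * (\<integral>\<^sup>+y. ?c x y \<partial>N) \<partial>M)"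
    by (simp add: spread_def nn_integral_cmult)
  also have "\<dots> \<le> (\<integral>\<^sup>+x. 2 * (\<integral>\<^sup>+z. ?c x z \<partial>P) * emeasure N (space N) + 2 * spread u N P \<partial>M)"
    using 2 by (intro nn_integral_mono) auto
  also have "\<dots> = 2 * spread u M P * emeasure N (space N) + 2 * spread u N P * emeasure M (space M)"
    by (simp add: nn_integral_add nn_integral_cmult nn_integral_multc spread_def)
  finally show ?thesis
    by (simp add: algebra_simps)
qed

lemma emeasure_lborel_bounded:
  assumes "bounded A"
  shows "emeasure lborel A = ennreal (measure lborel A)"
  using emeasure_bounded_finite[OF assms] by (intro emeasure_eq_ennreal_measure) auto

lemma finite_measure_lebesgue_on_bounded:
  "open V \<Longrightarrow> bounded V \<Longrightarrow> finite_measure (lebesgue_on V)"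
  by (intro finite_measure_lebesgue_on bounded_set_imp_lmeasurable) auto

lemma sigma_finite_lebesgue_on:
  "open V \<Longrightarrow> bounded V \<Longrightarrow> sigma_finite_measure (lebesgue_on V)"
  using finite_measure_lebesgue_on_bounded finite_measure.axioms(1) by blast

lemma nn_integral_lebesgue_on:
  assumes "open V"
  shows "(\<integral>\<^sup>+x. F x \<partial>lebesgue_on V) = (\<integral>\<^sup>+x\<in>V. F x \<partial>lborel)"
  using assms by (subst nn_integral_restrict_space) (auto simp: nn_integral_completion)

lemma emeasure_lebesgue_on_space:
  assumes "open V"
  shows "emeasure (lebesgue_on V) V = emeasure lborel V"
  using assms by (subst emeasure_restrict_space) auto

lemma borel_measurable_lebesgue_on_borel:
  "u \<in> borel_measurable borel \<Longrightarrow> u \<in> borel_measurable (lebesgue_on V)"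
  by (intro measurable_restrict_space1 borel_measurable_lebesgueI)

lemma spread_mono:
  assumes "open V" "open W" "open V'" "open W'" "V \<subseteq> V'" "W \<subseteq> W'"
  shows "spread u (lebesgue_on V) (lebesgue_on W) \<le> spread u (lebesgue_on V') (lebesgue_on W')"
  unfolding spread_def nn_integral_lebesgue_on[OF assms(1)] nn_integral_lebesgue_on[OF assms(2)]
    nn_integral_lebesgue_on[OF assms(3)] nn_integral_lebesgue_on[OF assms(4)]
  using assms by (intro nn_integral_mono mult_mono) (auto split: split_indicator)

lemma spread_Un_le:
  assumes [measurable]: "u \<in> borel_measurable borel" and o: "open V" "open W"
    and b: "bounded V" "bounded W"
  shows "spread u (lebesgue_on (V \<union> W)) (lebesgue_on (V \<union> W)) \<le>
    spread u (lebesgue_on V) (lebesgue_on V) + spread u (lebesgue_on V) (lebesgue_on W) +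
    (spread u (lebesgue_on W) (lebesgue_on V) + spread u (lebesgue_on W) (lebesgue_on W))"
proof -
  have [measurable]: "V \<in> sets borel" "W \<in> sets borel" using o by auto
  have le: "(\<integral>\<^sup>+x. F x \<partial>lebesgue_on (V \<union> W)) \<le> (\<integral>\<^sup>+x. F x \<partial>lebesgue_on V) + (\<integral>\<^sup>+x. F x \<partial>lebesgue_on W)"
    if [measurable]: "F \<in> borel_measurable borel" for F :: "'a \<Rightarrow> ennreal"
  proof -
    have "(\<integral>\<^sup>+x. F x \<partial>lebesgue_on (V \<union> W)) \<le> (\<integral>\<^sup>+x. F x * indicator V x + F x * indicator W x \<partial>lborel)"
      unfolding nn_integral_lebesgue_on[OF open_Un[OF o]]
      by (intro nn_integral_mono) (auto split: split_indicator)
    also have "\<dots> = (\<integral>\<^sup>+x. F x \<partial>lebesgue_on V) + (\<integral>\<^sup>+x. F x \<partial>lebesgue_on W)"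
      by (simp add: nn_integral_add nn_integral_lebesgue_on o)
    finally show ?thesis .
  qed
  have m: "(\<lambda>x. \<integral>\<^sup>+y. ennreal ((u x - u y)\<^sup>2) \<partial>lebesgue_on Z) \<in> borel_measurable borel" if "open Z" for Z
  proof -
    have [measurable]: "Z \<in> sets borel" using that by auto
    show ?thesis
      unfolding nn_integral_lebesgue_on[OF that] by measurable
  qed
  note [measurable] = m[OF o(1)] m[OF o(2)]
  have "spread u (lebesgue_on (V \<union> W)) (lebesgue_on (V \<union> W)) \<le>
     (\<integral>\<^sup>+x. (\<integral>\<^sup>+y. ennreal ((u x - u y)\<^sup>2) \<partial>lebesgue_on V) + (\<integral>\<^sup>+y. ennreal ((u x - u y)\<^sup>2) \<partial>lebesgue_on W) \<partial>lebesgue_on (V \<union> W))"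
    unfolding spread_def by (intro nn_integral_mono le) measurable
  also have "\<dots> \<le> (\<integral>\<^sup>+x. (\<integral>\<^sup>+y. ennreal ((u x - u y)\<^sup>2) \<partial>lebesgue_on V) + (\<integral>\<^sup>+y. ennreal ((u x - u y)\<^sup>2) \<partial>lebesgue_on W) \<partial>lebesgue_on V)
     + (\<integral>\<^sup>+x. (\<integral>\<^sup>+y. ennreal ((u x - u y)\<^sup>2) \<partial>lebesgue_on V) + (\<integral>\<^sup>+y. ennreal ((u x - u y)\<^sup>2) \<partial>lebesgue_on W) \<partial>lebesgue_on W)"
    by (rule le) measurable
  also have "\<dots> = spread u (lebesgue_on V) (lebesgue_on V) + spread u (lebesgue_on V) (lebesgue_on W) +
    (spread u (lebesgue_on W) (lebesgue_on V) + spread u (lebesgue_on W) (lebesgue_on W))"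
    unfolding spread_def
    by (intro arg_cong2[where f = "(+)"] nn_integral_add borel_measurable_lebesgue_on_borel m o)
  finally show ?thesis .
qed

section \<open>The Poincare inequality on Lipschitz domains\<close>

text \<open>The spread over the part \<open>V\<close> is compared with the gradient on all of \<open>U\<close>, since sliding \<open>V\<close> into
  another part of \<open>U\<close> leaves \<open>V\<close>.\<close>

definition poincare_on :: "'a::euclidean_space set \<Rightarrow> 'a set \<Rightarrow> bool" where
  "poincare_on U V \<longleftrightarrow> open V \<and> bounded V \<and>
     (\<exists>K\<ge>0. \<forall>u g. borel_weak_gradient U u g \<longrightarrow>
        spread u (lebesgue_on V) (lebesgue_on V) \<le> ennreal K * (\<integral>\<^sup>+x. ennreal ((norm (g x))\<^sup>2) \<partial>lborel))"

text \<open>Substitute \<open>y = x + h\<close> and integrate the difference estimate over the bounded set of possible \<open>h\<close>;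
  convexity keeps the segments inside \<open>V\<close>.\<close>

lemma poincare_on_convex:
  fixes V :: "'a::euclidean_space set"
  assumes V: "open V" "bounded V" "convex V" "V \<subseteq> U"
  shows "poincare_on U V"
proof -
  obtain r where r: "\<And>x. x \<in> V \<Longrightarrow> norm x \<le> r"
    using V(2) unfolding bounded_iff by auto
  define B where "B = cball (0::'a) (2 * r)"
  have fB: "emeasure lborel B = ennreal (measure lborel B)"
    unfolding B_def by (intro emeasure_lborel_bounded bounded_cball)
  have "spread u (lebesgue_on V) (lebesgue_on V)
      \<le> ennreal ((2 * r)\<^sup>2 * measure lborel B) * (\<integral>\<^sup>+x. ennreal ((norm (g x))\<^sup>2) \<partial>lborel)"
    if bw: "borel_weak_gradient U u g" for u g
  proof -
    let ?E = "\<integral>\<^sup>+x. ennreal ((norm (g x))\<^sup>2) \<partial>lborel"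
    have [measurable]: "u \<in> borel_measurable borel" "g \<in> borel_measurable borel"
      using bw unfolding borel_weak_gradient_def by auto
    have [measurable]: "V \<in> sets borel" "B \<in> sets borel" using V by (auto simp: B_def)
    let ?f = "\<lambda>x y. ennreal ((u y - u x)\<^sup>2) * indicator V y * indicator V x"
    have "spread u (lebesgue_on V) (lebesgue_on V) = (\<integral>\<^sup>+x. (\<integral>\<^sup>+y. ?f x y \<partial>lborel) \<partial>lborel)"
      unfolding spread_def nn_integral_lebesgue_on[OF V(1)]
      by (intro nn_integral_cong) (simp add: nn_integral_multc power2_commute)
    also have "\<dots> = (\<integral>\<^sup>+x. (\<integral>\<^sup>+h. ?f x (h + x) \<partial>lborel) \<partial>lborel)"
      by (intro nn_integral_cong nn_integral_lborel_translate[symmetric]) measurable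
    also have "\<dots> = (\<integral>\<^sup>+h. (\<integral>\<^sup>+x. ?f x (h + x) \<partial>lborel) \<partial>lborel)"
      by (rule lborel_pair.Fubini') measurable
    also have "\<dots> \<le> (\<integral>\<^sup>+h. ennreal ((2 * r)\<^sup>2) * ?E * indicator B h \<partial>lborel)"
    proof (intro nn_integral_mono)
      fix h :: 'a
      \<comment> \<open>The points of \<open>V\<close> that \<open>h\<close> carries to points of \<open>V\<close>; there are none unless \<open>norm h \<le> 2 * r\<close>.\<close>
      let ?V = "V \<inter> (\<lambda>x. x + h) -` V"
      show "(\<integral>\<^sup>+x. ?f x (h + x) \<partial>lborel) \<le> ennreal ((2 * r)\<^sup>2) * ?E * indicator B h"
      proof (cases "?V = {}")
        case True
        then have "?f x (h + x) = 0" for x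
          by (auto split: split_indicator simp: add.commute)
        then have "(\<integral>\<^sup>+x. ?f x (h + x) \<partial>lborel) = (\<integral>\<^sup>+x. 0 \<partial>(lborel :: 'a measure))"
          by (intro nn_integral_cong)
        then show ?thesis by (simp only: nn_integral_const) simp
      next
        case False
        then obtain x where x: "x \<in> V" "x + h \<in> V" by auto
        have "norm h \<le> norm (x + h) + norm x"
          by (metis add_diff_cancel_left' norm_triangle_ineq4)
        then have nh: "norm h \<le> 2 * r"
          using r[OF x(1)] r[OF x(2)] by linarith
        have o: "open ?V"
          by (intro open_Int V open_vimage continuous_intros)
        have "(\<integral>\<^sup>+x. ?f x (h + x) \<partial>lborel) = (\<integral>\<^sup>+x\<in>?V. ennreal ((u (x + h) - u x)\<^sup>2) \<partial>lborel)"
          by (intro nn_integral_cong) (auto split: split_indicator simp: add.commute)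
        also have "\<dots> \<le> ennreal ((norm h)\<^sup>2) * ?E"
        proof (rule nn_integral_difference_square_le[OF bw o])
          fix x and t :: real assume "x \<in> ?V" "0 \<le> t" "t \<le> 1"
          then have "(1 - t) *\<^sub>R x + t *\<^sub>R (x + h) \<in> V"
            using V(3) by (intro convexD) auto
          then show "x + t *\<^sub>R h \<in> U"
            using V(4) by (auto simp: algebra_simps)
        qed
        also have "\<dots> \<le> ennreal ((2 * r)\<^sup>2) * ?E"
          using nh by (intro mult_right_mono ennreal_leI power_mono) auto
        finally show ?thesis
          using nh by (simp add: B_def)
      qed
    qed
    also have "\<dots> = ennreal ((2 * r)\<^sup>2) * ?E * emeasure lborel B"
      by (rule nn_integral_cmult_indicator) simp
    also have "\<dots> = ennreal ((2 * r)\<^sup>2 * measure lborel B) * ?E"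
      by (simp add: fB ennreal_mult mult_ac)
    finally show ?thesis .
  qed
  then show ?thesis
    unfolding poincare_on_def using V
    by (intro conjI exI[of _ "(2 * r)\<^sup>2 * measure lborel B"] allI impI) auto
qed

text \<open>Boundary regions need not be convex. They are handled by sliding them into a region where
  the inequality is known; the slide costs one difference estimate at each end.\<close>

lemma poincare_on_shift:
  fixes V :: "'a::euclidean_space set"
  assumes V: "open V" "bounded V"
    and seg: "\<And>x t. x \<in> V \<Longrightarrow> 0 \<le> t \<Longrightarrow> t \<le> 1 \<Longrightarrow> x + t *\<^sub>R h \<in> U"
    and W: "poincare_on U W" "\<And>x. x \<in> V \<Longrightarrow> x + h \<in> W"
  shows "poincare_on U V"
proof -
  have oW: "open W" using W by (simp add: poincare_on_def)
  obtain K where K: "K \<ge> 0" "\<And>u g. borel_weak_gradient U u g \<Longrightarrow>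
        spread u (lebesgue_on W) (lebesgue_on W) \<le> ennreal K * (\<integral>\<^sup>+x. ennreal ((norm (g x))\<^sup>2) \<partial>lborel)"
    using W(1) unfolding poincare_on_def by blast
  define m where "m = measure lborel V"
  have m: "emeasure lborel V = ennreal m"
    unfolding m_def by (intro emeasure_lborel_bounded V)
  have "m \<ge> 0" by (simp add: m_def)
  have "spread u (lebesgue_on V) (lebesgue_on V)
      \<le> ennreal (3 * (norm h)\<^sup>2 * m + 3 * K + 3 * (norm h)\<^sup>2 * m) * (\<integral>\<^sup>+x. ennreal ((norm (g x))\<^sup>2) \<partial>lborel)"
    if bw: "borel_weak_gradient U u g" for u g
  proof -
    let ?E = "\<integral>\<^sup>+x. ennreal ((norm (g x))\<^sup>2) \<partial>lborel"
    have [measurable]: "u \<in> borel_measurable borel" "g \<in> borel_measurable borel"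
      using bw unfolding borel_weak_gradient_def by auto
    have [measurable]: "V \<in> sets borel" "W \<in> sets borel" using V oW by auto
    let ?d = "\<lambda>x. ennreal ((u (x + h) - u x)\<^sup>2)"
    let ?c = "\<lambda>x y. ennreal ((u (x + h) - u (y + h))\<^sup>2)"
    define T where "T = (\<integral>\<^sup>+x\<in>V. ?d x \<partial>lborel)"
    have T: "T \<le> ennreal ((norm h)\<^sup>2) * ?E"
      unfolding T_def by (rule nn_integral_difference_square_le[OF bw V(1)]) (rule seg)
    define S where "S = (\<integral>\<^sup>+x\<in>V. (\<integral>\<^sup>+y\<in>V. ?c x y \<partial>lborel) \<partial>lborel)"
    have "S \<le> (\<integral>\<^sup>+x. (\<integral>\<^sup>+y. ?c x y * indicator W (y + h) \<partial>lborel) * indicator W (x + h) \<partial>lborel)"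
      unfolding S_def using W(2) by (intro nn_integral_mono mult_mono) (auto split: split_indicator)
    also have "\<dots> = (\<integral>\<^sup>+x. (\<integral>\<^sup>+y. ennreal ((u (x + h) - u y)\<^sup>2) * indicator W y \<partial>lborel) * indicator W (x + h) \<partial>lborel)"
      using nn_integral_lborel_translate[of "\<lambda>y. ennreal ((u (x + h) - u y)\<^sup>2) * indicator W y" h for x]
      by simp
    also have "\<dots> = spread u (lebesgue_on W) (lebesgue_on W)"
      using nn_integral_lborel_translate[of "\<lambda>x. (\<integral>\<^sup>+y. ennreal ((u x - u y)\<^sup>2) * indicator W y \<partial>lborel) * indicator W x" h]
      unfolding spread_def nn_integral_lebesgue_on[OF oW] by simp
    finally have S: "S \<le> ennreal K * ?E"
      using K(2)[OF bw] by (rule order_trans)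
    have le: "ennreal ((u x - u y)\<^sup>2) \<le> 3 * ?d x + 3 * ?c x y + 3 * ?d y" for x y
    proof -
      have "(u x - u y)\<^sup>2 \<le> 3 * (u (x + h) - u x)\<^sup>2 + 3 * (u (x + h) - u (y + h))\<^sup>2 + 3 * (u (y + h) - u y)\<^sup>2"
        using square_sum3_le[of "u x - u (x + h)" "u (x + h) - u (y + h)" "u (y + h) - u y"]
        by (simp add: power2_commute)
      then have "ennreal ((u x - u y)\<^sup>2) \<le> ennreal (3 * (u (x + h) - u x)\<^sup>2 + 3 * (u (x + h) - u (y + h))\<^sup>2 + 3 * (u (y + h) - u y)\<^sup>2)"
        by (rule ennreal_leI)
      also have "\<dots> = 3 * ?d x + 3 * ?c x y + 3 * ?d y"
        by (simp add: ennreal_plus ennreal_mult)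
      finally show ?thesis .
    qed
    have "spread u (lebesgue_on V) (lebesgue_on V) \<le>
        (\<integral>\<^sup>+x\<in>V. (\<integral>\<^sup>+y\<in>V. 3 * ?d x + 3 * ?c x y + 3 * ?d y \<partial>lborel) \<partial>lborel)"
      unfolding spread_def nn_integral_lebesgue_on[OF V(1)]
      by (intro nn_integral_mono mult_right_mono le) auto
    also have "\<dots> = (\<integral>\<^sup>+x\<in>V. 3 * ?d x * m + 3 * (\<integral>\<^sup>+y\<in>V. ?c x y \<partial>lborel) + 3 * T \<partial>lborel)"
      unfolding T_def m[symmetric]
      by (simp add: distrib_right nn_integral_add nn_integral_cmult mult.assoc nn_integral_cmult_indicator)
    also have "\<dots> = (\<integral>\<^sup>+x. (3 * ennreal m) * (?d x * indicator V x) +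
        (3 * ((\<integral>\<^sup>+y\<in>V. ?c x y \<partial>lborel) * indicator V x) + (3 * T) * indicator V x) \<partial>lborel)"
      by (intro nn_integral_cong) (auto split: split_indicator simp: mult_ac add_ac)
    also have "\<dots> = (3 * ennreal m) * T + (3 * S + (3 * T) * m)"
    proof -
      have "(\<integral>\<^sup>+x. (3 * ennreal m) * (?d x * indicator V x) \<partial>lborel) = (3 * ennreal m) * T"
        unfolding T_def by (rule nn_integral_cmult) measurable
      moreover have "(\<integral>\<^sup>+x. 3 * ((\<integral>\<^sup>+y\<in>V. ?c x y \<partial>lborel) * indicator V x) \<partial>lborel) = 3 * S"
        unfolding S_def by (rule nn_integral_cmult) measurable
      moreover have "(\<integral>\<^sup>+x. (3 * T) * indicator V x \<partial>lborel) = (3 * T) * m"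
        by (simp add: nn_integral_cmult_indicator m)
      ultimately show ?thesis
        by (simp add: nn_integral_add)
    qed
    also have "\<dots> = 3 * T * m + 3 * S + 3 * T * m"
      by (simp add: mult_ac add_ac)
    also have "\<dots> \<le> 3 * (ennreal ((norm h)\<^sup>2) * ?E) * m + 3 * (ennreal K * ?E) + 3 * (ennreal ((norm h)\<^sup>2) * ?E) * m"
      by (intro add_mono mult_mono T S) auto
    also have "\<dots> = ennreal (3 * (norm h)\<^sup>2 * m + 3 * K + 3 * (norm h)\<^sup>2 * m) * ?E"
    proof -
      have "3 * (ennreal ((norm h)\<^sup>2) * ?E) * m = ennreal (3 * (norm h)\<^sup>2 * m) * ?E"
           "3 * (ennreal K * ?E) = ennreal (3 * K) * ?E"
        using \<open>m \<ge> 0\<close> K(1) by (simp_all add: ennreal_mult mult_ac)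
      moreover have "ennreal (3 * (norm h)\<^sup>2 * m + 3 * K + 3 * (norm h)\<^sup>2 * m)
          = ennreal (3 * (norm h)\<^sup>2 * m) + ennreal (3 * K) + ennreal (3 * (norm h)\<^sup>2 * m)"
        using \<open>m \<ge> 0\<close> K(1) by (subst ennreal_plus; simp)+
      ultimately show ?thesis
        by (simp only: distrib_right)
    qed
    finally show ?thesis .
  qed
  then show ?thesis
    unfolding poincare_on_def using V \<open>m \<ge> 0\<close> K(1)
    by (intro conjI exI[of _ "3 * (norm h)\<^sup>2 * m + 3 * K + 3 * (norm h)\<^sup>2 * m"] allI impI) auto
qed

lemma ennreal_le_divide_real:
  assumes a: "a > 0" "b \<ge> 0" and le: "ennreal a * S \<le> ennreal b * E"
  shows "S \<le> ennreal (b / a) * E"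
proof -
  have "S = ennreal (1 / a) * (ennreal a * S)"
    using a by (simp add: mult.assoc[symmetric] ennreal_mult[symmetric])
  also have "\<dots> \<le> ennreal (1 / a) * (ennreal b * E)"
    by (intro mult_left_mono le) auto
  also have "\<dots> = ennreal (b / a) * E"
    using a by (simp add: mult.assoc[symmetric] ennreal_mult[symmetric])
  finally show ?thesis .
qed

lemma measure_open_pos:
  assumes "open A" "bounded A" "A \<noteq> {}"
  shows "measure lborel A > 0"
proof -
  have "emeasure lborel A \<noteq> 0"
    using open_not_negligible[OF assms(1,3)] assms(1)
    by (auto simp: negligible_iff_null_sets null_sets_completion_iff null_sets_def)
  then show ?thesis
    using emeasure_lborel_bounded[OF assms(2)] by (simp add: zero_less_measure_iff)
qed

lemma spread_link_bound:
  assumes V: "open V" "bounded V" and W: "open W" "bounded W" and A: "open A" "bounded A" "A \<noteq> {}"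
    and u: "u \<in> borel_measurable (lebesgue_on V)" "u \<in> borel_measurable (lebesgue_on W)"
      "u \<in> borel_measurable (lebesgue_on A)"
    and KL: "K \<ge> 0" "L \<ge> 0"
    and le: "spread u (lebesgue_on V) (lebesgue_on A) \<le> ennreal K * E"
      "spread u (lebesgue_on W) (lebesgue_on A) \<le> ennreal L * E"
  shows "spread u (lebesgue_on V) (lebesgue_on W)
    \<le> ennreal (2 * (measure lborel W * K + measure lborel V * L) / measure lborel A) * E"
proof (rule ennreal_le_divide_real)
  let ?s = "\<lambda>V W. spread u (lebesgue_on V) (lebesgue_on W)"
  define a v w where "a = measure lborel A" and "v = measure lborel V" and "w = measure lborel W"
  have nn: "v \<ge> 0" "w \<ge> 0" by (simp_all add: v_def w_def)
  have em: "emeasure (lebesgue_on A) A = ennreal a" "emeasure (lebesgue_on V) V = ennreal v"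
      "emeasure (lebesgue_on W) W = ennreal w"
    using V W A by (simp_all only: emeasure_lebesgue_on_space emeasure_lborel_bounded a_def v_def w_def)
  have "ennreal a * ?s V W \<le> 2 * (ennreal w * ?s V A + ennreal v * ?s W A)"
    using spread_link[OF u, unfolded space_lebesgue_on] V W A by (simp add: em sigma_finite_lebesgue_on)
  also have "\<dots> \<le> 2 * (ennreal w * (ennreal K * E) + ennreal v * (ennreal L * E))"
    by (intro mult_left_mono add_mono le) auto
  also have "\<dots> = ennreal (2 * (w * K + v * L)) * E"
    using nn KL by (simp add: ennreal_plus ennreal_mult distrib_left distrib_right mult_ac)
  finally show "ennreal (measure lborel A) * ?s V W
    \<le> ennreal (2 * (measure lborel W * K + measure lborel V * L)) * E"
    by (simp add: a_def v_def w_def)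
qed (use measure_open_pos[OF A] KL in auto)

lemma poincare_on_Un:
  fixes V W :: "'a::euclidean_space set"
  assumes V: "poincare_on U V" and W: "poincare_on U W" and ne: "V \<inter> W \<noteq> {}"
  shows "poincare_on U (V \<union> W)"
proof -
  have o: "open V" "open W" and b: "bounded V" "bounded W"
    using V W by (auto simp: poincare_on_def)
  obtain K where K: "K \<ge> 0" "\<And>u g. borel_weak_gradient U u g \<Longrightarrow>
        spread u (lebesgue_on V) (lebesgue_on V) \<le> ennreal K * (\<integral>\<^sup>+x. ennreal ((norm (g x))\<^sup>2) \<partial>lborel)"
    using V unfolding poincare_on_def by blast
  obtain L where L: "L \<ge> 0" "\<And>u g. borel_weak_gradient U u g \<Longrightarrow>
        spread u (lebesgue_on W) (lebesgue_on W) \<le> ennreal L * (\<integral>\<^sup>+x. ennreal ((norm (g x))\<^sup>2) \<partial>lborel)"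
    using W unfolding poincare_on_def by blast
  let ?A = "V \<inter> W"
  have oA: "open ?A" and bA: "bounded ?A"
    using o b by (auto intro: bounded_subset)
  define a v w where "a = measure lborel ?A" and "v = measure lborel V" and "w = measure lborel W"
  have nn: "v \<ge> 0" "w \<ge> 0" "a \<ge> 0" by (simp_all add: v_def w_def a_def)
  define M where "M = 2 * (w * K + v * L) / a"
  define M' where "M' = 2 * (v * L + w * K) / a"
  have "spread u (lebesgue_on (V \<union> W)) (lebesgue_on (V \<union> W))
      \<le> ennreal (K + M + (M' + L)) * (\<integral>\<^sup>+x. ennreal ((norm (g x))\<^sup>2) \<partial>lborel)"
    if bw: "borel_weak_gradient U u g" for u g
  proof -
    let ?E = "\<integral>\<^sup>+x. ennreal ((norm (g x))\<^sup>2) \<partial>lborel"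
    let ?s = "\<lambda>V W. spread u (lebesgue_on V) (lebesgue_on W)"
    have u: "u \<in> borel_measurable borel"
      using bw unfolding borel_weak_gradient_def by auto
    note mu = borel_measurable_lebesgue_on_borel[OF u]
    have VA: "?s V ?A \<le> ennreal K * ?E" and WA: "?s W ?A \<le> ennreal L * ?E"
      using order_trans[OF spread_mono K(2)[OF bw]] order_trans[OF spread_mono L(2)[OF bw]] o oA by auto
    have 1: "?s V W \<le> ennreal M * ?E"
      unfolding M_def a_def v_def w_def
      by (rule spread_link_bound[OF o(1) b(1) o(2) b(2) oA bA ne mu mu mu K(1) L(1) VA WA])
    have 2: "?s W V \<le> ennreal M' * ?E"
      unfolding M'_def a_def v_def w_def
      by (rule spread_link_bound[OF o(2) b(2) o(1) b(1) oA bA ne mu mu mu L(1) K(1) WA VA])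
    have "?s (V \<union> W) (V \<union> W) \<le> ?s V V + ?s V W + (?s W V + ?s W W)"
      by (rule spread_Un_le[OF u o b])
    also have "\<dots> \<le> ennreal K * ?E + ennreal M * ?E + (ennreal M' * ?E + ennreal L * ?E)"
      by (intro add_mono K(2)[OF bw] L(2)[OF bw] 1 2)
    also have "\<dots> = ennreal (K + M + (M' + L)) * ?E"
      using nn K L by (simp add: M_def M'_def ennreal_plus distrib_right)
    finally show ?thesis .
  qed
  moreover have "K + M + (M' + L) \<ge> 0"
    using nn K L by (simp add: M_def M'_def)
  ultimately show ?thesis
    unfolding poincare_on_def using o b
    by (intro conjI exI[of _ "K + M + (M' + L)"] allI impI) auto
qed

text \<open>Take a maximal subfamily whose union satisfies the inequality. A member outside it that met this
  union could be added, so the remaining members cover a disjoint open set, which connectedness makes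
  empty.\<close>

lemma poincare_on_connected_Union:
  assumes fin: "finite \<V>" and P: "\<And>V. V \<in> \<V> \<Longrightarrow> poincare_on U V"
    and con: "connected (\<Union>\<V>)" and ne: "\<Union>\<V> \<noteq> {}"
  shows "poincare_on U (\<Union>\<V>)"
proof -
  define \<S> where "\<S> = {S. S \<subseteq> \<V> \<and> \<Union>S \<noteq> {} \<and> poincare_on U (\<Union>S)}"
  have finS: "finite \<S>"
    using fin by (auto simp: \<S>_def intro: finite_subset[of _ "Pow \<V>"])
  obtain V0 where V0: "V0 \<in> \<V>" "V0 \<noteq> {}" using ne by blast
  then have "{V0} \<in> \<S>" using P by (simp add: \<S>_def)
  then obtain S where S: "S \<in> \<S>" and max: "\<And>S'. S' \<in> \<S> \<Longrightarrow> S \<subseteq> S' \<Longrightarrow> S' = S"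
    using finite_has_maximal[OF finS] by (metis empty_iff)
  have Sp: "S \<subseteq> \<V>" "\<Union>S \<noteq> {}" "poincare_on U (\<Union>S)"
    using S by (auto simp: \<S>_def)
  have disj: "\<Union>S \<inter> V = {}" if V: "V \<in> \<V> - S" for V
  proof (rule ccontr)
    assume ne': "\<Union>S \<inter> V \<noteq> {}"
    then have "poincare_on U (\<Union>S \<union> V)"
      using Sp P V by (intro poincare_on_Un) auto
    then have "insert V S \<in> \<S>"
      using Sp V by (auto simp: \<S>_def Un_commute)
    from max[OF this] V show False by blast
  qed
  have o: "open (\<Union>S)" "open (\<Union>(\<V> - S))"
    using Sp P by (auto simp: poincare_on_def intro!: open_Union)
  have "\<Union>(\<V> - S) = {}"
  proof (rule ccontr)
    assume "\<Union>(\<V> - S) \<noteq> {}"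
    moreover have "\<Union>S \<inter> \<Union>(\<V> - S) = {}" using disj by blast
    moreover have "\<Union>\<V> = \<Union>S \<union> \<Union>(\<V> - S)" using Sp(1) by blast
    ultimately show False
      using connectedD[OF con o] Sp(2) by blast
  qed
  then have "\<Union>\<V> = \<Union>S" using Sp(1) by blast
  then show ?thesis using Sp(3) by simp
qed

text \<open>Near a boundary point the domain is a supergraph, so sliding up by \<open>h\<close> stays inside and ends in a
  ball around \<open>p + h\<close>, which is convex.\<close>

lemma lipschitz_boundary_point_poincare_on:
  fixes U :: "'a::euclidean_space set"
  assumes U: "open U" and lip: "lipschitz_boundary U" and p: "p \<in> frontier U"
  shows "\<exists>r>0. poincare_on U (U \<inter> ball p r)"
proof -
  obtain r e \<gamma> L where r: "r > 0" and e: "norm e = 1"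
    and \<gamma>: "L-lipschitz_on {y. y \<bullet> e = 0} \<gamma>"
    and graph: "U \<inter> ball p r = {x \<in> ball p r. \<gamma> (x - (x \<bullet> e) *\<^sub>R e) < x \<bullet> e}"
    using lip p unfolding lipschitz_boundary_def by blast
  have L: "L \<ge> 0" using \<gamma> by (rule lipschitz_on_nonneg)
  have ee: "e \<bullet> e = 1" using e by (simp add: norm_eq_1)
  define \<pi> where "\<pi> x = x - (x \<bullet> e) *\<^sub>R e" for x
  have \<pi>0: "\<pi> x \<bullet> e = 0" for x
    by (simp add: \<pi>_def inner_diff_left ee)
  have \<pi>shift: "\<pi> (x + t *\<^sub>R e) = \<pi> x" for x t
    by (simp add: \<pi>_def inner_add_left ee algebra_simps)
  have ie: "\<bar>x \<bullet> e\<bar> \<le> norm x" for x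
    using Cauchy_Schwarz_ineq2[of x e] e by simp
  have \<pi>dist: "norm (\<pi> x - \<pi> y) \<le> 2 * norm (x - y)" for x y
  proof -
    have "\<pi> x - \<pi> y = (x - y) - ((x - y) \<bullet> e) *\<^sub>R e"
      by (simp add: \<pi>_def inner_diff_left algebra_simps)
    also have "norm \<dots> \<le> norm (x - y) + \<bar>(x - y) \<bullet> e\<bar>"
      using norm_triangle_ineq4[of "x - y" "((x - y) \<bullet> e) *\<^sub>R e"] e by simp
    finally show ?thesis using ie[of "x - y"] by linarith
  qed
  have \<gamma>d: "\<bar>\<gamma> (\<pi> x) - \<gamma> (\<pi> y)\<bar> \<le> 2 * L * norm (x - y)" for x y
  proof -
    have "\<bar>\<gamma> (\<pi> x) - \<gamma> (\<pi> y)\<bar> \<le> L * norm (\<pi> x - \<pi> y)"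
      using lipschitz_onD[OF \<gamma>, of "\<pi> x" "\<pi> y"] \<pi>0 by (simp add: dist_norm)
    also have "\<dots> \<le> L * (2 * norm (x - y))"
      by (intro mult_left_mono \<pi>dist L)
    finally show ?thesis by simp
  qed
  have graph': "x \<in> U \<longleftrightarrow> \<gamma> (\<pi> x) < x \<bullet> e" if "x \<in> ball p r" for x
  proof -
    have "x \<in> U \<inter> ball p r \<longleftrightarrow> x \<in> {x \<in> ball p r. \<gamma> (x - (x \<bullet> e) *\<^sub>R e) < x \<bullet> e}"
      by (simp only: graph)
    then show ?thesis using that by (simp add: \<pi>_def)
  qed
  \<comment> \<open>The graph condition speaks of points of \<open>U\<close> only; at the boundary point itself it survives as a weak inequality by continuity.\<close>
  have \<gamma>p: "\<gamma> (\<pi> p) \<le> p \<bullet> e"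
  proof (rule ccontr)
    assume "\<not> \<gamma> (\<pi> p) \<le> p \<bullet> e"
    then have pos: "\<gamma> (\<pi> p) - p \<bullet> e > 0" (is "?\<epsilon> > 0") by simp
    let ?s = "min r (?\<epsilon> / (2 * L + 1))"
    have s: "?s > 0" using pos r L by simp
    have "p \<in> closure U" using p by (simp add: frontier_def)
    then obtain x where x: "x \<in> U" "dist x p < ?s"
      using s closure_approachable by blast
    have xb: "x \<in> ball p r" using x(2) by (simp add: dist_commute)
    have "norm (x - p) * (2 * L + 1) < ?\<epsilon>"
      using x(2) L by (simp add: dist_norm pos_less_divide_eq)
    moreover have "\<gamma> (\<pi> x) < x \<bullet> e" using graph'[OF xb] x(1) by simp
    moreover have "\<bar>x \<bullet> e - p \<bullet> e\<bar> \<le> norm (x - p)"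
      using ie[of "x - p"] by (simp add: inner_diff_left)
    ultimately show False
      using \<gamma>d[of x p] by (simp add: algebra_simps abs_le_iff)
  qed
  \<comment> \<open>Slide by \<open>\<rho>\<close>. The radius \<open>r'\<close> is so small that the rise \<open>\<rho> - r'\<close> beats the variation \<open>2 * L * r'\<close> of the graph over the ball.\<close>
  define \<rho> where "\<rho> = r / 2"
  define r' where "r' = \<rho> / (2 * L + 2)"
  have \<rho>: "\<rho> > 0" using r by (simp add: \<rho>_def)
  have r': "r' > 0" "(2 * L + 2) * r' = \<rho>"
    using \<rho> L by (simp_all add: r'_def)
  have "2 * L * r' \<ge> 0" using L r' by simp
  then have r'\<rho>: "2 * r' \<le> \<rho>" "2 * L * r' < \<rho> - r'"
    using r' by (simp_all add: algebra_simps)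
  let ?h = "\<rho> *\<^sub>R e"
  have ball: "ball (p + ?h) r' \<subseteq> U"
  proof
    fix x assume x: "x \<in> ball (p + ?h) r'"
    then have xn: "norm (x - ?h - p) < r'"
      by (simp add: dist_norm norm_minus_commute algebra_simps)
    have "norm (x - p) \<le> norm (x - ?h - p) + norm ?h"
      using norm_triangle_ineq[of "x - ?h - p" ?h] by simp
    then have "norm (x - p) < r"
      using xn e \<rho> r'\<rho> r'(1) by (simp add: \<rho>_def)
    then have xb: "x \<in> ball p r" by (simp add: dist_norm norm_minus_commute)
    have "\<pi> (x - ?h) = \<pi> x" using \<pi>shift[of "x - ?h" \<rho>] by simp
    then have "\<gamma> (\<pi> x) \<le> \<gamma> (\<pi> p) + 2 * L * norm (x - ?h - p)"
      using \<gamma>d[of "x - ?h" p] by (simp add: abs_le_iff)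
    also have "\<dots> \<le> p \<bullet> e + 2 * L * r'"
      using \<gamma>p xn L by (intro add_mono mult_left_mono) auto
    also have "\<dots> < p \<bullet> e + \<rho> - r'" using r'\<rho>(2) by linarith
    also have "\<dots> \<le> x \<bullet> e"
      using ie[of "x - ?h - p"] xn by (simp add: inner_diff_left ee abs_le_iff)
    finally show "x \<in> U" using graph'[OF xb] by simp
  qed
  have "poincare_on U (U \<inter> ball p r')"
  proof (rule poincare_on_shift)
    show "open (U \<inter> ball p r')" "bounded (U \<inter> ball p r')"
      using U by (auto intro: bounded_subset[OF bounded_ball])
    show "poincare_on U (ball (p + ?h) r')"
      using ball by (intro poincare_on_convex) auto
    show "x + ?h \<in> ball (p + ?h) r'" if "x \<in> U \<inter> ball p r'" for x
      using that by (simp add: dist_norm)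
    fix x and t :: real assume x: "x \<in> U \<inter> ball p r'" and t: "0 \<le> t" "t \<le> 1"
    have tr: "0 \<le> t * \<rho>" "t * \<rho> \<le> \<rho>" using t \<rho> by (auto simp: mult_left_le_one_le)
    have xn: "norm (x - p) < r'" using x by (simp add: dist_norm norm_minus_commute)
    have "norm (x + t *\<^sub>R ?h - p) \<le> norm (x - p) + norm (t *\<^sub>R ?h)"
      using norm_triangle_ineq[of "x - p" "t *\<^sub>R ?h"] by (simp add: algebra_simps)
    also have "\<dots> < r"
    proof -
      have "norm (t *\<^sub>R ?h) \<le> \<rho>"
        using tr e t \<rho> by (simp add: abs_mult)
      moreover have "r = 2 * \<rho>" by (simp add: \<rho>_def)
      ultimately show ?thesis using xn r'\<rho>(1) r'(1) by linarith
    qed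
    finally have xb: "x + t *\<^sub>R ?h \<in> ball p r"
      by (simp add: dist_norm norm_minus_commute)
    have "x \<in> ball p r" using xn r'\<rho> \<rho> r'(1) by (simp add: \<rho>_def dist_norm norm_minus_commute)
    then have "\<gamma> (\<pi> x) < x \<bullet> e" using graph' x by blast
    then show "x + t *\<^sub>R ?h \<in> U"
      using graph'[OF xb] \<pi>shift[of x "t * \<rho>"] tr by (simp add: inner_add_left ee)
  qed
  then show ?thesis using r'(1) by blast
qed

text \<open>Balls inside \<open>U\<close> and boundary pieces cover the compact closure; finitely many of them are glued.\<close>

theorem poincare_on_lipschitz_domain:
  fixes U :: "'a::euclidean_space set"
  assumes U: "open U" "bounded U" "connected U" "U \<noteq> {}" and lip: "lipschitz_boundary U"
  shows "poincare_on U U"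
proof -
  have loc: "\<exists>r>0. poincare_on U (U \<inter> ball p r)" if p: "p \<in> closure U" for p
  proof (cases "p \<in> U")
    case True
    then obtain r where r: "r > 0" "ball p r \<subseteq> U"
      using U(1) openE by blast
    then have "poincare_on U (ball p r)"
      by (intro poincare_on_convex) auto
    moreover have "U \<inter> ball p r = ball p r" using r by blast
    ultimately show ?thesis using r(1) by auto
  next
    case False
    then have "p \<in> frontier U" using p U(1) by (simp add: frontier_def interior_open)
    then show ?thesis by (rule lipschitz_boundary_point_poincare_on[OF U(1) lip])
  qed
  then obtain r where r: "\<And>p. p \<in> closure U \<Longrightarrow> r p > 0 \<and> poincare_on U (U \<inter> ball p (r p))"
    by metis
  have "compact (closure U)" using U(2) by (simp add: compact_closure)
  moreover have "closure U \<subseteq> (\<Union>p\<in>closure U. ball p (r p))"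
    using r by force
  ultimately obtain C where C: "C \<subseteq> closure U" "finite C" "closure U \<subseteq> (\<Union>p\<in>C. ball p (r p))"
    using compactE_image[of "closure U" "closure U" "\<lambda>p. ball p (r p)"] by (metis open_ball)
  let ?V = "(\<lambda>p. U \<inter> ball p (r p)) ` C"
  have eq: "\<Union>?V = U" using C(3) closure_subset[of U] by blast
  have "poincare_on U (\<Union>?V)"
  proof (rule poincare_on_connected_Union)
    show "finite ?V" using C(2) by simp
    show "poincare_on U V" if "V \<in> ?V" for V
      using that C(1) r by auto
    show "connected (\<Union>?V)" "\<Union>?V \<noteq> {}"
      unfolding eq using U by auto
  qed
  then show ?thesis by (simp only: eq)
qed

section \<open>Square integrable functions\<close>

definition nn_square :: "'c measure \<Rightarrow> ('c \<Rightarrow> 'b::euclidean_space) \<Rightarrow> ennreal" where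
  "nn_square M F = (\<integral>\<^sup>+x. ennreal ((norm (F x))\<^sup>2) \<partial>M)"

lemma nn_square_finite_iff:
  assumes [measurable]: "F \<in> borel_measurable M"
  shows "nn_square M F < \<infinity> \<longleftrightarrow> integrable M (\<lambda>x. (norm (F x))\<^sup>2)"
  unfolding nn_square_def integrable_iff_bounded by auto

lemma nn_square_eq_integral:
  assumes [measurable]: "F \<in> borel_measurable M" and "nn_square M F < \<infinity>"
  shows "nn_square M F = ennreal (\<integral>x. (norm (F x))\<^sup>2 \<partial>M)"
  using assms nn_square_finite_iff[of F M] unfolding nn_square_def
  by (intro nn_integral_eq_integral) auto

lemma L2_iff_nn_square:
  "L2 U u \<longleftrightarrow> u \<in> borel_measurable (lebesgue_on U) \<and> nn_square (lebesgue_on U) u < \<infinity>"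
  unfolding L2_def using nn_square_finite_iff by blast

lemma nn_square_cong_AE: "AE x in M. F x = H x \<Longrightarrow> nn_square M F = nn_square M H"
  unfolding nn_square_def by (intro nn_integral_cong_AE) auto

lemma integrable_inner_if_square_integrable:
  assumes [measurable]: "F \<in> borel_measurable M" "H \<in> borel_measurable M"
    and "nn_square M F < \<infinity>" "nn_square M H < \<infinity>"
  shows "integrable M (\<lambda>x. F x \<bullet> H x)"
proof (rule Bochner_Integration.integrable_bound)
  show "integrable M (\<lambda>x. (norm (F x))\<^sup>2 + (norm (H x))\<^sup>2)"
    using assms by (intro Bochner_Integration.integrable_add nn_square_finite_iff[THEN iffD1])
  show "AE x in M. norm (F x \<bullet> H x) \<le> norm ((norm (F x))\<^sup>2 + (norm (H x))\<^sup>2)"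
  proof (intro AE_I2)
    fix x
    have "\<bar>F x \<bullet> H x\<bar> \<le> norm (F x) * norm (H x)"
      by (rule Cauchy_Schwarz_ineq2)
    also have "\<dots> \<le> (norm (F x))\<^sup>2 + (norm (H x))\<^sup>2"
      using sum_squares_bound[of "norm (F x)" "norm (H x)"]
        mult_nonneg_nonneg[OF norm_ge_zero norm_ge_zero, of "F x" "H x"] by linarith
    finally show "norm (F x \<bullet> H x) \<le> norm ((norm (F x))\<^sup>2 + (norm (H x))\<^sup>2)"
      by simp
  qed
qed measurable

text \<open>Stated for any \<open>W\<close> that equals \<open>F + c H\<close> almost everywhere, because the weak gradient of a linear
  combination is known only up to null sets.\<close>

lemma nn_square_add_scaled:
  fixes F H W :: "'c \<Rightarrow> 'b::euclidean_space"
  assumes [measurable]: "F \<in> borel_measurable M" "H \<in> borel_measurable M" "W \<in> borel_measurable M"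
    and fin: "nn_square M F < \<infinity>" "nn_square M H < \<infinity>"
    and W: "AE x in M. W x = F x + c *\<^sub>R H x"
  shows "nn_square M W < \<infinity>"
    and "enn2real (nn_square M W) =
      enn2real (nn_square M F) + 2 * c * (\<integral>x. F x \<bullet> H x \<partial>M) + c\<^sup>2 * enn2real (nn_square M H)"
proof -
  have i: "integrable M (\<lambda>x. (norm (F x))\<^sup>2)" "integrable M (\<lambda>x. F x \<bullet> H x)" "integrable M (\<lambda>x. (norm (H x))\<^sup>2)"
    by (intro nn_square_finite_iff[THEN iffD1] integrable_inner_if_square_integrable assms(1,2) fin)+
  have eq: "AE x in M. (norm (W x))\<^sup>2 = (norm (F x))\<^sup>2 + 2 * c * (F x \<bullet> H x) + c\<^sup>2 * (norm (H x))\<^sup>2"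
    using W by eventually_elim
      (simp add: power2_norm_eq_inner inner_add_left inner_add_right inner_commute power2_eq_square[of c] algebra_simps)
  have "integrable M (\<lambda>x. (norm (F x))\<^sup>2 + 2 * c * (F x \<bullet> H x) + c\<^sup>2 * (norm (H x))\<^sup>2)"
    using i by simp
  then have "integrable M (\<lambda>x. (norm (W x))\<^sup>2)"
    by (subst integrable_cong_AE[OF _ _ eq]) auto
  then show *: "nn_square M W < \<infinity>"
    by (intro nn_square_finite_iff[THEN iffD2]) auto
  have r: "enn2real (nn_square M X) = (\<integral>x. (norm (X x))\<^sup>2 \<partial>M)"
    if "X \<in> borel_measurable M" "nn_square M X < \<infinity>" for X :: "'c \<Rightarrow> 'b"
    using nn_square_eq_integral[OF that] by simp
  have "(\<integral>x. (norm (W x))\<^sup>2 \<partial>M) = (\<integral>x. (norm (F x))\<^sup>2 + 2 * c * (F x \<bullet> H x) + c\<^sup>2 * (norm (H x))\<^sup>2 \<partial>M)"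
    by (intro integral_cong_AE eq) auto
  then show "enn2real (nn_square M W) =
      enn2real (nn_square M F) + 2 * c * (\<integral>x. F x \<bullet> H x \<partial>M) + c\<^sup>2 * enn2real (nn_square M H)"
    using i r[OF assms(3) *] r[OF assms(1) fin(1)] r[OF assms(2) fin(2)] by simp
qed

lemma nn_integral_norm_square_le:
  assumes [measurable]: "F \<in> borel_measurable M"
  shows "(\<integral>\<^sup>+x. ennreal (norm (F x)) \<partial>M)\<^sup>2 \<le> nn_square M F * emeasure M (space M)"
  using Cauchy_Schwarz_nn_integral[of "\<lambda>x. ennreal (norm (F x))" M "\<lambda>_. 1"]
  by (simp add: nn_square_def ennreal_power)

lemma (in finite_measure) integrable_if_square_integrable:
  assumes [measurable]: "F \<in> borel_measurable M" and "nn_square M F < \<infinity>"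
  shows "integrable M F"
proof (rule integrableI_bounded)
  have "nn_square M F * emeasure M (space M) < \<infinity>"
    using assms(2) finite_emeasure_space by (auto simp: ennreal_mult_eq_top_iff less_top[symmetric])
  then have "(\<integral>\<^sup>+x. ennreal (norm (F x)) \<partial>M)\<^sup>2 < \<infinity>"
    by (rule le_less_trans[OF nn_integral_norm_square_le[OF assms(1)]])
  then show "(\<integral>\<^sup>+x. ennreal (norm (F x)) \<partial>M) < \<infinity>"
    by (simp add: power_less_top_ennreal)
qed fact

lemma L2_integrable:
  "open U \<Longrightarrow> bounded U \<Longrightarrow> L2 U u \<Longrightarrow> integrable (lebesgue_on U) u"
  using finite_measure.integrable_if_square_integrable[OF finite_measure_lebesgue_on_bounded]
  by (auto simp: L2_iff_nn_square)

lemma L2_add_scaled: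
  assumes "L2 U u" "L2 U v"
  shows "L2 U (\<lambda>x. u x + c *\<^sub>R v x)"
proof -
  have [measurable]: "u \<in> borel_measurable (lebesgue_on U)" "v \<in> borel_measurable (lebesgue_on U)"
    using assms by (auto simp: L2_iff_nn_square)
  show ?thesis
    using nn_square_add_scaled(1)[of u "lebesgue_on U" v "\<lambda>x. u x + c *\<^sub>R v x" c] assms
    by (simp add: L2_iff_nn_square)
qed

section \<open>The Poincare inequality in the Sobolev space\<close>

lemma lebesgue_ex_borel_representative:
  fixes g :: "'a::euclidean_space \<Rightarrow> 'b::euclidean_space"
  assumes g: "g \<in> borel_measurable lebesgue"
  shows "\<exists>g'\<in>borel_measurable borel. AE x in lebesgue. g x = g' x"
proof -
  have "\<exists>h\<in>borel_measurable lborel. AE x in lborel. g x \<bullet> b = h x" for b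
    using g by (intro completion_ex_borel_measurable_real borel_measurable_inner borel_measurable_const)
  then obtain h where h: "\<And>b. h b \<in> borel_measurable lborel" "\<And>b. AE x in lborel. g x \<bullet> b = h b x"
    by metis
  note h(1)[unfolded measurable_lborel2, measurable]
  have "AE x in lborel. \<forall>b\<in>Basis. g x \<bullet> b = h b x"
    using h(2) countable_finite[OF finite_Basis] by (subst AE_ball_countable) auto
  then have "AE x in lborel. g x = (\<Sum>b\<in>Basis. h b x *\<^sub>R b)"
    by eventually_elim (metis (no_types, lifting) euclidean_representation sum.cong)
  then have "AE x in lebesgue. g x = (\<Sum>b\<in>Basis. h b x *\<^sub>R b)"
    by (rule AE_completion)
  moreover have "(\<lambda>x. \<Sum>b\<in>Basis. h b x *\<^sub>R b) \<in> borel_measurable borel"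
    by measurable
  ultimately show ?thesis
    by (intro bexI[of _ "\<lambda>x. \<Sum>b\<in>Basis. h b x *\<^sub>R b"])
qed

lemma integrable_ex_borel_representative:
  fixes g :: "'a::euclidean_space \<Rightarrow> 'b::euclidean_space"
  assumes U: "open U" and g: "integrable (lebesgue_on U) g"
  shows "\<exists>g0. integrable lborel g0 \<and> (\<forall>x. x \<notin> U \<longrightarrow> g0 x = 0) \<and> (AE x in lebesgue. indicator U x *\<^sub>R g x = g0 x)"
proof -
  let ?g = "\<lambda>x. indicator U x *\<^sub>R g x"
  have ig: "integrable lebesgue ?g"
    using g U by (simp add: integrable_restrict_space)
  then have m: "?g \<in> borel_measurable lebesgue" by auto
  obtain g' where g': "g' \<in> borel_measurable borel" "AE x in lebesgue. ?g x = g' x"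
    using lebesgue_ex_borel_representative[OF m] by blast
  note [measurable] = g'(1)
  define g0 where "g0 x = indicator U x *\<^sub>R g' x" for x
  have [measurable]: "U \<in> sets borel" using U by auto
  have [measurable]: "g0 \<in> borel_measurable borel"
    unfolding g0_def by measurable
  have ae: "AE x in lebesgue. ?g x = g0 x"
    using g'(2) by eventually_elim (auto simp: g0_def split: split_indicator)
  have "integrable lebesgue g0"
    using integrable_cong_AE[OF m borel_measurable_lebesgueI ae] ig by simp
  then have "integrable lborel g0"
    by (subst (asm) integrable_completion) auto
  then show ?thesis
    using ae by (intro exI[of _ g0]) (auto simp: g0_def)
qed

lemma borel_measurable_lebesgue_on_subset:
  fixes u :: "'a::euclidean_space \<Rightarrow> real"
  assumes u: "u \<in> borel_measurable (lebesgue_on V)" and "open V" "open W" "W \<subseteq> V"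
  shows "u \<in> borel_measurable (lebesgue_on W)"
proof -
  have s: "V \<inter> space lebesgue \<in> sets lebesgue" "W \<inter> space lebesgue \<in> sets lebesgue"
    using assms by auto
  have "(\<lambda>x. indicator V x *\<^sub>R u x) \<in> borel_measurable lebesgue"
    using u borel_measurable_restrict_space_iff[OF s(1), of u] by blast
  moreover have "(\<lambda>x. indicator W x :: real) \<in> borel_measurable lebesgue"
    using s(2) by (intro borel_measurable_indicator) auto
  ultimately have "(\<lambda>x. indicator W x *\<^sub>R (indicator V x *\<^sub>R u x)) \<in> borel_measurable lebesgue"
    by (rule borel_measurable_scaleR[rotated])
  also have "(\<lambda>x. indicator W x *\<^sub>R (indicator V x *\<^sub>R u x)) = (\<lambda>x. indicator W x *\<^sub>R u x)"
    using assms(4) by (auto simp: fun_eq_iff split: split_indicator)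
  finally show ?thesis
    using borel_measurable_restrict_space_iff[OF s(2), of u] by simp
qed

lemma H1_weak_gradient:
  assumes "open U" "u \<in> H1 U"
  shows "has_weak_gradient U u (weak_gradient U u)" "L2 U (weak_gradient U u)"
proof -
  obtain g where g: "has_weak_gradient U u g" "L2 U g"
    using assms(2) by (auto simp: H1_def)
  then show "has_weak_gradient U u (weak_gradient U u)"
    by (blast intro: has_weak_gradient_weak_gradient)
  have ae: "AE x in lebesgue_on U. g x = weak_gradient U u x"
    using AE_weak_gradient_eq[OF assms(1) g(1)] by eventually_elim simp
  have U: "U \<inter> space lebesgue \<in> sets lebesgue" using assms(1) by auto
  have "(\<lambda>x. indicator U x *\<^sub>R weak_gradient U u x) \<in> borel_measurable lebesgue"
  proof (rule borel_measurable_AE)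
    show "(\<lambda>x. indicator U x *\<^sub>R g x) \<in> borel_measurable lebesgue"
      using g(2) borel_measurable_restrict_space_iff[OF U, of g] by (simp add: L2_iff_nn_square)
    show "AE x in lebesgue. indicator U x *\<^sub>R g x = indicator U x *\<^sub>R weak_gradient U u x"
      using ae unfolding AE_lebesgue_on_iff[OF assms(1)]
      by eventually_elim (auto split: split_indicator)
  qed
  then have "weak_gradient U u \<in> borel_measurable (lebesgue_on U)"
    using borel_measurable_restrict_space_iff[OF U] by blast
  then show "L2 U (weak_gradient U u)"
    using g(2) nn_square_cong_AE[OF ae] by (simp add: L2_iff_nn_square)
qed

text \<open>This carries the estimates, proved for Borel functions and Borel measure, over to all of \<open>H\<^sup>1\<close>.\<close>

lemma H1_ex_borel_weak_gradient:
  assumes U: "open U" "bounded U" and u: "u \<in> H1 U"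
  shows "\<exists>u0 g0. borel_weak_gradient U u0 g0 \<and> (AE x in lebesgue_on U. u x = u0 x) \<and>
    (AE x in lebesgue_on U. weak_gradient U u x = g0 x)"
proof -
  let ?g = "weak_gradient U u"
  have g: "has_weak_gradient U u ?g" "integrable (lebesgue_on U) ?g"
    using H1_weak_gradient[OF U(1) u] L2_integrable[OF U] by auto
  have iu: "integrable (lebesgue_on U) u"
    using u L2_integrable[OF U] by (auto simp: H1_def)
  obtain u0 where u0: "integrable lborel u0" "\<forall>x. x \<notin> U \<longrightarrow> u0 x = 0"
      "AE x in lebesgue. indicator U x *\<^sub>R u x = u0 x"
    using integrable_ex_borel_representative[OF U(1) iu] by blast
  obtain g0 where g0: "integrable lborel g0" "\<forall>x. x \<notin> U \<longrightarrow> g0 x = 0"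
      "AE x in lebesgue. indicator U x *\<^sub>R ?g x = g0 x"
    using integrable_ex_borel_representative[OF U(1) g(2)] by blast
  have Us: "U \<inter> space lebesgue \<in> sets lebesgue" using U(1) by auto
  have mu: "(\<lambda>x. indicator U x *\<^sub>R u x) \<in> borel_measurable lebesgue"
     "(\<lambda>x. indicator U x *\<^sub>R ?g x) \<in> borel_measurable lebesgue"
    using iu g(2) borel_measurable_restrict_space_iff[OF Us, of u] borel_measurable_restrict_space_iff[OF Us, of ?g]
    by auto
  have m0: "u0 \<in> borel_measurable borel" "g0 \<in> borel_measurable borel"
    using u0 g0 by auto
  have "borel_weak_gradient U u0 g0"
    unfolding borel_weak_gradient_def
  proof (intro conjI allI impI)
    fix \<psi> and b :: 'a assume \<psi>: "test_function U \<psi>" and b: "b \<in> Basis"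
    have s: "smooth \<psi>" using \<psi> by (rule test_function_smooth)
    have m: "\<psi> \<in> borel_measurable borel" "partial b \<psi> \<in> borel_measurable borel"
      using s b by (auto intro: borel_measurable_smooth smooth_partial)
    note ml = borel_measurable_lebesgueI[OF m(1)] borel_measurable_lebesgueI[OF m(2)]
      borel_measurable_lebesgueI[OF m0(1)] borel_measurable_lebesgueI[OF m0(2)]
    have "(\<integral>x. u0 x * partial b \<psi> x \<partial>lborel) = (\<integral>x. u0 x * partial b \<psi> x \<partial>lebesgue)"
      using m m0 by (intro integral_completion[symmetric]) simp
    also have "\<dots> = (\<integral>x. (indicator U x *\<^sub>R u x) * partial b \<psi> x \<partial>lebesgue)"
      using u0(3) ml mu by (intro integral_cong_AE) auto
    also have "\<dots> = (\<integral>x. u x * partial b \<psi> x \<partial>lebesgue_on U)"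
      unfolding integral_lebesgue_on_eq[OF U(1)] by (simp add: mult.assoc)
    also have "\<dots> = - (\<integral>x. (?g x \<bullet> b) * \<psi> x \<partial>lebesgue_on U)"
      using g(1) \<psi> b by (simp add: has_weak_gradient_def)
    also have "(\<integral>x. (?g x \<bullet> b) * \<psi> x \<partial>lebesgue_on U) = (\<integral>x. ((indicator U x *\<^sub>R ?g x) \<bullet> b) * \<psi> x \<partial>lebesgue)"
      unfolding integral_lebesgue_on_eq[OF U(1)] by (simp add: mult.assoc)
    also have "\<dots> = (\<integral>x. (g0 x \<bullet> b) * \<psi> x \<partial>lebesgue)"
    proof (rule integral_cong_AE)
      show "AE x in lebesgue. ((indicator U x *\<^sub>R ?g x) \<bullet> b) * \<psi> x = (g0 x \<bullet> b) * \<psi> x"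
        using g0(3) by eventually_elim (simp only:)
    qed (intro borel_measurable_times borel_measurable_inner borel_measurable_const ml mu)+
    also have "\<dots> = (\<integral>x. (g0 x \<bullet> b) * \<psi> x \<partial>lborel)"
      using m m0 by (intro integral_completion) simp
    finally show "(\<integral>x. u0 x * partial b \<psi> x \<partial>lborel) = - (\<integral>x. (g0 x \<bullet> b) * \<psi> x \<partial>lborel)" .
  qed (use u0 g0 in auto)
  moreover have "AE x in lebesgue_on U. u x = u0 x"
    unfolding AE_lebesgue_on_iff[OF U(1)] using u0(3)
    by eventually_elim (auto split: split_indicator_asm)
  moreover have "AE x in lebesgue_on U. ?g x = g0 x"
    unfolding AE_lebesgue_on_iff[OF U(1)] using g0(3)
    by eventually_elim (auto split: split_indicator_asm)
  ultimately show ?thesis by blast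
qed

lemma spread_cong_AE:
  assumes "AE x in M. u x = v x" "AE y in N. u y = v y"
  shows "spread u M N = spread v M N"
  unfolding spread_def
proof (rule nn_integral_cong_AE)
  show "AE x in M. (\<integral>\<^sup>+y. ennreal ((u x - u y)\<^sup>2) \<partial>N) = (\<integral>\<^sup>+y. ennreal ((v x - v y)\<^sup>2) \<partial>N)"
    using assms(1)
  proof eventually_elim
    case (elim x)
    show ?case
    proof (rule nn_integral_cong_AE)
      show "AE y in N. ennreal ((u x - u y)\<^sup>2) = ennreal ((v x - v y)\<^sup>2)"
        using assms(2) by eventually_elim (simp add: elim)
    qed
  qed
qed

theorem poincare_H1:
  fixes U :: "'a::euclidean_space set"
  assumes U: "open U" "bounded U" "connected U" "U \<noteq> {}" and lip: "lipschitz_boundary U"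
  shows "\<exists>K\<ge>0. \<forall>u\<in>H1 U. spread u (lebesgue_on U) (lebesgue_on U)
    \<le> ennreal K * nn_square (lebesgue_on U) (weak_gradient U u)"
proof -
  obtain K where K: "K \<ge> 0" "\<And>u g. borel_weak_gradient U u g \<Longrightarrow>
        spread u (lebesgue_on U) (lebesgue_on U) \<le> ennreal K * (\<integral>\<^sup>+x. ennreal ((norm (g x))\<^sup>2) \<partial>lborel)"
    using poincare_on_lipschitz_domain[OF U lip] unfolding poincare_on_def by blast
  have "spread u (lebesgue_on U) (lebesgue_on U) \<le> ennreal K * nn_square (lebesgue_on U) (weak_gradient U u)"
    if "u \<in> H1 U" for u
  proof -
    obtain u0 g0 where r: "borel_weak_gradient U u0 g0" "AE x in lebesgue_on U. u x = u0 x"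
        "AE x in lebesgue_on U. weak_gradient U u x = g0 x"
      using H1_ex_borel_weak_gradient[OF U(1,2) \<open>u \<in> H1 U\<close>] by blast
    have z: "g0 x = 0" if "x \<notin> U" for x
      using r(1) that by (simp add: borel_weak_gradient_def)
    have "(\<integral>\<^sup>+x. ennreal ((norm (g0 x))\<^sup>2) \<partial>lborel) = nn_square (lebesgue_on U) g0"
      unfolding nn_square_def nn_integral_lebesgue_on[OF U(1)]
      using z by (intro nn_integral_cong) (auto split: split_indicator)
    also have "\<dots> = nn_square (lebesgue_on U) (weak_gradient U u)"
      using r(3) by (intro nn_square_cong_AE) auto
    finally show ?thesis
      using K(2)[OF r(1)] spread_cong_AE[OF r(2) r(2)] by simp
  qed
  then show ?thesis using K(1) by blast
qed

lemma H1_add_scaled: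
  assumes U: "open U" and u: "u \<in> H1 U" and v: "v \<in> H1 U"
  shows "(\<lambda>x. u x + c * v x) \<in> H1 U"
    and "AE x in lebesgue_on U. weak_gradient U (\<lambda>x. u x + c * v x) x = weak_gradient U u x + c *\<^sub>R weak_gradient U v x"
proof -
  have g: "has_weak_gradient U (\<lambda>x. u x + c * v x) (\<lambda>x. weak_gradient U u x + c *\<^sub>R weak_gradient U v x)"
    by (intro has_weak_gradient_add_scaled H1_weak_gradient U u v)
  moreover have "L2 U (\<lambda>x. weak_gradient U u x + c *\<^sub>R weak_gradient U v x)"
    by (intro L2_add_scaled H1_weak_gradient U u v)
  moreover have "L2 U (\<lambda>x. u x + c * v x)"
    using L2_add_scaled[of U u v c] u v by (auto simp: H1_def)
  ultimately show "(\<lambda>x. u x + c * v x) \<in> H1 U"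
    by (auto simp: H1_def)
  show "AE x in lebesgue_on U. weak_gradient U (\<lambda>x. u x + c * v x) x = weak_gradient U u x + c *\<^sub>R weak_gradient U v x"
    by (rule AE_weak_gradient_eq[OF U g])
qed

lemma smooth_H1:
  fixes \<phi> :: "'a::euclidean_space \<Rightarrow> real"
  assumes U: "open U" "bounded U" and \<phi>: "smooth \<phi>"
  shows "L2 U \<phi>" "\<phi> \<in> H1 U" "AE x in lebesgue_on U. weak_gradient U \<phi> x = grad \<phi> x"
proof -
  have L2c: "L2 U F" if F: "continuous_on UNIV F" for F :: "'a \<Rightarrow> 'b::euclidean_space"
  proof -
    have "F \<in> borel_measurable borel"
      using F by (rule borel_measurable_continuous_onI)
    then have m: "F \<in> borel_measurable (lebesgue_on U)"
      by (intro measurable_restrict_space1 borel_measurable_lebesgueI)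
    have "bounded (F ` closure U)"
      using U(2) F by (intro compact_imp_bounded compact_continuous_image)
         (auto intro: continuous_on_subset)
    then obtain B where B: "\<And>y. y \<in> F ` closure U \<Longrightarrow> norm y \<le> B"
      unfolding bounded_iff by auto
    have "nn_square (lebesgue_on U) F \<le> (\<integral>\<^sup>+x. ennreal (B\<^sup>2) \<partial>lebesgue_on U)"
      unfolding nn_square_def
    proof (intro nn_integral_mono ennreal_leI power_mono)
      fix x assume "x \<in> space (lebesgue_on U)"
      then show "norm (F x) \<le> B" using B closure_subset[of U] by auto
    qed simp
    also have "\<dots> < \<infinity>"
      using emeasure_lborel_bounded[OF U(2)]
      by (simp add: emeasure_lebesgue_on_space[OF U(1)] ennreal_mult_less_top)
    finally show ?thesis using m by (simp add: L2_iff_nn_square)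
  qed
  show "L2 U \<phi>"
    by (rule L2c[OF smooth_continuous[OF \<phi>]])
  moreover have "continuous_on UNIV (grad \<phi>)"
    unfolding grad_def
    by (intro continuous_on_sum continuous_on_scaleR continuous_on_const
        smooth_continuous[OF smooth_partial[OF \<phi>]])
  ultimately show "\<phi> \<in> H1 U"
    using smooth_has_weak_gradient[OF U(1) \<phi>] L2c by (auto simp: H1_def)
  show "AE x in lebesgue_on U. weak_gradient U \<phi> x = grad \<phi> x"
    by (rule AE_weak_gradient_eq[OF U(1) smooth_has_weak_gradient[OF U(1) \<phi>]])
qed

text \<open>For fixed \<open>x\<close>, the mean zero condition kills the cross term in the integral of \<open>(u x - u y)\<^sup>2\<close> over
  \<open>y\<close>, which leaves at least the squared norm of \<open>u\<close>.\<close>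

lemma finite_measure_variance_le:
  fixes u :: "'c \<Rightarrow> real"
  assumes M: "finite_measure M" and [measurable]: "u \<in> borel_measurable M"
    and fin: "nn_square M u < \<infinity>" and mean: "(\<integral>x. u x \<partial>M) = 0"
  shows "emeasure M (space M) * nn_square M u \<le> spread u M M"
proof -
  interpret finite_measure M by fact
  have i: "integrable M u" "integrable M (\<lambda>x. (u x)\<^sup>2)"
    using integrable_if_square_integrable[of u] fin nn_square_finite_iff[of u M] by auto
  have le: "nn_square M u \<le> (\<integral>\<^sup>+y. ennreal ((u x - u y)\<^sup>2) \<partial>M)" for x
  proof -
    have e: "(u x - u y)\<^sup>2 = (u x)\<^sup>2 - 2 * u x * u y + (u y)\<^sup>2" for y
      by (simp add: power2_eq_square algebra_simps)
    have "integrable M (\<lambda>y. (u x - u y)\<^sup>2)"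
      unfolding e using i by auto
    then have "(\<integral>\<^sup>+y. ennreal ((u x - u y)\<^sup>2) \<partial>M) = ennreal (\<integral>y. (u x - u y)\<^sup>2 \<partial>M)"
      by (intro nn_integral_eq_integral) auto
    moreover have "(\<integral>y. (u x - u y)\<^sup>2 \<partial>M) = measure M (space M) * (u x)\<^sup>2 + (\<integral>y. (u y)\<^sup>2 \<partial>M)"
      unfolding e using i mean by simp
    moreover have "nn_square M u = ennreal (\<integral>y. (u y)\<^sup>2 \<partial>M)"
      using nn_square_eq_integral[of u M] fin by simp
    ultimately show ?thesis
      by (simp add: ennreal_leI)
  qed
  have "emeasure M (space M) * nn_square M u = (\<integral>\<^sup>+x. nn_square M u \<partial>M)"
    by (simp add: mult.commute)
  also have "\<dots> \<le> spread u M M"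
    unfolding spread_def by (intro nn_integral_mono le)
  finally show ?thesis .
qed

section \<open>The coupled local and nonlocal energy\<close>

text \<open>The part of the hypotheses that concerns the geometry and the kernels. The interface between the
  two parts is a null set, so almost everywhere statements on \<open>\<Omega>\<close> split.\<close>

locale coupled_domain =
  fixes \<Omega> \<Omega>l \<Omega>nl :: "'a::euclidean_space set"
    and \<delta> s C :: real
    and G :: "'a \<Rightarrow> 'a \<Rightarrow> real"
  assumes open_\<Omega>: "open \<Omega>" and bounded_\<Omega>: "bounded \<Omega>"
    and open_l: "open \<Omega>l" and l_ne: "\<Omega>l \<noteq> {}" and l_sub: "\<Omega>l \<subseteq> \<Omega>"
    and open_n: "open \<Omega>nl" and n_ne: "\<Omega>nl \<noteq> {}" and n_sub: "\<Omega>nl \<subseteq> \<Omega>"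
    and disjoint: "\<Omega>l \<inter> \<Omega>nl = {}"
    and interface_null: "negligible (\<Omega> - (\<Omega>l \<union> \<Omega>nl))"
    and connected_l: "connected \<Omega>l" and lipschitz_l: "lipschitz_boundary \<Omega>l"
    and G_nonneg: "\<And>x y. x \<in> \<Omega>l \<Longrightarrow> y \<in> \<Omega>nl \<Longrightarrow> 0 \<le> G x y"
    and G_measurable: "(\<lambda>(x, y). G x y) \<in> borel_measurable (lebesgue_on (\<Omega>l \<times> \<Omega>nl))"
    and G_pos: "\<exists>c>0. \<forall>x\<in>\<Omega>l. \<forall>y\<in>\<Omega>nl. norm (x - y) \<le> 2 * \<delta> \<longrightarrow> c < G x y"
    and close: "setdist \<Omega>l \<Omega>nl < \<delta>"
    and s_pos: "0 < s" and C_pos: "C > 0"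
begin

abbreviation "M \<equiv> lebesgue_on \<Omega>"
abbreviation "Ml \<equiv> lebesgue_on \<Omega>l"
abbreviation "Mn \<equiv> lebesgue_on \<Omega>nl"
abbreviation "Mnn \<equiv> Mn \<Otimes>\<^sub>M Mn"
abbreviation "Mnl \<equiv> Mn \<Otimes>\<^sub>M Ml"
abbreviation "grad_l \<equiv> weak_gradient \<Omega>l"
abbreviation "H_N \<equiv> H_Neu \<Omega> \<Omega>l \<Omega>nl s"
abbreviation "E_N \<equiv> E_Neu \<Omega> \<Omega>l \<Omega>nl s C G"
abbreviation "E_quad \<equiv> quadratic_energy \<Omega>l \<Omega>nl s C G"

lemma bounded_l: "bounded \<Omega>l" and bounded_n: "bounded \<Omega>nl"
  using bounded_\<Omega> l_sub n_sub bounded_subset by blast+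

sublocale fM: finite_measure M
  by (rule finite_measure_lebesgue_on_bounded[OF open_\<Omega> bounded_\<Omega>])
sublocale fl: finite_measure Ml
  by (rule finite_measure_lebesgue_on_bounded[OF open_l bounded_l])
sublocale fn: finite_measure Mn
  by (rule finite_measure_lebesgue_on_bounded[OF open_n bounded_n])
sublocale nn: pair_sigma_finite Mn Mn ..
sublocale nl: pair_sigma_finite Mn Ml ..

lemma sets_\<Omega>: "\<Omega> \<inter> space lebesgue \<in> sets lebesgue" "\<Omega>l \<inter> space lebesgue \<in> sets lebesgue"
    "\<Omega>nl \<inter> space lebesgue \<in> sets lebesgue"
  using open_\<Omega> open_l open_n by auto

lemma AE_split:
  "AE x in lebesgue. indicator \<Omega> x = (indicator \<Omega>l x + indicator \<Omega>nl x :: 'b::{semiring_1})"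
proof -
  have "AE x in lebesgue. x \<notin> \<Omega> - (\<Omega>l \<union> \<Omega>nl)"
    using interface_null by (intro AE_not_in) (simp add: negligible_iff_null_sets)
  then show ?thesis
    by eventually_elim (use l_sub n_sub disjoint in \<open>auto split: split_indicator\<close>)
qed

lemma AE_\<Omega>_iff: "(AE x in M. P x) \<longleftrightarrow> (AE x in Ml. P x) \<and> (AE x in Mn. P x)"
proof -
  have *: "AE x in lebesgue. x \<in> \<Omega> \<longleftrightarrow> x \<in> \<Omega>l \<or> x \<in> \<Omega>nl"
  proof -
    have "AE x in lebesgue. x \<notin> \<Omega> - (\<Omega>l \<union> \<Omega>nl)"
      using interface_null by (intro AE_not_in) (simp add: negligible_iff_null_sets)
    then show ?thesis
      by eventually_elim (use l_sub n_sub in auto)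
  qed
  show ?thesis
    unfolding AE_lebesgue_on_iff[OF open_\<Omega>] AE_lebesgue_on_iff[OF open_l] AE_lebesgue_on_iff[OF open_n]
      AE_conj_iff[symmetric]
  proof
    assume "AE x in lebesgue. x \<in> \<Omega> \<longrightarrow> P x"
    with * show "AE x in lebesgue. (x \<in> \<Omega>l \<longrightarrow> P x) \<and> (x \<in> \<Omega>nl \<longrightarrow> P x)"
      by eventually_elim auto
  next
    assume "AE x in lebesgue. (x \<in> \<Omega>l \<longrightarrow> P x) \<and> (x \<in> \<Omega>nl \<longrightarrow> P x)"
    with * show "AE x in lebesgue. x \<in> \<Omega> \<longrightarrow> P x"
      by eventually_elim auto
  qed
qed

lemma measurable_\<Omega>:
  fixes u :: "'a \<Rightarrow> real"
  assumes "u \<in> borel_measurable Ml" "u \<in> borel_measurable Mn"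
  shows "u \<in> borel_measurable M"
proof -
  have m: "(\<lambda>x. indicator \<Omega>l x *\<^sub>R u x + indicator \<Omega>nl x *\<^sub>R u x) \<in> borel_measurable lebesgue"
    using assms borel_measurable_restrict_space_iff[OF sets_\<Omega>(2), of u]
      borel_measurable_restrict_space_iff[OF sets_\<Omega>(3), of u]
    by (intro borel_measurable_add) auto
  have "AE x in lebesgue. indicator \<Omega>l x *\<^sub>R u x + indicator \<Omega>nl x *\<^sub>R u x = indicator \<Omega> x *\<^sub>R u x"
    using AE_split[where 'b = real] by eventually_elim (simp add: distrib_right)
  from borel_measurable_AE[OF m this] show ?thesis
    using borel_measurable_restrict_space_iff[OF sets_\<Omega>(1), of u] by simp
qed

lemma nn_integral_\<Omega>:
  assumes "F \<in> borel_measurable Ml" "F \<in> borel_measurable Mn"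
  shows "(\<integral>\<^sup>+x. F x \<partial>M) = (\<integral>\<^sup>+x. F x \<partial>Ml) + (\<integral>\<^sup>+x. F x \<partial>Mn)"
proof -
  have m: "(\<lambda>x. F x * indicator \<Omega>l x) \<in> borel_measurable lebesgue"
     "(\<lambda>x. F x * indicator \<Omega>nl x) \<in> borel_measurable lebesgue"
    using assms borel_measurable_restrict_space_iff_ennreal[OF sets_\<Omega>(2), of F]
      borel_measurable_restrict_space_iff_ennreal[OF sets_\<Omega>(3), of F] by auto
  have "(\<integral>\<^sup>+x. F x \<partial>M) = (\<integral>\<^sup>+x. F x * indicator \<Omega> x \<partial>lebesgue)"
    by (rule nn_integral_restrict_space[OF sets_\<Omega>(1)])
  also have "\<dots> = (\<integral>\<^sup>+x. F x * indicator \<Omega>l x + F x * indicator \<Omega>nl x \<partial>lebesgue)"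
  proof (rule nn_integral_cong_AE)
    show "AE x in lebesgue. F x * indicator \<Omega> x = F x * indicator \<Omega>l x + F x * indicator \<Omega>nl x"
      using AE_split[where 'b = ennreal] by eventually_elim (simp add: distrib_left)
  qed
  also have "\<dots> = (\<integral>\<^sup>+x. F x * indicator \<Omega>l x \<partial>lebesgue) + (\<integral>\<^sup>+x. F x * indicator \<Omega>nl x \<partial>lebesgue)"
    by (rule nn_integral_add[OF m])
  finally show ?thesis
    by (simp only: nn_integral_restrict_space[OF sets_\<Omega>(2)] nn_integral_restrict_space[OF sets_\<Omega>(3)])
qed

lemma nn_square_\<Omega>:
  fixes u :: "'a \<Rightarrow> real"
  assumes [measurable]: "u \<in> borel_measurable Ml" "u \<in> borel_measurable Mn"
  shows "nn_square M u = nn_square Ml u + nn_square Mn u"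
  unfolding nn_square_def by (rule nn_integral_\<Omega>) measurable

lemma L2_\<Omega>_iff: "L2 \<Omega> u \<longleftrightarrow> L2 \<Omega>l u \<and> L2 \<Omega>nl u" for u :: "'a \<Rightarrow> real"
proof -
  have "u \<in> borel_measurable M \<longleftrightarrow> u \<in> borel_measurable Ml \<and> u \<in> borel_measurable Mn"
    using measurable_\<Omega>[of u] borel_measurable_lebesgue_on_subset[OF _ open_\<Omega> open_l l_sub]
      borel_measurable_lebesgue_on_subset[OF _ open_\<Omega> open_n n_sub] by blast
  then show ?thesis
    unfolding L2_iff_nn_square using nn_square_\<Omega>[of u] by auto
qed

definition kern :: "'a \<Rightarrow> 'a \<Rightarrow> real" where
  "kern x y = C / norm (x - y) powr (real DIM('a) + 2 * s)"

lemma kern_nonneg: "0 \<le> kern x y"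
  using C_pos by (simp add: kern_def)

lemma kern_measurable [measurable]: "(\<lambda>(x, y). kern x y) \<in> borel_measurable (borel \<Otimes>\<^sub>M borel)"
  unfolding kern_def by measurable

text \<open>Lebesgue measurability on the product is weaker than measurability for the product of the
  Lebesgue measures; a Borel kernel that agrees with \<open>G\<close> on almost every section restores the latter.\<close>

lemma ex_borel_kernel:
  "\<exists>G'. G' \<in> borel_measurable (borel \<Otimes>\<^sub>M borel) \<and> (\<forall>z. 0 \<le> G' z) \<and>
     (AE y in Mn. AE x in Ml. G x y = G' (x, y))"
proof -
  have op: "open (\<Omega>l \<times> \<Omega>nl)" using open_l open_n by (rule open_Times)
  then have s: "(\<Omega>l \<times> \<Omega>nl) \<inter> space lebesgue \<in> sets lebesgue" by auto
  have "(\<lambda>z. indicator (\<Omega>l \<times> \<Omega>nl) z *\<^sub>R (\<lambda>(x, y). G x y) z) \<in> borel_measurable lebesgue"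
    using G_measurable borel_measurable_restrict_space_iff[OF s] by blast
  then obtain G1 where G1: "G1 \<in> borel_measurable lborel"
      "AE z in lborel. indicator (\<Omega>l \<times> \<Omega>nl) z *\<^sub>R (\<lambda>(x, y). G x y) z = G1 z"
    using completion_ex_borel_measurable_real by blast
  have [measurable]: "G1 \<in> borel_measurable (borel \<Otimes>\<^sub>M borel)"
    using G1(1) by (simp add: borel_prod)
  obtain N where N: "N \<in> null_sets (lborel :: ('a \<times> 'a) measure)"
      "{z \<in> space lborel. indicator (\<Omega>l \<times> \<Omega>nl) z *\<^sub>R (\<lambda>(x, y). G x y) z \<noteq> G1 z} \<subseteq> N"
    using G1(2) unfolding eventually_ae_filter by blast
  then have Ns: "N \<in> sets (lborel \<Otimes>\<^sub>M lborel)"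
    unfolding lborel_prod by auto
  have "AE z in lborel \<Otimes>\<^sub>M lborel. z \<notin> N"
    using N(1) unfolding lborel_prod by (rule AE_not_in)
  then have "AE x in lborel. AE y in lborel. (x, y) \<notin> N"
    by (rule lborel_pair.AE_pair)
  moreover have "{z \<in> space (lborel \<Otimes>\<^sub>M lborel). (fst z, snd z) \<notin> N} \<in> sets (lborel \<Otimes>\<^sub>M lborel)"
    using sets.compl_sets[OF Ns] by (simp add: set_diff_eq)
  ultimately have "AE y in lborel. AE x in lborel. (x, y) \<notin> N"
    using lborel_pair.AE_commute[of "\<lambda>x y. (x, y) \<notin> N"] by blast
  then have ae: "AE y in lebesgue. AE x in lborel. (x, y) \<notin> N"
    by (rule AE_completion)
  have "AE y in Mn. AE x in Ml. G x y = max 0 (G1 (x, y))"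
    unfolding AE_lebesgue_on_iff[OF open_n] using ae
  proof eventually_elim
    case (elim y)
    show ?case
    proof
      assume y: "y \<in> \<Omega>nl"
      show "AE x in Ml. G x y = max 0 (G1 (x, y))"
        unfolding AE_lebesgue_on_iff[OF open_l] using AE_completion[OF elim]
      proof eventually_elim
        case (elim x)
        show ?case
        proof
          assume x: "x \<in> \<Omega>l"
          show "G x y = max 0 (G1 (x, y))"
          proof -
            have "G x y = G1 (x, y)"
              using subsetD[OF N(2), of "(x, y)"] elim x y by auto
            then show ?thesis using G_nonneg[OF x y] by simp
          qed
        qed
      qed
    qed
  qed
  then show ?thesis
    by (intro exI[of _ "\<lambda>z. max 0 (G1 z)"] conjI) auto
qed

definition G_borel :: "'a \<times> 'a \<Rightarrow> real" where
  "G_borel = (SOME G'. G' \<in> borel_measurable (borel \<Otimes>\<^sub>M borel) \<and> (\<forall>z. 0 \<le> G' z) \<and>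
     (AE y in Mn. AE x in Ml. G x y = G' (x, y)))"

lemma G_borel_measurable [measurable]: "G_borel \<in> borel_measurable (borel \<Otimes>\<^sub>M borel)"
  and G_borel_nonneg: "0 \<le> G_borel z"
  and AE_G_borel: "AE y in Mn. AE x in Ml. G x y = G_borel (x, y)"
  using someI_ex[OF ex_borel_kernel] unfolding G_borel_def by blast+

text \<open>With the square roots of the kernels absorbed, the three terms of the energy become squared norms
  of linear maps into \<open>L\<^sup>2\<close> spaces, and the algebra of \<open>nn_square\<close> applies to each of them. The
  coupling term has the nonlocal variable first, in the order of the iterated integral.\<close>

definition nonlocal_diff :: "('a \<Rightarrow> real) \<Rightarrow> 'a \<times> 'a \<Rightarrow> real" where
  "nonlocal_diff u = (\<lambda>(x, y). sqrt (kern x y) * (u y - u x))"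

definition coupling_diff :: "('a \<Rightarrow> real) \<Rightarrow> 'a \<times> 'a \<Rightarrow> real" where
  "coupling_diff u = (\<lambda>(y, x). sqrt (G_borel (x, y)) * (u y - u x))"

lemma id_measurable_lebesgue_on [measurable]: "(\<lambda>x. x) \<in> lebesgue_on V \<rightarrow>\<^sub>M borel"
  using id_borel_measurable_lebesgue_on[of V] by (simp add: id_def)

lemma nonlocal_diff_measurable [measurable]:
  assumes [measurable]: "u \<in> borel_measurable Mn"
  shows "nonlocal_diff u \<in> borel_measurable Mnn"
proof -
  have "(\<lambda>z. (fst z, snd z)) \<in> Mnn \<rightarrow>\<^sub>M borel \<Otimes>\<^sub>M borel"
    by (intro measurable_Pair measurable_compose[OF measurable_fst id_measurable_lebesgue_on]
        measurable_compose[OF measurable_snd id_measurable_lebesgue_on])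
  from measurable_compose[OF this kern_measurable]
  have [measurable]: "(\<lambda>(x, y). kern x y) \<in> borel_measurable Mnn"
    by (simp add: case_prod_beta)
  show ?thesis unfolding nonlocal_diff_def by measurable
qed

lemma coupling_diff_measurable [measurable]:
  assumes [measurable]: "u \<in> borel_measurable Mn" "u \<in> borel_measurable Ml"
  shows "coupling_diff u \<in> borel_measurable Mnl"
proof -
  have "(\<lambda>z. (snd z, fst z)) \<in> Mnl \<rightarrow>\<^sub>M borel \<Otimes>\<^sub>M borel"
    by (intro measurable_Pair measurable_compose[OF measurable_fst id_measurable_lebesgue_on]
        measurable_compose[OF measurable_snd id_measurable_lebesgue_on])
  from measurable_compose[OF this G_borel_measurable]
  have [measurable]: "(\<lambda>(y, x). G_borel (x, y)) \<in> borel_measurable Mnl"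
    by (simp add: case_prod_beta)
  show ?thesis unfolding coupling_diff_def by measurable
qed

definition qform_nn :: "('a \<Rightarrow> real) \<Rightarrow> ennreal" where
  "qform_nn u = nn_square Ml (grad_l u) + nn_square Mnn (nonlocal_diff u) + nn_square Mnl (coupling_diff u)"

lemma nn_square_nonlocal_diff:
  assumes [measurable]: "u \<in> borel_measurable Mn"
  shows "nn_square Mnn (nonlocal_diff u) = (\<integral>\<^sup>+x. (\<integral>\<^sup>+y. ennreal (kern x y * \<bar>u y - u x\<bar>\<^sup>2) \<partial>Mn) \<partial>Mn)"
proof -
  have "nn_square Mnn (nonlocal_diff u) = (\<integral>\<^sup>+x. (\<integral>\<^sup>+y. ennreal ((norm (nonlocal_diff u (x, y)))\<^sup>2) \<partial>Mn) \<partial>Mn)"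
    unfolding nn_square_def by (rule fn.nn_integral_fst[symmetric]) measurable
  then show ?thesis
    using kern_nonneg by (simp add: nonlocal_diff_def power_mult_distrib)
qed

lemma nn_square_coupling_diff:
  assumes [measurable]: "u \<in> borel_measurable Mn" "u \<in> borel_measurable Ml"
  shows "nn_square Mnl (coupling_diff u) = (\<integral>\<^sup>+y. (\<integral>\<^sup>+x. ennreal (G x y * \<bar>u y - u x\<bar>\<^sup>2) \<partial>Ml) \<partial>Mn)"
proof -
  have "nn_square Mnl (coupling_diff u) = (\<integral>\<^sup>+y. (\<integral>\<^sup>+x. ennreal ((norm (coupling_diff u (y, x)))\<^sup>2) \<partial>Ml) \<partial>Mn)"
    unfolding nn_square_def by (rule fl.nn_integral_fst[symmetric]) measurable
  also have "\<dots> = (\<integral>\<^sup>+y. (\<integral>\<^sup>+x. ennreal (G x y * \<bar>u y - u x\<bar>\<^sup>2) \<partial>Ml) \<partial>Mn)"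
  proof (rule nn_integral_cong_AE)
    show "AE y in Mn. (\<integral>\<^sup>+x. ennreal ((norm (coupling_diff u (y, x)))\<^sup>2) \<partial>Ml) = (\<integral>\<^sup>+x. ennreal (G x y * \<bar>u y - u x\<bar>\<^sup>2) \<partial>Ml)"
      using AE_G_borel
    proof eventually_elim
      case (elim y)
      show ?case
      proof (rule nn_integral_cong_AE)
        show "AE x in Ml. ennreal ((norm (coupling_diff u (y, x)))\<^sup>2) = ennreal (G x y * \<bar>u y - u x\<bar>\<^sup>2)"
          using elim by eventually_elim (simp add: coupling_diff_def power_mult_distrib G_borel_nonneg)
      qed
    qed
  qed
  finally show ?thesis .
qed

lemma quadratic_energy_eq:
  assumes u: "u \<in> H1 \<Omega>l" "u \<in> borel_measurable Mn"
  shows "E_quad u = ennreal (1/2) * qform_nn u"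
proof -
  have [measurable]: "grad_l u \<in> borel_measurable Ml" "u \<in> borel_measurable Ml"
    using H1_weak_gradient(2)[OF open_l u(1)] u(1) by (auto simp: L2_iff_nn_square H1_def)
  have "(\<integral>\<^sup>+x. ennreal ((norm (grad_l u x))\<^sup>2 / 2) \<partial>Ml)
      = (\<integral>\<^sup>+x. ennreal (1/2) * ennreal ((norm (grad_l u x))\<^sup>2) \<partial>Ml)"
    using ennreal_mult'[of "1/2" "(norm (grad_l u x))\<^sup>2" for x]
    by (intro nn_integral_cong) simp
  also have "\<dots> = ennreal (1/2) * nn_square Ml (grad_l u)"
    unfolding nn_square_def by (rule nn_integral_cmult) measurable
  finally show ?thesis
    unfolding quadratic_energy_def qform_nn_def nn_square_nonlocal_diff[OF u(2)] nn_square_coupling_diff[OF u(2) \<open>u \<in> borel_measurable Ml\<close>] kern_def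
    by (simp only: distrib_left)
qed

section \<open>The Poincare inequality for the coupled energy\<close>

text \<open>Distances in a bounded set are bounded and the exponent is positive. The diagonal is excluded, since
  there the kernel has the value \<open>C / 0 = 0\<close>.\<close>

lemma kern_lower_bound: "\<exists>k>0. \<forall>x\<in>\<Omega>nl. \<forall>y\<in>\<Omega>nl. x \<noteq> y \<longrightarrow> k \<le> kern x y"
proof -
  obtain R where R: "R > 0" "\<And>x. x \<in> \<Omega>nl \<Longrightarrow> norm x \<le> R"
    using bounded_n unfolding bounded_pos by auto
  let ?p = "real DIM('a) + 2 * s"
  have p: "?p > 0" using s_pos by (simp add: add_nonneg_pos)
  have "C / (2 * R) powr ?p \<le> kern x y" if "x \<in> \<Omega>nl" "y \<in> \<Omega>nl" "x \<noteq> y" for x y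
  proof -
    have "norm (x - y) \<le> 2 * R"
      using norm_triangle_ineq4[of x y] R(2)[OF that(1)] R(2)[OF that(2)] by linarith
    then have "norm (x - y) powr ?p \<le> (2 * R) powr ?p"
      using p by (intro powr_mono2) auto
    then show ?thesis
      unfolding kern_def using C_pos that(3) by (intro divide_left_mono mult_pos_pos) auto
  qed
  moreover have "C / (2 * R) powr ?p > 0"
    using C_pos R(1) by simp
  ultimately show ?thesis by blast
qed

lemma spread_nonlocal: "\<exists>K\<ge>0. \<forall>u. u \<in> borel_measurable Mn \<longrightarrow>
  spread u Mn Mn \<le> ennreal K * nn_square Mnn (nonlocal_diff u)"
proof -
  obtain k where k: "k > 0" "\<And>x y. x \<in> \<Omega>nl \<Longrightarrow> y \<in> \<Omega>nl \<Longrightarrow> x \<noteq> y \<Longrightarrow> k \<le> kern x y"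
    using kern_lower_bound by blast
  have "spread u Mn Mn \<le> ennreal (1 / k) * nn_square Mnn (nonlocal_diff u)" if u: "u \<in> borel_measurable Mn" for u
  proof (rule ennreal_le_divide_real)
    note [measurable] = u
    have "ennreal k * spread u Mn Mn = (\<integral>\<^sup>+x. (\<integral>\<^sup>+y. ennreal k * ennreal ((u x - u y)\<^sup>2) \<partial>Mn) \<partial>Mn)"
      unfolding spread_def by (simp add: nn_integral_cmult)
    also have "\<dots> \<le> nn_square Mnn (nonlocal_diff u)"
      unfolding nn_square_nonlocal_diff[OF u]
    proof (intro nn_integral_mono)
      fix x y assume "x \<in> space Mn" "y \<in> space Mn"
      then have "k * (u x - u y)\<^sup>2 \<le> kern x y * \<bar>u y - u x\<bar>\<^sup>2"
        using k(2)[of x y] by (cases "x = y") (auto simp: power2_commute[of "u x"] intro!: mult_right_mono)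
      then show "ennreal k * ennreal ((u x - u y)\<^sup>2) \<le> ennreal (kern x y * \<bar>u y - u x\<bar>\<^sup>2)"
        using k(1) by (simp add: ennreal_mult[symmetric] ennreal_leI)
    qed
    finally show "ennreal k * spread u Mn Mn \<le> ennreal 1 * nn_square Mnn (nonlocal_diff u)"
      by simp
  qed (use k in auto)
  then show ?thesis
    using k(1) by (intro exI[of _ "1 / k"]) auto
qed

text \<open>Two points at distance less than \<open>\<delta>\<close>, one on either side, have neighbourhoods of radius \<open>\<delta> / 2\<close>
  whose points are at distance less than \<open>2 * \<delta>\<close>, where the coupling kernel is bounded below.\<close>

lemma spread_interface:
  "\<exists>A B K. open A \<and> A \<noteq> {} \<and> A \<subseteq> \<Omega>l \<and> open B \<and> B \<noteq> {} \<and> B \<subseteq> \<Omega>nl \<and> K \<ge> 0 \<and>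
    (\<forall>u. u \<in> borel_measurable Mn \<longrightarrow> u \<in> borel_measurable Ml \<longrightarrow>
      spread u (lebesgue_on B) (lebesgue_on A) \<le> ennreal K * nn_square Mnl (coupling_diff u))"
proof -
  obtain c where c: "c > 0" "\<And>x y. x \<in> \<Omega>l \<Longrightarrow> y \<in> \<Omega>nl \<Longrightarrow> norm (x - y) \<le> 2 * \<delta> \<Longrightarrow> c < G x y"
    using G_pos by blast
  obtain x0 y0 where xy: "x0 \<in> \<Omega>l" "y0 \<in> \<Omega>nl" "dist x0 y0 < \<delta>"
    using close setdist_ltE l_ne n_ne by metis
  have \<delta>: "\<delta> > 0" using xy(3) by (smt (verit) zero_le_dist)
  define A where "A = \<Omega>l \<inter> ball x0 (\<delta> / 2)"
  define B where "B = \<Omega>nl \<inter> ball y0 (\<delta> / 2)"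
  have AB: "open A" "open B" "A \<subseteq> \<Omega>l" "B \<subseteq> \<Omega>nl" "x0 \<in> A" "y0 \<in> B"
    using open_l open_n xy \<delta> by (auto simp: A_def B_def)
  have G: "c < G x y" if "x \<in> A" "y \<in> B" for x y
  proof -
    have "dist x y \<le> dist x x0 + dist x0 y0 + dist y0 y"
      by (metis dist_commute dist_triangle add.assoc add_left_mono order_trans)
    then have "norm (x - y) \<le> 2 * \<delta>"
      using that xy(3) by (simp add: A_def B_def dist_norm[symmetric] dist_commute)
    then show ?thesis using c(2) that AB(3,4) by blast
  qed
  have "spread u (lebesgue_on B) (lebesgue_on A) \<le> ennreal (1 / c) * nn_square Mnl (coupling_diff u)"
    if u: "u \<in> borel_measurable Mn" "u \<in> borel_measurable Ml" for u
  proof (rule ennreal_le_divide_real)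
    have [measurable]: "u \<in> borel_measurable (lebesgue_on A)" "u \<in> borel_measurable (lebesgue_on B)"
      using borel_measurable_lebesgue_on_subset u AB open_l open_n by blast+
    interpret A: sigma_finite_measure "lebesgue_on A"
      using AB(1,3) bounded_l by (intro sigma_finite_lebesgue_on) (auto intro: bounded_subset)
    have "ennreal c * spread u (lebesgue_on B) (lebesgue_on A)
        = (\<integral>\<^sup>+y. \<integral>\<^sup>+x. ennreal c * ennreal ((u y - u x)\<^sup>2) \<partial>lebesgue_on A \<partial>lebesgue_on B)"
      unfolding spread_def by (simp add: nn_integral_cmult)
    also have "\<dots> \<le> (\<integral>\<^sup>+y. \<integral>\<^sup>+x. ennreal (G x y * \<bar>u y - u x\<bar>\<^sup>2) \<partial>lebesgue_on A \<partial>lebesgue_on B)"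
    proof (intro nn_integral_mono)
      fix y x assume "y \<in> space (lebesgue_on B)" "x \<in> space (lebesgue_on A)"
      then have "c * (u y - u x)\<^sup>2 \<le> G x y * \<bar>u y - u x\<bar>\<^sup>2"
        using G[of x y] by (auto intro!: mult_right_mono)
      then show "ennreal c * ennreal ((u y - u x)\<^sup>2) \<le> ennreal (G x y * \<bar>u y - u x\<bar>\<^sup>2)"
        using c(1) by (simp add: ennreal_mult[symmetric] ennreal_leI)
    qed
    also have "\<dots> \<le> nn_square Mnl (coupling_diff u)"
      unfolding nn_square_coupling_diff[OF u] nn_integral_lebesgue_on[OF AB(1)] nn_integral_lebesgue_on[OF AB(2)]
        nn_integral_lebesgue_on[OF open_l] nn_integral_lebesgue_on[OF open_n]
      using AB(3,4) by (intro nn_integral_mono mult_mono) (auto split: split_indicator)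
    finally show "ennreal c * spread u (lebesgue_on B) (lebesgue_on A) \<le> ennreal 1 * nn_square Mnl (coupling_diff u)"
      by simp
  qed (use c in auto)
  then show ?thesis
    using c(1) AB by (intro exI[of _ A] exI[of _ B] exI[of _ "1 / c"]) auto
qed

text \<open>The chain: the local part reaches \<open>A\<close>, the interface links \<open>A\<close> to \<open>B\<close>, and \<open>B\<close> lies in the nonlocal
  part. Each \<open>K\<close> below is the constant of one more link.\<close>

theorem poincare_coupled:
  "\<exists>K>0. \<forall>u. u \<in> H1 \<Omega>l \<longrightarrow> L2 \<Omega>nl u \<longrightarrow> (\<integral>x. u x \<partial>M) = 0 \<longrightarrow> nn_square M u \<le> ennreal K * qform_nn u"
proof -
  obtain K1 where K1: "K1 \<ge> 0" "\<And>u. u \<in> H1 \<Omega>l \<Longrightarrow> spread u Ml Ml \<le> ennreal K1 * nn_square Ml (grad_l u)"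
    using poincare_H1[OF open_l bounded_l connected_l l_ne lipschitz_l] by blast
  obtain K2 where K2: "K2 \<ge> 0" "\<And>u. u \<in> borel_measurable Mn \<Longrightarrow>
      spread u Mn Mn \<le> ennreal K2 * nn_square Mnn (nonlocal_diff u)"
    using spread_nonlocal by blast
  obtain A B K3 where AB: "open A" "A \<noteq> {}" "A \<subseteq> \<Omega>l" "open B" "B \<noteq> {}" "B \<subseteq> \<Omega>nl"
    and K3: "K3 \<ge> 0" "\<And>u. u \<in> borel_measurable Mn \<Longrightarrow> u \<in> borel_measurable Ml \<Longrightarrow>
      spread u (lebesgue_on B) (lebesgue_on A) \<le> ennreal K3 * nn_square Mnl (coupling_diff u)"
    using spread_interface by blast
  have bA: "bounded A" and bB: "bounded B"
    using AB bounded_l bounded_n bounded_subset by blast+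
  let ?m = "measure lborel"
  define K4 where "K4 = 2 * (?m B * K1 + ?m \<Omega>l * K3) / ?m A"
  define K5 where "K5 = 2 * (?m \<Omega>nl * K4 + ?m \<Omega>l * K2) / ?m B"
  define K6 where "K6 = 2 * (?m \<Omega>l * K2 + ?m \<Omega>nl * K4) / ?m B"
  have K4: "K4 \<ge> 0" using K1 K3 by (simp add: K4_def)
  have K56: "K5 \<ge> 0" "K6 \<ge> 0" using K4 K2 by (simp_all add: K5_def K6_def)
  define K where "K = (K1 + K5 + (K6 + K2)) / ?m \<Omega>"
  have mpos: "?m \<Omega> > 0"
    using l_ne l_sub by (intro measure_open_pos open_\<Omega> bounded_\<Omega>) auto
  have K: "K \<ge> 0"
    using K1(1) K2(1) K56 by (simp add: K_def)
  have "nn_square M u \<le> ennreal K * qform_nn u" if u: "u \<in> H1 \<Omega>l" "L2 \<Omega>nl u" and mean: "(\<integral>x. u x \<partial>M) = 0" for u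
  proof -
    have L2: "L2 \<Omega>l u" "L2 \<Omega> u"
      using u L2_\<Omega>_iff by (auto simp: H1_def)
    have m: "u \<in> borel_measurable Ml" "u \<in> borel_measurable Mn" "u \<in> borel_measurable M"
      using L2 u(2) by (auto simp: L2_iff_nn_square)
    note [measurable] = m
    have mA: "u \<in> borel_measurable (lebesgue_on A)" and mB: "u \<in> borel_measurable (lebesgue_on B)"
      using borel_measurable_lebesgue_on_subset m AB open_l open_n by blast+
    let ?s = "\<lambda>V W. spread u (lebesgue_on V) (lebesgue_on W)"
    have ll: "?s \<Omega>l \<Omega>l \<le> ennreal K1 * qform_nn u"
      by (rule order_trans[OF K1(2)[OF u(1)]]) (auto simp: qform_nn_def add.assoc intro!: mult_left_mono)
    have nn: "?s \<Omega>nl \<Omega>nl \<le> ennreal K2 * qform_nn u"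
      by (rule order_trans[OF K2(2)[OF m(2)]])
         (auto simp: qform_nn_def add.assoc add.left_commute[of "nn_square Ml _"] intro!: mult_left_mono)
    have BA: "?s B A \<le> ennreal K3 * qform_nn u"
      by (rule order_trans[OF K3(2)[OF m(2) m(1)]]) (auto simp: qform_nn_def intro!: mult_left_mono)
    have lA: "?s \<Omega>l A \<le> ennreal K1 * qform_nn u"
      by (rule order_trans[OF spread_mono ll]) (use AB open_l in auto)
    have nB: "?s \<Omega>nl B \<le> ennreal K2 * qform_nn u"
      by (rule order_trans[OF spread_mono nn]) (use AB open_n in auto)
    have lB: "?s \<Omega>l B \<le> ennreal K4 * qform_nn u"
      unfolding K4_def
      by (rule spread_link_bound[OF open_l bounded_l AB(4) bB AB(1) bA AB(2) m(1) mB mA K1(1) K3(1) lA BA])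
    have ln: "?s \<Omega>l \<Omega>nl \<le> ennreal K5 * qform_nn u"
      unfolding K5_def
      by (rule spread_link_bound[OF open_l bounded_l open_n bounded_n AB(4) bB AB(5) m(1,2) mB K4 K2(1) lB nB])
    have nl: "?s \<Omega>nl \<Omega>l \<le> ennreal K6 * qform_nn u"
      unfolding K6_def
      by (rule spread_link_bound[OF open_n bounded_n open_l bounded_l AB(4) bB AB(5) m(2,1) mB K2(1) K4 nB lB])
    have i: "(\<integral>\<^sup>+y. ennreal ((u x - u y)\<^sup>2) \<partial>M)
        = (\<integral>\<^sup>+y. ennreal ((u x - u y)\<^sup>2) \<partial>Ml) + (\<integral>\<^sup>+y. ennreal ((u x - u y)\<^sup>2) \<partial>Mn)" for x
      by (rule nn_integral_\<Omega>) measurable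
    have "spread u M M = (?s \<Omega>l \<Omega>l + ?s \<Omega>l \<Omega>nl) + (?s \<Omega>nl \<Omega>l + ?s \<Omega>nl \<Omega>nl)"
      unfolding spread_def i by (subst nn_integral_\<Omega>, measurable) (simp add: nn_integral_add)
    also have "\<dots> \<le> ennreal K1 * qform_nn u + ennreal K5 * qform_nn u + (ennreal K6 * qform_nn u + ennreal K2 * qform_nn u)"
      by (intro add_mono ll ln nl nn)
    also have "\<dots> = ennreal (K1 + K5 + (K6 + K2)) * qform_nn u"
      using K1(1) K2(1) K56 by (simp add: ennreal_plus distrib_right)
    finally have "emeasure M \<Omega> * nn_square M u \<le> ennreal (K1 + K5 + (K6 + K2)) * qform_nn u"
      using finite_measure_variance_le[OF fM.finite_measure_axioms m(3) _ mean] L2(2)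
      by (auto simp: L2_iff_nn_square intro: order_trans)
    then show ?thesis
      unfolding K_def using mpos K1(1) K2(1) K56
      by (intro ennreal_le_divide_real)
         (simp_all add: emeasure_lebesgue_on_space[OF open_\<Omega>] emeasure_lborel_bounded[OF bounded_\<Omega>])
  qed
  \<comment> \<open>The constant is raised by one so that it can serve as a divisor.\<close>
  moreover have "ennreal K * qform_nn u \<le> ennreal (K + 1) * qform_nn u" for u
    using K by (intro mult_right_mono ennreal_leI) auto
  ultimately show ?thesis
    using K by (intro exI[of _ "K + 1"]) (auto intro: order_trans)
qed

end

section \<open>Completeness and weak limits\<close>

lemma nn_square_Fatou:
  fixes F :: "nat \<Rightarrow> 'c \<Rightarrow> 'b::euclidean_space"
  assumes [measurable]: "\<And>k. F k \<in> borel_measurable M" "H \<in> borel_measurable M"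
    and lim: "AE x in M. (\<lambda>k. F k x) \<longlonglongrightarrow> H x"
    and le: "\<And>k. k \<ge> N \<Longrightarrow> nn_square M (F k) \<le> e"
  shows "nn_square M H \<le> e"
proof -
  have "nn_square M H = (\<integral>\<^sup>+x. liminf (\<lambda>k. ennreal ((norm (F k x))\<^sup>2)) \<partial>M)"
    unfolding nn_square_def
  proof (rule nn_integral_cong_AE)
    show "AE x in M. ennreal ((norm (H x))\<^sup>2) = liminf (\<lambda>k. ennreal ((norm (F k x))\<^sup>2))"
      using lim
    proof eventually_elim
      case (elim x)
      have "(\<lambda>k. ennreal ((norm (F k x))\<^sup>2)) \<longlonglongrightarrow> ennreal ((norm (H x))\<^sup>2)"
        by (intro tendsto_ennrealI tendsto_power tendsto_norm elim)
      from lim_imp_Liminf[OF trivial_limit_sequentially this] show ?case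
        by (rule sym)
    qed
  qed
  also have "\<dots> \<le> liminf (\<lambda>k. nn_square M (F k))"
    unfolding nn_square_def by (rule nn_integral_liminf) measurable
  also have "\<dots> \<le> liminf (\<lambda>k. e)"
    by (rule Liminf_mono) (use le in \<open>auto simp: eventually_sequentially\<close>)
  finally show ?thesis by (simp add: Liminf_const)
qed

lemma nn_square_finite_if_diff:
  fixes F H :: "'c \<Rightarrow> 'b::euclidean_space"
  assumes [measurable]: "F \<in> borel_measurable M" "H \<in> borel_measurable M"
    and "nn_square M F < \<infinity>" "nn_square M (\<lambda>x. F x - H x) < \<infinity>"
  shows "nn_square M H < \<infinity>"
  by (rule nn_square_add_scaled(1)[of F M "\<lambda>x. F x - H x" H "-1"]) (use assms in auto)

text \<open>On a finite measure \<open>L\<^sup>2\<close> convergence implies \<open>L\<^sup>1\<close> convergence, which yields an almost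
  everywhere convergent subsequence; Fatou then upgrades the pointwise limit to an \<open>L\<^sup>2\<close> limit.\<close>

lemma square_integrable_complete:
  fixes F :: "nat \<Rightarrow> 'c \<Rightarrow> 'b::euclidean_space"
  assumes M: "finite_measure M" and m [measurable]: "\<And>n. F n \<in> borel_measurable M"
    and fin: "\<And>n. nn_square M (F n) < \<infinity>"
    and Cauchy: "\<And>e. e > 0 \<Longrightarrow> \<exists>N. \<forall>i\<ge>N. \<forall>j\<ge>N. nn_square M (\<lambda>x. F i x - F j x) \<le> ennreal e"
  obtains H r where "H \<in> borel_measurable M" "nn_square M H < \<infinity>" "strict_mono r"
    "AE x in M. (\<lambda>k. F (r k) x) \<longlonglongrightarrow> H x" "(\<lambda>n. nn_square M (\<lambda>x. F n x - H x)) \<longlonglongrightarrow> 0"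
proof -
  interpret finite_measure M by fact
  have int: "integrable M (F n)" for n
    using fin by (intro integrable_if_square_integrable) auto
  have L1: "\<exists>N. \<forall>i\<ge>N. \<forall>j\<ge>N. (\<integral>x. norm (F i x - F j x) \<partial>M) < e" if e: "e > 0" for e
  proof -
    define \<mu> where "\<mu> = measure M (space M) + 1"
    have \<mu>: "\<mu> > 0" "measure M (space M) < \<mu>"
      using measure_nonneg[of M "space M"] unfolding \<mu>_def by linarith+
    obtain N where N: "\<And>i j. i \<ge> N \<Longrightarrow> j \<ge> N \<Longrightarrow> nn_square M (\<lambda>x. F i x - F j x) \<le> ennreal ((e / 2)\<^sup>2 / \<mu>)"
      using Cauchy[of "(e / 2)\<^sup>2 / \<mu>"] e \<mu> by auto
    have "(\<integral>x. norm (F i x - F j x) \<partial>M) < e" if "i \<ge> N" "j \<ge> N" for i j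
    proof -
      let ?I = "\<integral>x. norm (F i x - F j x) \<partial>M"
      have "ennreal (?I\<^sup>2) = (\<integral>\<^sup>+x. ennreal (norm (F i x - F j x)) \<partial>M)\<^sup>2"
        using int by (subst nn_integral_eq_integral) (auto simp: ennreal_power)
      also have "\<dots> \<le> nn_square M (\<lambda>x. F i x - F j x) * emeasure M (space M)"
        by (rule nn_integral_norm_square_le) measurable
      also have "\<dots> \<le> ennreal ((e / 2)\<^sup>2 / \<mu>) * ennreal \<mu>"
        using \<mu> by (intro mult_mono N that) (auto simp: emeasure_eq_measure ennreal_leI)
      also have "\<dots> = ennreal ((e / 2)\<^sup>2)"
        using \<mu> by (simp add: ennreal_mult[symmetric])
      finally have "?I\<^sup>2 \<le> (e / 2)\<^sup>2"
        by simp
      then have "?I \<le> e / 2"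
        by (rule power2_le_imp_le) (use e in simp)
      then show ?thesis using e by simp
    qed
    then show ?thesis by blast
  qed
  obtain r where r: "strict_mono r" "AE x in M. Cauchy (\<lambda>i. F (r i) x)"
    by (rule cauchy_L1_AE_cauchy_subseq[OF int L1])
  define H where "H x = lim (\<lambda>i. F (r i) x)" for x
  have [measurable]: "H \<in> borel_measurable M"
    unfolding H_def by (rule borel_measurable_lim_metric) measurable
  have lim: "AE x in M. (\<lambda>k. F (r k) x) \<longlonglongrightarrow> H x"
    using r(2) by eventually_elim (simp add: H_def Cauchy_convergent_iff convergent_LIMSEQ_iff)
  have le: "\<exists>N. \<forall>n\<ge>N. nn_square M (\<lambda>x. F n x - H x) \<le> ennreal e" if "e > 0" for e
  proof -
    obtain N where N: "\<And>i j. i \<ge> N \<Longrightarrow> j \<ge> N \<Longrightarrow> nn_square M (\<lambda>x. F i x - F j x) \<le> ennreal e"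
      using Cauchy[OF \<open>e > 0\<close>] by blast
    have "nn_square M (\<lambda>x. F n x - H x) \<le> ennreal e" if n: "n \<ge> N" for n
    proof (rule nn_square_Fatou[where F = "\<lambda>k x. F n x - F (r k) x" and N = N])
      show "AE x in M. (\<lambda>k. F n x - F (r k) x) \<longlonglongrightarrow> F n x - H x"
        using lim by eventually_elim (intro tendsto_intros)
      show "nn_square M (\<lambda>x. F n x - F (r k) x) \<le> ennreal e" if "k \<ge> N" for k
        using n that seq_suble[OF r(1), of k] by (intro N) auto
    qed measurable
    then show ?thesis by blast
  qed
  have "(\<lambda>n. nn_square M (\<lambda>x. F n x - H x)) \<longlonglongrightarrow> 0"
  proof (rule tendsto_0_if_Limsup_eq_0_ennreal)
    show "limsup (\<lambda>n. nn_square M (\<lambda>x. F n x - H x)) = 0"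
    proof (rule ccontr)
      assume "limsup (\<lambda>n. nn_square M (\<lambda>x. F n x - H x)) \<noteq> 0"
      then have "0 < limsup (\<lambda>n. nn_square M (\<lambda>x. F n x - H x))"
        by (simp add: zero_less_iff_neq_zero)
      then obtain y where y: "0 < y" "y < limsup (\<lambda>n. nn_square M (\<lambda>x. F n x - H x))"
        using dense by blast
      define e where "e = enn2real y"
      have "y < top" using y(2) by (rule order_less_le_trans) simp
      then have e: "0 < e" "ennreal e < limsup (\<lambda>n. nn_square M (\<lambda>x. F n x - H x))"
        using y by (simp_all add: e_def enn2real_positive_iff)
      obtain N where "\<forall>n\<ge>N. nn_square M (\<lambda>x. F n x - H x) \<le> ennreal e"
        using le[OF e(1)] by blast
      then have "limsup (\<lambda>n. nn_square M (\<lambda>x. F n x - H x)) \<le> ennreal e"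
        by (intro Limsup_bounded) (auto simp: eventually_sequentially)
      with e show False by simp
    qed
  qed
  moreover obtain N where "nn_square M (\<lambda>x. F N x - H x) \<le> ennreal 1"
    using le[of 1] by auto
  then have "nn_square M (\<lambda>x. F N x - H x) < \<infinity>"
    by (simp add: order_le_less_trans)
  then have "nn_square M H < \<infinity>"
    by (rule nn_square_finite_if_diff[OF m \<open>H \<in> borel_measurable M\<close> fin])
  ultimately show ?thesis
    by (intro that[of H r]) (use r(1) lim in auto)
qed

lemma integral_inner_tendsto:
  fixes F :: "nat \<Rightarrow> 'c \<Rightarrow> 'b::euclidean_space"
  assumes [measurable]: "\<And>n. F n \<in> borel_measurable M" "H \<in> borel_measurable M" "k \<in> borel_measurable M"
    and fin: "\<And>n. nn_square M (F n) < \<infinity>" "nn_square M H < \<infinity>" "nn_square M k < \<infinity>"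
    and lim: "(\<lambda>n. nn_square M (\<lambda>x. F n x - H x)) \<longlonglongrightarrow> 0"
  shows "(\<lambda>n. \<integral>x. F n x \<bullet> k x \<partial>M) \<longlonglongrightarrow> (\<integral>x. H x \<bullet> k x \<partial>M)"
proof -
  have i: "integrable M (\<lambda>x. F n x \<bullet> k x)" "integrable M (\<lambda>x. H x \<bullet> k x)" for n
    using fin by (auto intro!: integrable_inner_if_square_integrable)
  define d where "d n = (\<integral>x. F n x \<bullet> k x \<partial>M) - (\<integral>x. H x \<bullet> k x \<partial>M)" for n
  have le: "ennreal ((d n)\<^sup>2) \<le> nn_square M (\<lambda>x. F n x - H x) * nn_square M k" for n
  proof -
    have "d n = (\<integral>x. (F n x - H x) \<bullet> k x \<partial>M)"
      using i by (simp add: d_def inner_diff_left)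
    moreover have "integrable M (\<lambda>x. (F n x - H x) \<bullet> k x)"
      using i by (simp add: inner_diff_left)
    ultimately have "ennreal \<bar>d n\<bar> \<le> (\<integral>\<^sup>+x. ennreal (norm ((F n x - H x) \<bullet> k x)) \<partial>M)"
      using integral_norm_bound_ennreal[of M "\<lambda>x. (F n x - H x) \<bullet> k x"] by simp
    also have "\<dots> \<le> (\<integral>\<^sup>+x. ennreal (norm (F n x - H x)) * ennreal (norm (k x)) \<partial>M)"
      by (intro nn_integral_mono) (simp add: ennreal_mult[symmetric] Cauchy_Schwarz_ineq2 ennreal_leI)
    finally have "(ennreal \<bar>d n\<bar>)\<^sup>2 \<le> (\<integral>\<^sup>+x. ennreal (norm (F n x - H x)) * ennreal (norm (k x)) \<partial>M)\<^sup>2"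
      by (rule power_mono) simp
    also have "\<dots> \<le> nn_square M (\<lambda>x. F n x - H x) * nn_square M k"
      using Cauchy_Schwarz_nn_integral[of "\<lambda>x. ennreal (norm (F n x - H x))" M "\<lambda>x. ennreal (norm (k x))"]
      by (simp add: nn_square_def ennreal_power)
    finally show ?thesis
      by (simp add: ennreal_power)
  qed
  have "(\<lambda>n. nn_square M k * nn_square M (\<lambda>x. F n x - H x)) \<longlonglongrightarrow> nn_square M k * 0"
    using fin(3) by (intro ennreal_tendsto_cmult lim) auto
  then have L: "(\<lambda>n. nn_square M k * nn_square M (\<lambda>x. F n x - H x)) \<longlonglongrightarrow> 0"
    by simp
  have "(\<lambda>n. ennreal ((d n)\<^sup>2)) \<longlonglongrightarrow> 0"
    by (rule tendsto_sandwich[OF _ _ tendsto_const L]) (use le in \<open>auto simp: mult.commute\<close>)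
  then have "(\<lambda>n. ennreal ((d n)\<^sup>2)) \<longlonglongrightarrow> ennreal 0"
    by simp
  then have "(\<lambda>n. (d n)\<^sup>2) \<longlonglongrightarrow> 0"
    by (subst (asm) tendsto_ennreal_iff) auto
  then have "(\<lambda>n. sqrt ((d n)\<^sup>2)) \<longlonglongrightarrow> sqrt 0"
    by (rule tendsto_real_sqrt)
  then have "d \<longlonglongrightarrow> 0"
    by (simp add: tendsto_rabs_zero_iff)
  then show ?thesis
    unfolding d_def by (rule LIM_zero_cancel)
qed

text \<open>The exceptional sets need not be measurable; they are enlarged to measurable null sets so that
  Fubini applies to their products.\<close>

lemma AE_pair_fst_snd:
  assumes "sigma_finite_measure N" and P: "AE x in M. P x" and R: "AE y in N. R y"
    and "sigma_finite_measure M"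
  shows "AE z in M \<Otimes>\<^sub>M N. P (fst z) \<and> R (snd z)"
proof -
  interpret pair_sigma_finite M N
    by (intro pair_sigma_finite.intro assms)
  obtain A where A: "A \<in> null_sets M" "{x \<in> space M. \<not> P x} \<subseteq> A"
    using P unfolding eventually_ae_filter by blast
  obtain B where B: "B \<in> null_sets N" "{y \<in> space N. \<not> R y} \<subseteq> B"
    using R unfolding eventually_ae_filter by blast
  have [measurable]: "A \<in> sets M" "B \<in> sets N" using A B by auto
  have "AE z in M \<Otimes>\<^sub>M N. fst z \<notin> A \<and> snd z \<notin> B"
  proof (rule AE_pair_measure)
    show "{z \<in> space (M \<Otimes>\<^sub>M N). fst z \<notin> A \<and> snd z \<notin> B} \<in> sets (M \<Otimes>\<^sub>M N)"
      by measurable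
    show "AE x in M. AE y in N. fst (x, y) \<notin> A \<and> snd (x, y) \<notin> B"
      using AE_not_in[OF A(1)] by eventually_elim (use AE_not_in[OF B(1)] in auto)
  qed
  with AE_space show ?thesis
    by eventually_elim (use A(2) B(2) in \<open>auto simp: space_pair_measure\<close>)
qed

lemma integrable_locally_integrable_on:
  assumes "open U" "integrable (lebesgue_on U) u"
  shows "u locally_integrable_on U"
  unfolding locally_integrable_on_def
proof (intro allI impI)
  fix K assume K: "compact K \<and> K \<subseteq> U"
  have "u absolutely_integrable_on U"
    using assms by (simp add: set_integrable_def integrable_restrict_space)
  then show "u absolutely_integrable_on K"
    by (rule set_integrable_subset) (use K in \<open>auto intro!: fmeasurableD lmeasurable_compact\<close>)
qed

text \<open>The defining identity of a weak gradient pairs \<open>u\<close> and \<open>g\<close> with bounded functions, so it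
  survives convergence in \<open>L\<^sup>2\<close>.\<close>

lemma has_weak_gradient_limit:
  fixes u :: "nat \<Rightarrow> 'a::euclidean_space \<Rightarrow> real"
  assumes U: "open U" "bounded U"
    and wg: "\<And>n. has_weak_gradient U (u n) (g n)" and L2: "\<And>n. L2 U (u n)" "\<And>n. L2 U (g n)" "L2 U v" "L2 U k"
    and lim: "(\<lambda>n. nn_square (lebesgue_on U) (\<lambda>x. u n x - v x)) \<longlonglongrightarrow> 0"
      "(\<lambda>n. nn_square (lebesgue_on U) (\<lambda>x. g n x - k x)) \<longlonglongrightarrow> 0"
  shows "has_weak_gradient U v k"
  unfolding has_weak_gradient_def
proof (intro conjI allI impI ballI)
  show "v locally_integrable_on U" "k locally_integrable_on U"
    using L2 by (auto intro!: integrable_locally_integrable_on L2_integrable U)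
  fix \<psi> and b :: 'a assume \<psi>: "test_function U \<psi>" and b: "b \<in> Basis"
  have s: "smooth \<psi>" using \<psi> by (rule test_function_smooth)
  have L2\<psi>: "L2 U \<psi>" "L2 U (partial b \<psi>)"
    using s b by (auto intro!: smooth_H1(1) U smooth_partial)
  have m: "\<psi> \<in> borel_measurable (lebesgue_on U)" "partial b \<psi> \<in> borel_measurable (lebesgue_on U)"
    "v \<in> borel_measurable (lebesgue_on U)" "k \<in> borel_measurable (lebesgue_on U)"
    "\<And>n. u n \<in> borel_measurable (lebesgue_on U)" "\<And>n. g n \<in> borel_measurable (lebesgue_on U)"
    using L2\<psi> L2 by (auto simp: L2_iff_nn_square)
  note [measurable] = m
  have n: "nn_square (lebesgue_on U) (\<lambda>x. \<psi> x *\<^sub>R b) < \<infinity>"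
    using L2\<psi>(1) b by (simp add: nn_square_def L2_iff_nn_square)
  have lim_u: "(\<lambda>n. \<integral>x. u n x * partial b \<psi> x \<partial>lebesgue_on U) \<longlonglongrightarrow> (\<integral>x. v x * partial b \<psi> x \<partial>lebesgue_on U)"
    using integral_inner_tendsto[of u "lebesgue_on U" v "partial b \<psi>"] m L2 L2\<psi> lim(1)
    by (simp add: L2_iff_nn_square)
  have "(\<lambda>n. \<integral>x. (g n x \<bullet> b) * \<psi> x \<partial>lebesgue_on U) \<longlonglongrightarrow> (\<integral>x. (k x \<bullet> b) * \<psi> x \<partial>lebesgue_on U)"
    using integral_inner_tendsto[of g "lebesgue_on U" k "\<lambda>x. \<psi> x *\<^sub>R b"] m L2 n lim(2)
    by (simp add: L2_iff_nn_square mult.commute)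
  then have "(\<lambda>n. - (\<integral>x. (g n x \<bullet> b) * \<psi> x \<partial>lebesgue_on U)) \<longlonglongrightarrow> - (\<integral>x. (k x \<bullet> b) * \<psi> x \<partial>lebesgue_on U)"
    by (rule tendsto_minus)
  moreover have "(\<lambda>n. - (\<integral>x. (g n x \<bullet> b) * \<psi> x \<partial>lebesgue_on U)) = (\<lambda>n. \<integral>x. u n x * partial b \<psi> x \<partial>lebesgue_on U)"
  proof
    fix n
    show "- (\<integral>x. (g n x \<bullet> b) * \<psi> x \<partial>lebesgue_on U) = (\<integral>x. u n x * partial b \<psi> x \<partial>lebesgue_on U)"
      using wg[of n] \<psi> b by (simp add: has_weak_gradient_def)
  qed
  ultimately show "(\<integral>x. v x * partial b \<psi> x \<partial>lebesgue_on U) = - (\<integral>x. (k x \<bullet> b) * \<psi> x \<partial>lebesgue_on U)"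
    using LIMSEQ_unique[OF lim_u] by simp
qed

lemma borel_measurable_lebesgue_on_AE:
  fixes f g :: "'a::euclidean_space \<Rightarrow> real"
  assumes V: "open V" and f: "f \<in> borel_measurable (lebesgue_on V)"
    and ae: "AE x in lebesgue_on V. f x = g x"
  shows "g \<in> borel_measurable (lebesgue_on V)"
proof -
  have s: "V \<inter> space lebesgue \<in> sets lebesgue" using V by auto
  have "(\<lambda>x. indicator V x *\<^sub>R g x) \<in> borel_measurable lebesgue"
  proof (rule borel_measurable_AE)
    show "(\<lambda>x. indicator V x *\<^sub>R f x) \<in> borel_measurable lebesgue"
      using f borel_measurable_restrict_space_iff[OF s, of f] by blast
    show "AE x in lebesgue. indicator V x *\<^sub>R f x = indicator V x *\<^sub>R g x"
      using ae unfolding AE_lebesgue_on_iff[OF V]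
      by eventually_elim (auto split: split_indicator)
  qed
  then show ?thesis
    using borel_measurable_restrict_space_iff[OF s, of g] by blast
qed

lemma integral_cong_AE_lebesgue_on:
  fixes f g :: "'a::euclidean_space \<Rightarrow> real"
  assumes "open V" "f \<in> borel_measurable (lebesgue_on V)" "AE x in lebesgue_on V. f x = g x"
  shows "(\<integral>x. f x \<partial>lebesgue_on V) = (\<integral>x. g x \<partial>lebesgue_on V)"
  using borel_measurable_lebesgue_on_AE[OF assms] assms by (intro integral_cong_AE)

context coupled_domain
begin

section \<open>The energy space\<close>

text \<open>The functions of finite energy; the membership in the fractional space is implied
  (\<open>energy_space_iff\<close>).\<close>

definition energy_space :: "('a \<Rightarrow> real) set" where
  "energy_space = {u. u \<in> H1 \<Omega>l \<and> L2 \<Omega>nl u \<and> (\<integral>x. u x \<partial>M) = 0 \<and> qform_nn u < \<infinity>}"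

lemma energy_spaceD:
  assumes "u \<in> energy_space"
  shows "u \<in> H1 \<Omega>l" "L2 \<Omega>nl u" "L2 \<Omega>l u" "L2 \<Omega> u" "(\<integral>x. u x \<partial>M) = 0" "qform_nn u < \<infinity>"
    "u \<in> borel_measurable Ml" "u \<in> borel_measurable Mn" "u \<in> borel_measurable M"
    "grad_l u \<in> borel_measurable Ml"
    "nn_square Ml (grad_l u) < \<infinity>" "nn_square Mnn (nonlocal_diff u) < \<infinity>"
    "nn_square Mnl (coupling_diff u) < \<infinity>" "nn_square M u < \<infinity>"
proof -
  show u: "u \<in> H1 \<Omega>l" "L2 \<Omega>nl u" "(\<integral>x. u x \<partial>M) = 0" "qform_nn u < \<infinity>"
    using assms by (auto simp: energy_space_def)
  show *: "L2 \<Omega>l u" "L2 \<Omega> u"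
    using u L2_\<Omega>_iff by (auto simp: H1_def)
  show "u \<in> borel_measurable Ml" "u \<in> borel_measurable Mn" "u \<in> borel_measurable M" "nn_square M u < \<infinity>"
    using u * by (auto simp: L2_iff_nn_square)
  show "grad_l u \<in> borel_measurable Ml"
    using H1_weak_gradient(2)[OF open_l u(1)] by (simp add: L2_iff_nn_square)
  show "nn_square Ml (grad_l u) < \<infinity>" "nn_square Mnn (nonlocal_diff u) < \<infinity>"
    "nn_square Mnl (coupling_diff u) < \<infinity>"
    using u(4) by (auto simp: qform_nn_def)
qed

lemma Gagliardo_eq:
  assumes [measurable]: "u \<in> borel_measurable Mn"
  shows "(\<integral>\<^sup>+x. (\<integral>\<^sup>+y. ennreal (\<bar>u x - u y\<bar>\<^sup>2 / norm (x - y) powr (real DIM('a) + 2 * s)) \<partial>Mn) \<partial>Mn)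
    = ennreal (1 / C) * nn_square Mnn (nonlocal_diff u)"
proof -
  have [measurable]: "(\<lambda>x. \<integral>\<^sup>+y. ennreal ((norm (nonlocal_diff u (x, y)))\<^sup>2) \<partial>Mn) \<in> borel_measurable Mn"
    by measurable
  have eq: "ennreal (\<bar>u x - u y\<bar>\<^sup>2 / norm (x - y) powr (real DIM('a) + 2 * s))
      = ennreal (1 / C) * ennreal ((norm (nonlocal_diff u (x, y)))\<^sup>2)" for x y
    using C_pos kern_nonneg[of x y]
    by (simp add: nonlocal_diff_def power_mult_distrib ennreal_mult[symmetric] power2_commute[of "u x"])
       (simp add: kern_def)
  have m: "(\<lambda>y. ennreal ((norm (nonlocal_diff u (x, y)))\<^sup>2)) \<in> borel_measurable Mn" if "x \<in> space Mn" for x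
    using that by measurable
  have "(\<integral>\<^sup>+x. (\<integral>\<^sup>+y. ennreal (\<bar>u x - u y\<bar>\<^sup>2 / norm (x - y) powr (real DIM('a) + 2 * s)) \<partial>Mn) \<partial>Mn)
    = (\<integral>\<^sup>+x. ennreal (1 / C) * (\<integral>\<^sup>+y. ennreal ((norm (nonlocal_diff u (x, y)))\<^sup>2) \<partial>Mn) \<partial>Mn)"
    unfolding eq by (intro nn_integral_cong nn_integral_cmult m)
  also have "\<dots> = ennreal (1 / C) * (\<integral>\<^sup>+x. (\<integral>\<^sup>+y. ennreal ((norm (nonlocal_diff u (x, y)))\<^sup>2) \<partial>Mn) \<partial>Mn)"
    by (rule nn_integral_cmult) measurable
  also have "(\<integral>\<^sup>+x. (\<integral>\<^sup>+y. ennreal ((norm (nonlocal_diff u (x, y)))\<^sup>2) \<partial>Mn) \<partial>Mn) = nn_square Mnn (nonlocal_diff u)"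
    unfolding nn_square_def by (rule fn.nn_integral_fst) measurable
  finally show ?thesis .
qed

lemma energy_space_iff: "u \<in> energy_space \<longleftrightarrow> u \<in> H_N \<and> qform_nn u < \<infinity>"
proof
  assume u: "u \<in> energy_space"
  have "u \<in> Hs s \<Omega>nl"
    unfolding Hs_def using energy_spaceD(2,12)[OF u] Gagliardo_eq[OF energy_spaceD(8)[OF u]]
    by (simp add: ennreal_mult_less_top)
  then show "u \<in> H_N \<and> qform_nn u < \<infinity>"
    using energy_spaceD[OF u] by (simp add: H_Neu_def)
next
  assume "u \<in> H_N \<and> qform_nn u < \<infinity>"
  then show "u \<in> energy_space"
    by (auto simp: energy_space_def H_Neu_def Hs_def)
qed

lemma H_Neu_measurable:
  assumes "u \<in> H_N"
  shows "u \<in> H1 \<Omega>l" "u \<in> borel_measurable Mn"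
  using assms by (auto simp: H_Neu_def Hs_def L2_iff_nn_square)

definition qform :: "('a \<Rightarrow> real) \<Rightarrow> real" where
  "qform u = enn2real (qform_nn u)"

text \<open>The polar form of \<open>qform\<close>, see \<open>energy_space_add_scaled\<close>.\<close>

definition bform :: "('a \<Rightarrow> real) \<Rightarrow> ('a \<Rightarrow> real) \<Rightarrow> real" where
  "bform u v = (\<integral>x. grad_l u x \<bullet> grad_l v x \<partial>Ml)
     + (\<integral>z. nonlocal_diff u z \<bullet> nonlocal_diff v z \<partial>Mnn) + (\<integral>z. coupling_diff u z \<bullet> coupling_diff v z \<partial>Mnl)"

lemma qform_nonneg: "qform u \<ge> 0"
  by (simp add: qform_def)

lemma qform_nn_eq: "u \<in> energy_space \<Longrightarrow> qform_nn u = ennreal (qform u)"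
  using energy_spaceD(6) by (simp add: qform_def less_top[symmetric])

lemma qform_eq_sum:
  "u \<in> energy_space \<Longrightarrow> qform u = enn2real (nn_square Ml (grad_l u))
     + enn2real (nn_square Mnn (nonlocal_diff u)) + enn2real (nn_square Mnl (coupling_diff u))"
  using energy_spaceD(11-13)[of u] by (simp add: qform_def qform_nn_def enn2real_plus)

lemma energy_space_add_scaled:
  assumes u: "u \<in> energy_space" and v: "v \<in> energy_space"
  shows "(\<lambda>x. u x + c * v x) \<in> energy_space"
    and "qform (\<lambda>x. u x + c * v x) = qform u + 2 * c * bform u v + c\<^sup>2 * qform v"
proof -
  let ?w = "\<lambda>x. u x + c * v x"
  note U = energy_spaceD[OF u] and V = energy_spaceD[OF v]
  have H: "?w \<in> H1 \<Omega>l"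
    and ae: "AE x in Ml. grad_l ?w x = grad_l u x + c *\<^sub>R grad_l v x"
    using H1_add_scaled[OF open_l U(1) V(1)] by auto
  have L: "L2 \<Omega>nl ?w"
    using L2_add_scaled[OF U(2) V(2), of c] by simp
  have "integrable M u" "integrable M v"
    using U(4) V(4) L2_integrable[OF open_\<Omega> bounded_\<Omega>] by auto
  then have mean: "(\<integral>x. ?w x \<partial>M) = 0"
    using U(5) V(5) by simp
  have mw: "grad_l ?w \<in> borel_measurable Ml" "?w \<in> borel_measurable Ml" "?w \<in> borel_measurable Mn"
    using H1_weak_gradient(2)[OF open_l H] H L by (auto simp: L2_iff_nn_square H1_def)
  have dn: "AE z in Mnn. nonlocal_diff ?w z = nonlocal_diff u z + c *\<^sub>R nonlocal_diff v z"
    by (auto simp: nonlocal_diff_def algebra_simps)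
  have dG: "AE z in Mnl. coupling_diff ?w z = coupling_diff u z + c *\<^sub>R coupling_diff v z"
    by (auto simp: coupling_diff_def algebra_simps)
  note 1 = nn_square_add_scaled[OF U(10) V(10) mw(1) U(11) V(11) ae]
  note 2 = nn_square_add_scaled[OF nonlocal_diff_measurable[OF U(8)] nonlocal_diff_measurable[OF V(8)] nonlocal_diff_measurable[OF mw(3)] U(12) V(12) dn]
  note 3 = nn_square_add_scaled[OF coupling_diff_measurable[OF U(8,7)] coupling_diff_measurable[OF V(8,7)] coupling_diff_measurable[OF mw(3,2)] U(13) V(13) dG]
  show w: "?w \<in> energy_space"
    using H L mean 1(1) 2(1) 3(1) by (simp add: energy_space_def qform_nn_def)
  show "qform ?w = qform u + 2 * c * bform u v + c\<^sup>2 * qform v"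
    unfolding qform_eq_sum[OF w] qform_eq_sum[OF u] qform_eq_sum[OF v] 1(2) 2(2) 3(2) bform_def
    by (simp add: algebra_simps)
qed

lemma energy_space_diff:
  "u \<in> energy_space \<Longrightarrow> v \<in> energy_space \<Longrightarrow> (\<lambda>x. u x - v x) \<in> energy_space"
  using energy_space_add_scaled(1)[of u v "-1"] by simp

lemma zero_energy_space: "(\<lambda>x. 0) \<in> energy_space" and qform_zero: "qform (\<lambda>x. 0) = 0"
proof -
  have s: "smooth (\<lambda>x::'a. 0::real)"
    by (simp add: smooth_def C_k_const)
  have g: "grad (\<lambda>x::'a. 0) x = 0" for x
    by (simp add: grad_def)
  have "nn_square Ml (grad_l (\<lambda>x. 0)) = nn_square Ml (grad (\<lambda>x. 0))"
    by (rule nn_square_cong_AE[OF smooth_H1(3)[OF open_l bounded_l s]])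
  then have "qform_nn (\<lambda>x. 0) = 0"
    by (simp add: qform_nn_def nn_square_def g nonlocal_diff_def coupling_diff_def case_prod_beta)
  then show "(\<lambda>x. 0) \<in> energy_space" "qform (\<lambda>x. 0) = 0"
    using smooth_H1[OF open_l bounded_l s] smooth_H1(1)[OF open_n bounded_n s]
    by (simp_all add: energy_space_def qform_def)
qed

lemma bform_Cauchy_Schwarz:
  assumes u: "u \<in> energy_space" and v: "v \<in> energy_space"
  shows "(bform u v)\<^sup>2 \<le> qform u * qform v"
proof -
  have nn: "0 \<le> qform u + 2 * t * bform u v + t\<^sup>2 * qform v" for t
    using qform_nonneg energy_space_add_scaled(2)[OF u v, of t] by metis
  show ?thesis
  proof (cases "qform v = 0")
    case True
    have "bform u v = 0"
    proof (rule ccontr)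
      assume b: "bform u v \<noteq> 0"
      have "2 * (- (qform u + 1) / (2 * bform u v)) * bform u v = - (qform u + 1)"
        using b by simp
      then show False
        using nn[of "- (qform u + 1) / (2 * bform u v)"] True by simp
    qed
    then show ?thesis using True by simp
  next
    case False
    then have "qform v > 0" using qform_nonneg[of v] by linarith
    moreover have "0 \<le> qform u - (bform u v)\<^sup>2 / qform v"
      using nn[of "- bform u v / qform v"] \<open>qform v > 0\<close> by (simp add: field_simps power2_eq_square)
    ultimately show ?thesis by (simp add: field_simps)
  qed
qed

text \<open>A sequence that is Cauchy in energy converges in \<open>L\<^sup>2\<close> by the Poincare inequality; the gradients
  converge too, and the nonlocal terms pass to the limit by Fatou.\<close>

theorem energy_space_complete:
  assumes w: "\<And>n. w n \<in> energy_space"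
    and Cauchy: "\<And>e. e > 0 \<Longrightarrow> \<exists>N. \<forall>i\<ge>N. \<forall>j\<ge>N. qform (\<lambda>x. w i x - w j x) \<le> e"
  obtains v where "v \<in> energy_space" "(\<lambda>n. qform (\<lambda>x. w n x - v x)) \<longlonglongrightarrow> 0"
    "(\<lambda>n. nn_square M (\<lambda>x. w n x - v x)) \<longlonglongrightarrow> 0"
proof -
  note W = energy_spaceD[OF w]
  note D = energy_space_diff[OF w w]
  obtain K where K: "K > 0" "\<And>u. u \<in> H1 \<Omega>l \<Longrightarrow> L2 \<Omega>nl u \<Longrightarrow> (\<integral>x. u x \<partial>M) = 0 \<Longrightarrow> nn_square M u \<le> ennreal K * qform_nn u"
    using poincare_coupled by blast
  have qC: "\<exists>N. \<forall>i\<ge>N. \<forall>j\<ge>N. qform_nn (\<lambda>x. w i x - w j x) \<le> ennreal e" if "e > 0" for e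
    using Cauchy[OF that] qform_nn_eq[OF D] by (simp add: ennreal_leI) (meson ennreal_leI)
  have C1: "\<exists>N. \<forall>i\<ge>N. \<forall>j\<ge>N. nn_square M (\<lambda>x. w i x - w j x) \<le> ennreal e" if e: "e > 0" for e
  proof -
    obtain N where N: "\<And>i j. i \<ge> N \<Longrightarrow> j \<ge> N \<Longrightarrow> qform_nn (\<lambda>x. w i x - w j x) \<le> ennreal (e / K)"
      using qC[of "e / K"] e K(1) by auto
    have "nn_square M (\<lambda>x. w i x - w j x) \<le> ennreal e" if "i \<ge> N" "j \<ge> N" for i j
    proof -
      have "nn_square M (\<lambda>x. w i x - w j x) \<le> ennreal K * qform_nn (\<lambda>x. w i x - w j x)"
        by (intro K(2) energy_spaceD D)
      also have "\<dots> \<le> ennreal K * ennreal (e / K)"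
        by (intro mult_left_mono N that) auto
      also have "\<dots> = ennreal e"
        using K(1) e by (simp add: ennreal_mult[symmetric])
      finally show ?thesis .
    qed
    then show ?thesis by blast
  qed
  have gd: "AE x in Ml. grad_l (\<lambda>x. w i x - w j x) x = grad_l (w i) x - grad_l (w j) x" for i j
    using H1_add_scaled(2)[OF open_l W(1)[of i] W(1)[of j], where c = "-1"] by simp
  have C2: "\<exists>N. \<forall>i\<ge>N. \<forall>j\<ge>N. nn_square Ml (\<lambda>x. grad_l (w i) x - grad_l (w j) x) \<le> ennreal e"
    if e: "e > 0" for e
  proof -
    have "nn_square Ml (\<lambda>x. grad_l (w i) x - grad_l (w j) x) \<le> qform_nn (\<lambda>x. w i x - w j x)" for i j
      unfolding nn_square_cong_AE[OF gd, symmetric] by (simp add: qform_nn_def add.assoc)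
    then show ?thesis
      using qC[OF e] by (meson order_trans)
  qed
  obtain v r where v: "v \<in> borel_measurable M" "nn_square M v < \<infinity>" "strict_mono r"
    "AE x in M. (\<lambda>k. w (r k) x) \<longlonglongrightarrow> v x" "(\<lambda>n. nn_square M (\<lambda>x. w n x - v x)) \<longlonglongrightarrow> 0"
    by (rule square_integrable_complete[OF fM.finite_measure_axioms W(9) W(14) C1])
  obtain g r' where g: "g \<in> borel_measurable Ml" "nn_square Ml g < \<infinity>" "strict_mono r'"
    "AE x in Ml. (\<lambda>k. grad_l (w (r' k)) x) \<longlonglongrightarrow> g x"
    "(\<lambda>n. nn_square Ml (\<lambda>x. grad_l (w n) x - g x)) \<longlonglongrightarrow> 0"
    by (rule square_integrable_complete[OF fl.finite_measure_axioms W(10) W(11) C2])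
  have L2v: "L2 \<Omega> v" "L2 \<Omega>l v" "L2 \<Omega>nl v"
    using v(1,2) L2_\<Omega>_iff by (auto simp: L2_iff_nn_square)
  have mv: "v \<in> borel_measurable Ml" "v \<in> borel_measurable Mn"
    using L2v by (auto simp: L2_iff_nn_square)
  have L2g: "L2 \<Omega>l g"
    using g by (simp add: L2_iff_nn_square)
  have "(\<lambda>n. nn_square Ml (\<lambda>x. w n x - v x)) \<longlonglongrightarrow> 0"
  proof (rule tendsto_sandwich[OF _ _ tendsto_const v(5)])
    have "nn_square Ml (\<lambda>x. w n x - v x) \<le> nn_square M (\<lambda>x. w n x - v x)" for n
      by (subst nn_square_\<Omega>) (auto intro!: borel_measurable_diff W mv)
    then show "\<forall>\<^sub>F n in sequentially. nn_square Ml (\<lambda>x. w n x - v x) \<le> nn_square M (\<lambda>x. w n x - v x)"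
      by simp
  qed simp
  from has_weak_gradient_limit[OF open_l bounded_l H1_weak_gradient(1)[OF open_l W(1)] W(3)
      H1_weak_gradient(2)[OF open_l W(1)] L2v(2) L2g this g(5)]
  have wgv: "has_weak_gradient \<Omega>l v g" .
  then have H: "v \<in> H1 \<Omega>l"
    using L2v L2g by (auto simp: H1_def)
  have aeg: "AE x in Ml. grad_l v x = g x"
    by (rule AE_weak_gradient_eq[OF open_l wgv])
  have "nn_square M (\<lambda>x. 1::real) < \<infinity>"
    using fM.finite_emeasure_space by (simp add: nn_square_def less_top[symmetric])
  then have "(\<lambda>n. \<integral>x. w n x \<partial>M) \<longlonglongrightarrow> (\<integral>x. v x \<partial>M)"
    using integral_inner_tendsto[of w M v "\<lambda>x. 1", OF W(9) v(1) _ W(14) v(2) _ v(5)] by simp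
  then have mean: "(\<integral>x. v x \<partial>M) = 0"
    using W(5) LIMSEQ_unique[OF _ tendsto_const] by simp
  have aen: "AE x in Mn. (\<lambda>k. w (r k) x) \<longlonglongrightarrow> v x" and ael: "AE x in Ml. (\<lambda>k. w (r k) x) \<longlonglongrightarrow> v x"
    using v(4) AE_\<Omega>_iff by auto
  have dn: "\<exists>N. \<forall>n\<ge>N. nn_square Mnn (nonlocal_diff (\<lambda>x. w n x - v x)) \<le> ennreal e
      \<and> nn_square Mnl (coupling_diff (\<lambda>x. w n x - v x)) \<le> ennreal e" if e: "e > 0" for e
  proof -
    obtain N where N: "\<And>i j. i \<ge> N \<Longrightarrow> j \<ge> N \<Longrightarrow> qform_nn (\<lambda>x. w i x - w j x) \<le> ennreal e"
      using qC[OF e] by blast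
    have N': "nn_square Mnn (nonlocal_diff (\<lambda>x. w i x - w j x)) \<le> ennreal e"
      "nn_square Mnl (coupling_diff (\<lambda>x. w i x - w j x)) \<le> ennreal e" if "i \<ge> N" "j \<ge> N" for i j
      using N[OF that] unfolding qform_nn_def
      by (auto intro: order_trans[rotated] simp: add.assoc add.left_commute[of "nn_square Ml _"])
    have "nn_square Mnn (nonlocal_diff (\<lambda>x. w n x - v x)) \<le> ennreal e" if n: "n \<ge> N" for n
    proof (rule nn_square_Fatou[where F = "\<lambda>k. nonlocal_diff (\<lambda>x. w n x - w (r k) x)" and N = N])
      show "AE z in Mnn. (\<lambda>k. nonlocal_diff (\<lambda>x. w n x - w (r k) x) z) \<longlonglongrightarrow> nonlocal_diff (\<lambda>x. w n x - v x) z"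
        using AE_pair_fst_snd[OF fn.sigma_finite_measure_axioms aen aen fn.sigma_finite_measure_axioms]
        by eventually_elim (auto simp: nonlocal_diff_def case_prod_beta intro!: tendsto_intros)
      show "nn_square Mnn (nonlocal_diff (\<lambda>x. w n x - w (r k) x)) \<le> ennreal e" if "k \<ge> N" for k
        using n that seq_suble[OF v(3), of k] by (intro N') auto
    qed (intro nonlocal_diff_measurable borel_measurable_diff W mv)+
    moreover have "nn_square Mnl (coupling_diff (\<lambda>x. w n x - v x)) \<le> ennreal e" if n: "n \<ge> N" for n
    proof (rule nn_square_Fatou[where F = "\<lambda>k. coupling_diff (\<lambda>x. w n x - w (r k) x)" and N = N])
      show "AE z in Mnl. (\<lambda>k. coupling_diff (\<lambda>x. w n x - w (r k) x) z) \<longlonglongrightarrow> coupling_diff (\<lambda>x. w n x - v x) z"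
        using AE_pair_fst_snd[OF fl.sigma_finite_measure_axioms aen ael fn.sigma_finite_measure_axioms]
        by eventually_elim (auto simp: coupling_diff_def case_prod_beta intro!: tendsto_intros)
      show "nn_square Mnl (coupling_diff (\<lambda>x. w n x - w (r k) x)) \<le> ennreal e" if "k \<ge> N" for k
        using n that seq_suble[OF v(3), of k] by (intro N') auto
    qed (intro coupling_diff_measurable borel_measurable_diff W mv)+
    ultimately show ?thesis by blast
  qed
  obtain N where N: "nn_square Mnn (nonlocal_diff (\<lambda>x. w N x - v x)) \<le> ennreal 1"
      "nn_square Mnl (coupling_diff (\<lambda>x. w N x - v x)) \<le> ennreal 1"
    using dn[of 1] by auto
  have "nn_square Mnn (nonlocal_diff v) < \<infinity>"
  proof (rule nn_square_finite_if_diff[OF nonlocal_diff_measurable[OF W(8)] nonlocal_diff_measurable[OF mv(2)] W(12)])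
    have "(\<lambda>z. nonlocal_diff (w N) z - nonlocal_diff v z) = nonlocal_diff (\<lambda>x. w N x - v x)"
      by (auto simp: nonlocal_diff_def fun_eq_iff algebra_simps)
    then show "nn_square Mnn (\<lambda>z. nonlocal_diff (w N) z - nonlocal_diff v z) < \<infinity>"
      using N(1) by (simp add: order_le_less_trans)
  qed
  moreover have "nn_square Mnl (coupling_diff v) < \<infinity>"
  proof (rule nn_square_finite_if_diff[OF coupling_diff_measurable[OF W(8,7)] coupling_diff_measurable[OF mv(2,1)] W(13)])
    have "(\<lambda>z. coupling_diff (w N) z - coupling_diff v z) = coupling_diff (\<lambda>x. w N x - v x)"
      by (auto simp: coupling_diff_def fun_eq_iff algebra_simps)
    then show "nn_square Mnl (\<lambda>z. coupling_diff (w N) z - coupling_diff v z) < \<infinity>"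
      using N(2) by (simp add: order_le_less_trans)
  qed
  ultimately have vE: "v \<in> energy_space"
    using H L2v mean g(2) nn_square_cong_AE[OF aeg] by (simp add: energy_space_def qform_nn_def)
  have gdv: "AE x in Ml. grad_l (\<lambda>x. w n x - v x) x = grad_l (w n) x - g x" for n
    using H1_add_scaled(2)[OF open_l W(1)[of n] H, where c = "-1"] aeg by eventually_elim simp
  have "(\<lambda>n. qform (\<lambda>x. w n x - v x)) \<longlonglongrightarrow> 0"
  proof (rule LIMSEQ_I)
    fix e :: real assume e: "e > 0"
    obtain N1 where N1: "\<And>n. n \<ge> N1 \<Longrightarrow> nn_square Mnn (nonlocal_diff (\<lambda>x. w n x - v x)) \<le> ennreal (e / 4)
      \<and> nn_square Mnl (coupling_diff (\<lambda>x. w n x - v x)) \<le> ennreal (e / 4)"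
      using dn[of "e / 4"] e by auto
    have "\<forall>\<^sub>F n in sequentially. nn_square Ml (\<lambda>x. grad_l (w n) x - g x) < ennreal (e / 4)"
      using g(5) e by (intro order_tendstoD) auto
    then obtain N2 where N2: "\<And>n. n \<ge> N2 \<Longrightarrow> nn_square Ml (\<lambda>x. grad_l (w n) x - g x) < ennreal (e / 4)"
      by (auto simp: eventually_sequentially)
    have "norm (qform (\<lambda>x. w n x - v x) - 0) < e" if "n \<ge> max N1 N2" for n
    proof -
      have "qform_nn (\<lambda>x. w n x - v x) \<le> ennreal (e / 4) + ennreal (e / 4) + ennreal (e / 4)"
        unfolding qform_nn_def nn_square_cong_AE[OF gdv]
        using N1[of n] N2[of n] that by (intro add_mono) auto
      also have "\<dots> = ennreal (3 * e / 4)"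
        using e by (simp add: ennreal_plus[symmetric] del: ennreal_plus)
      finally have "qform (\<lambda>x. w n x - v x) \<le> 3 * e / 4"
        using e qform_nn_eq[OF energy_space_diff[OF w vE]] by simp
      then show ?thesis using qform_nonneg[of "\<lambda>x. w n x - v x"] e by simp
    qed
    then show "\<exists>no. \<forall>n\<ge>no. norm (qform (\<lambda>x. w n x - v x) - 0) < e" by blast
  qed
  then show ?thesis
    using that vE v(5) by blast
qed

section \<open>The minimizer\<close>

definition energy :: "('a \<Rightarrow> real) \<Rightarrow> ('a \<Rightarrow> real) \<Rightarrow> real" where
  "energy f u = qform u / 2 - (\<integral>x. f x * u x \<partial>M)"

lemma quadratic_energy_eq_qform:
  assumes u: "u \<in> energy_space"
  shows "E_quad u = ennreal (qform u / 2)"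
proof -
  have "E_quad u = ennreal (1 / 2) * ennreal (qform u)"
    using quadratic_energy_eq[OF energy_spaceD(1,8)[OF u]] qform_nn_eq[OF u] by simp
  also have "\<dots> = ennreal (qform u / 2)"
    using ennreal_mult'[of "1/2" "qform u"] by simp
  finally show ?thesis .
qed

lemma E_Neu_eq_energy:
  assumes u: "u \<in> energy_space"
  shows "E_N f u = ereal (energy f u)"
  using qform_nonneg[of u] by (simp add: E_Neu_def energy_def quadratic_energy_eq_qform[OF u])

lemma E_Neu_eq_infinity:
  assumes u: "u \<in> H_N" "u \<notin> energy_space"
  shows "E_N f u = \<infinity>"
proof -
  have "qform_nn u = top"
    using u energy_space_iff[of u] by (simp add: less_top[symmetric])
  then have "E_quad u = top"
    using quadratic_energy_eq[OF H_Neu_measurable[OF u(1)]] by (simp add: ennreal_mult_top)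
  then show ?thesis
    by (simp add: E_Neu_def)
qed

text \<open>The zero function has finite energy, so a minimiser has finite energy, and the comparison with
  functions of infinite energy is void.\<close>

lemma is_arg_min_E_Neu_iff:
  "is_arg_min (E_N f) (\<lambda>w. w \<in> H_N) u \<longleftrightarrow>
     u \<in> energy_space \<and> (\<forall>v\<in>energy_space. energy f u \<le> energy f v)"
proof
  assume min: "is_arg_min (E_N f) (\<lambda>w. w \<in> H_N) u"
  then have u: "u \<in> H_N"
    and le: "\<And>v. v \<in> H_N \<Longrightarrow> E_N f u \<le> E_N f v"
    by (auto simp: is_arg_min_def not_less)
  have uE: "u \<in> energy_space"
  proof (rule ccontr)
    assume "u \<notin> energy_space"
    then show False
      using le[of "\<lambda>x. 0"] zero_energy_space energy_space_iff E_Neu_eq_infinity[OF u] E_Neu_eq_energy[OF zero_energy_space]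
      by simp
  qed
  then show "u \<in> energy_space \<and> (\<forall>v\<in>energy_space. energy f u \<le> energy f v)"
    using le E_Neu_eq_energy energy_space_iff by fastforce
next
  assume u: "u \<in> energy_space \<and> (\<forall>v\<in>energy_space. energy f u \<le> energy f v)"
  have "E_N f u \<le> E_N f v" if "v \<in> H_N" for v
    using u that E_Neu_eq_energy E_Neu_eq_infinity[OF that] by (cases "v \<in> energy_space") auto
  then show "is_arg_min (E_N f) (\<lambda>w. w \<in> H_N) u"
    using u energy_space_iff by (auto simp: is_arg_min_def not_less)
qed

lemma integrable_source:
  assumes "L2 \<Omega> f" "u \<in> energy_space"
  shows "integrable M (\<lambda>x. f x * u x)"
  using integrable_inner_if_square_integrable[of f M u] assms energy_spaceD(9,14)[OF assms(2)]
  by (simp add: L2_iff_nn_square)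

lemma energy_add_scaled:
  assumes f: "L2 \<Omega> f" and u: "u \<in> energy_space" and v: "v \<in> energy_space"
  shows "energy f (\<lambda>x. u x + c * v x) = energy f u + c * (bform u v - (\<integral>x. f x * v x \<partial>M)) + c\<^sup>2 / 2 * qform v"
proof -
  have "(\<integral>x. f x * (u x + c * v x) \<partial>M) = (\<integral>x. f x * u x + c * (f x * v x) \<partial>M)"
    by (simp add: algebra_simps)
  also have "\<dots> = (\<integral>x. f x * u x \<partial>M) + c * (\<integral>x. f x * v x \<partial>M)"
    using integrable_source[OF f u] integrable_source[OF f v] by simp
  finally show ?thesis
    unfolding energy_def energy_space_add_scaled(2)[OF u v] by (simp add: algebra_simps)
qed

lemma poincare_energy_space:
  "\<exists>K>0. \<forall>u\<in>energy_space. (\<integral>x. (u x)\<^sup>2 \<partial>M) \<le> K * qform u"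
proof -
  obtain K where K: "K > 0" "\<And>u. u \<in> H1 \<Omega>l \<Longrightarrow> L2 \<Omega>nl u \<Longrightarrow> (\<integral>x. u x \<partial>M) = 0 \<Longrightarrow> nn_square M u \<le> ennreal K * qform_nn u"
    using poincare_coupled by blast
  have "(\<integral>x. (u x)\<^sup>2 \<partial>M) \<le> K * qform u" if u: "u \<in> energy_space" for u
  proof -
    have "ennreal (\<integral>x. (u x)\<^sup>2 \<partial>M) \<le> ennreal (K * qform u)"
      using K(2)[OF energy_spaceD(1,2,5)[OF u]] K(1) qform_nonneg[of u]
        nn_square_eq_integral[OF energy_spaceD(9,14)[OF u]] qform_nn_eq[OF u]
      by (simp add: ennreal_mult)
    then show ?thesis
      using K(1) qform_nonneg[of u] by simp
  qed
  then show ?thesis using K(1) by blast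
qed

text \<open>Young's inequality with the Poincare constant as weight: half of the quadratic form absorbs the
  linear term.\<close>

lemma energy_bounded_below:
  assumes f: "L2 \<Omega> f"
  shows "\<exists>m. \<forall>u\<in>energy_space. m \<le> energy f u"
proof -
  obtain K where K: "K > 0" "\<And>u. u \<in> energy_space \<Longrightarrow> (\<integral>x. (u x)\<^sup>2 \<partial>M) \<le> K * qform u"
    using poincare_energy_space by blast
  have fi: "integrable M (\<lambda>x. (f x)\<^sup>2)"
    using f by (simp add: L2_def)
  have "- (K / 2 * (\<integral>x. (f x)\<^sup>2 \<partial>M)) \<le> energy f u" if u: "u \<in> energy_space" for u
  proof -
    have ui: "integrable M (\<lambda>x. (u x)\<^sup>2)"
      using energy_spaceD(4)[OF u] by (simp add: L2_def)
    have "(\<integral>x. f x * u x \<partial>M) \<le> (\<integral>x. K / 2 * (f x)\<^sup>2 + 1 / (2 * K) * (u x)\<^sup>2 \<partial>M)"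
    proof (rule integral_mono[OF integrable_source[OF f u]])
      show "integrable M (\<lambda>x. K / 2 * (f x)\<^sup>2 + 1 / (2 * K) * (u x)\<^sup>2)"
        using fi ui by simp
      fix x
      have "0 \<le> (K * f x - u x)\<^sup>2 / (2 * K)" using K(1) by simp
      also have "\<dots> = K / 2 * (f x)\<^sup>2 + 1 / (2 * K) * (u x)\<^sup>2 - f x * u x"
        using K(1) by (simp add: power2_eq_square field_simps)
      finally show "f x * u x \<le> K / 2 * (f x)\<^sup>2 + 1 / (2 * K) * (u x)\<^sup>2" by simp
    qed
    also have "\<dots> = K / 2 * (\<integral>x. (f x)\<^sup>2 \<partial>M) + 1 / (2 * K) * (\<integral>x. (u x)\<^sup>2 \<partial>M)"
      using fi ui by simp
    also have "1 / (2 * K) * (\<integral>x. (u x)\<^sup>2 \<partial>M) \<le> 1 / (2 * K) * (K * qform u)"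
      using K by (intro mult_left_mono K(2) u) auto
    finally show ?thesis
      using K(1) by (simp add: energy_def)
  qed
  then show ?thesis by blast
qed

text \<open>The parallelogram identity: closeness of two energies to the infimum controls the distance.\<close>

lemma qform_diff_le:
  assumes f: "L2 \<Omega> f" and u: "u \<in> energy_space" and v: "v \<in> energy_space"
    and m: "\<And>w. w \<in> energy_space \<Longrightarrow> m \<le> energy f w"
  shows "qform (\<lambda>x. u x - v x) \<le> 4 * (energy f u + energy f v - 2 * m)"
proof -
  let ?d = "\<lambda>x. u x - v x"
  have d: "?d \<in> energy_space" by (rule energy_space_diff[OF u v])
  let ?b = "bform v ?d - (\<integral>x. f x * ?d x \<partial>M)"
  have "energy f u = energy f v + ?b + qform ?d / 2"
    using energy_add_scaled[OF f v d, of 1] by simp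
  moreover have "m \<le> energy f v + ?b / 2 + qform ?d / 8"
    using m[OF energy_space_add_scaled(1)[OF v d, of "1 / 2"]] energy_add_scaled[OF f v d, of "1 / 2"]
    by (simp add: power2_eq_square)
  moreover have "qd \<le> 4 * (a + b - 2 * m)" if "a = b + l + qd / 2" "m \<le> b + l / 2 + qd / 8" for a b l qd :: real
    using that by simp
  ultimately show ?thesis
    by blast
qed

text \<open>The limit \<open>v\<close> of a minimising sequence attains the infimum because the energy is continuous along
  convergence in energy: expand it at \<open>v\<close> in the direction of the vanishing differences.\<close>

theorem ex_minimizer:
  assumes f: "L2 \<Omega> f"
  shows "\<exists>u\<in>energy_space. \<forall>v\<in>energy_space. energy f u \<le> energy f v"
proof -
  define m where "m = Inf (energy f ` energy_space)"
  have ne: "energy f ` energy_space \<noteq> {}" using zero_energy_space by blast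
  have bdd: "bdd_below (energy f ` energy_space)"
    using energy_bounded_below[OF f] by (auto simp: bdd_below_def)
  have m: "m \<le> energy f u" if "u \<in> energy_space" for u
    unfolding m_def using that by (intro cInf_lower bdd) auto
  have "\<exists>w\<in>energy_space. energy f w < m + inverse (real (Suc n))" for n
    using cInf_lessD[OF ne, of "m + inverse (real (Suc n))"] by (auto simp: m_def)
  then obtain w where w: "\<And>n. w n \<in> energy_space" "\<And>n. energy f (w n) < m + inverse (real (Suc n))"
    by metis
  have "\<exists>N. \<forall>i\<ge>N. \<forall>j\<ge>N. qform (\<lambda>x. w i x - w j x) \<le> e" if e: "e > 0" for e
  proof -
    obtain N where N: "inverse (real (Suc N)) < e / 8"
      using reals_Archimedean[of "e / 8"] e by auto
    have "qform (\<lambda>x. w i x - w j x) \<le> e" if "i \<ge> N" "j \<ge> N" for i j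
    proof -
      have inv: "inverse (real (Suc i)) \<le> inverse (real (Suc N))" "inverse (real (Suc j)) \<le> inverse (real (Suc N))"
        using that by (auto intro!: le_imp_inverse_le)
      have "qform (\<lambda>x. w i x - w j x) \<le> 4 * (energy f (w i) + energy f (w j) - 2 * m)"
        by (rule qform_diff_le[OF f w(1) w(1)]) (rule m)
      moreover have "4 * (energy f (w i) + energy f (w j) - 2 * m) \<le> e"
        using w(2)[of i] w(2)[of j] N inv by argo
      ultimately show ?thesis
        by (rule order_trans)
    qed
    then show ?thesis by blast
  qed
  then obtain v where v: "v \<in> energy_space" "(\<lambda>n. qform (\<lambda>x. w n x - v x)) \<longlonglongrightarrow> 0"
    "(\<lambda>n. nn_square M (\<lambda>x. w n x - v x)) \<longlonglongrightarrow> 0"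
    by (rule energy_space_complete[OF w(1)])
  let ?d = "\<lambda>n x. w n x - v x"
  have d: "?d n \<in> energy_space" for n by (rule energy_space_diff[OF w(1) v(1)])
  have fm: "f \<in> borel_measurable M" "nn_square M f < \<infinity>"
    using f by (auto simp: L2_iff_nn_square)
  have "(\<lambda>n. \<integral>x. w n x * f x \<partial>M) \<longlonglongrightarrow> (\<integral>x. v x * f x \<partial>M)"
    using integral_inner_tendsto[OF energy_spaceD(9)[OF w(1)] energy_spaceD(9)[OF v(1)] fm(1)
        energy_spaceD(14)[OF w(1)] energy_spaceD(14)[OF v(1)] fm(2) v(3)] by simp
  then have "(\<lambda>n. (\<integral>x. w n x * f x \<partial>M) - (\<integral>x. v x * f x \<partial>M)) \<longlonglongrightarrow> 0"
    by (rule LIM_zero)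
  moreover have "(\<integral>x. f x * ?d n x \<partial>M) = (\<integral>x. w n x * f x \<partial>M) - (\<integral>x. v x * f x \<partial>M)" for n
    using integrable_source[OF f w(1)] integrable_source[OF f v(1)]
    by (simp add: right_diff_distrib mult.commute)
  ultimately have l: "(\<lambda>n. \<integral>x. f x * ?d n x \<partial>M) \<longlonglongrightarrow> 0"
    by simp
  have b: "(\<lambda>n. bform v (?d n)) \<longlonglongrightarrow> 0"
  proof (rule Lim_null_comparison)
    have "norm (bform v (?d n)) \<le> sqrt (qform v * qform (?d n))" for n
      using real_sqrt_le_mono[OF bform_Cauchy_Schwarz[OF v(1) d[of n]]] by simp
    then show "\<forall>\<^sub>F n in sequentially. norm (bform v (?d n)) \<le> sqrt (qform v * qform (?d n))"
      by simp
    have "(\<lambda>n. sqrt (qform v * qform (?d n))) \<longlonglongrightarrow> sqrt (qform v * 0)"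
      by (intro tendsto_real_sqrt tendsto_mult tendsto_const v(2))
    then show "(\<lambda>n. sqrt (qform v * qform (?d n))) \<longlonglongrightarrow> 0"
      by simp
  qed
  have Jv: "energy f v = energy f (w n) - (bform v (?d n) - (\<integral>x. f x * ?d n x \<partial>M)) - qform (?d n) / 2" for n
    using energy_add_scaled[OF f v(1) d, of 1 n] by simp
  have "(\<lambda>n. m + inverse (real (Suc n)) - (bform v (?d n) - (\<integral>x. f x * ?d n x \<partial>M)) - qform (?d n) / 2)
      \<longlonglongrightarrow> m + 0 - (0 - 0) - 0 / 2"
    by (intro tendsto_intros LIMSEQ_inverse_real_of_nat b l v(2)) simp
  moreover have "energy f v \<le> m + inverse (real (Suc n)) - (bform v (?d n) - (\<integral>x. f x * ?d n x \<partial>M)) - qform (?d n) / 2" for n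
    using Jv[of n] w(2)[of n] by linarith
  ultimately have "energy f v \<le> m + 0 - (0 - 0) - 0 / 2"
    by (intro tendsto_lowerbound[OF _ always_eventually]) auto
  then have "energy f v \<le> m" by simp
  then show ?thesis
    using v(1) m order_trans by blast
qed

lemma minimizer_unique:
  assumes f: "L2 \<Omega> f" and u: "u \<in> energy_space" "\<And>w. w \<in> energy_space \<Longrightarrow> energy f u \<le> energy f w"
    and v: "v \<in> energy_space" "\<And>w. w \<in> energy_space \<Longrightarrow> energy f v \<le> energy f w"
  shows "AE x in M. v x = u x"
proof -
  let ?d = "\<lambda>x. v x - u x"
  have d: "?d \<in> energy_space" by (rule energy_space_diff[OF v(1) u(1)])
  have "energy f u = energy f v" using u(2)[OF v(1)] v(2)[OF u(1)] by simp
  then have "qform ?d \<le> 0"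
    using qform_diff_le[OF f v(1) u(1) u(2)] by simp
  then have "qform ?d = 0" using qform_nonneg[of ?d] by linarith
  moreover obtain K where K: "K > 0" "\<And>u. u \<in> energy_space \<Longrightarrow> (\<integral>x. (u x)\<^sup>2 \<partial>M) \<le> K * qform u"
    using poincare_energy_space by blast
  ultimately have "(\<integral>x. (?d x)\<^sup>2 \<partial>M) \<le> 0"
    using K(2)[OF d] by simp
  moreover have i: "integrable M (\<lambda>x. (?d x)\<^sup>2)"
    using energy_spaceD(4)[OF d] by (simp add: L2_def)
  moreover have "0 \<le> (\<integral>x. (?d x)\<^sup>2 \<partial>M)"
    by (rule Bochner_Integration.integral_nonneg) simp
  ultimately have "AE x in M. (?d x)\<^sup>2 = 0"
    using integral_nonneg_eq_0_iff_AE[OF i] by simp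
  then show ?thesis
    by eventually_elim simp
qed

lemma eq_0_if_quadratic_nonneg:
  fixes \<beta> \<gamma> :: real
  assumes "\<And>c. 0 \<le> c * \<beta> + c\<^sup>2 * \<gamma>" and "\<gamma> \<ge> 0"
  shows "\<beta> = 0"
proof (rule ccontr)
  assume b: "\<beta> \<noteq> 0"
  define t where "t = \<gamma> + 1"
  have t: "t > 0" "\<gamma> = t - 1" using assms(2) by (simp_all add: t_def)
  have "(- \<beta> / t) * \<beta> + (- \<beta> / t)\<^sup>2 * \<gamma> = - (\<beta>\<^sup>2 / t\<^sup>2)"
    using t(1) unfolding t(2) by (simp add: power2_eq_square field_simps)
  moreover have "\<beta>\<^sup>2 / t\<^sup>2 > 0"
    using b t(1) by simp
  ultimately show False
    using assms(1)[of "- \<beta> / t"] by linarith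
qed

text \<open>Along the line \<open>u + c v\<close> the energy is a quadratic polynomial in \<open>c\<close> with its minimum at \<open>0\<close>.\<close>

lemma Euler_Lagrange:
  assumes f: "L2 \<Omega> f" and u: "u \<in> energy_space" "\<And>w. w \<in> energy_space \<Longrightarrow> energy f u \<le> energy f w"
    and v: "v \<in> energy_space"
  shows "(\<integral>x. f x * v x \<partial>M) = bform u v"
proof -
  have "bform u v - (\<integral>x. f x * v x \<partial>M) = 0"
  proof (rule eq_0_if_quadratic_nonneg[where \<gamma> = "qform v / 2"])
    show "0 \<le> c * (bform u v - (\<integral>x. f x * v x \<partial>M)) + c\<^sup>2 * (qform v / 2)" for c
      using u(2)[OF energy_space_add_scaled(1)[OF u(1) v, of c]] energy_add_scaled[OF f u(1) v, of c] by simp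
  qed (use qform_nonneg[of v] in simp)
  then show ?thesis by simp
qed

lemma smooth_energy_space:
  assumes \<phi>: "smooth \<phi>" and mean: "(\<integral>x. \<phi> x \<partial>M) = 0" and fin: "E_quad \<phi> < \<infinity>"
  shows "\<phi> \<in> energy_space"
proof -
  have L: "L2 \<Omega>nl \<phi>" and H: "\<phi> \<in> H1 \<Omega>l"
    using smooth_H1(1)[OF open_n bounded_n \<phi>] smooth_H1(2)[OF open_l bounded_l \<phi>] by auto
  then have "E_quad \<phi> = ennreal (1 / 2) * qform_nn \<phi>"
    by (intro quadratic_energy_eq) (auto simp: L2_iff_nn_square)
  then have "qform_nn \<phi> < \<infinity>"
    using fin by (auto simp: ennreal_mult_less_top)
  then show ?thesis
    using L H mean by (simp add: energy_space_def)
qed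

text \<open>The bilinear form is built on product measures; unfolding it as iterated integrals needs
  Fubini, and replacing the Borel kernel by \<open>G\<close> uses that the Lebesgue measure is complete.\<close>

lemma bform_eq_iterated:
  assumes u: "u \<in> energy_space" and v: "v \<in> energy_space" and s: "smooth v"
  shows "bform u v = (\<integral>x. grad_l u x \<bullet> grad v x \<partial>Ml)
     + (\<integral>x. (\<integral>y. kern x y * (u y - u x) * (v y - v x) \<partial>Mn) \<partial>Mn)
     + (\<integral>y. (\<integral>x. G x y * (u y - u x) * (v y - v x) \<partial>Ml) \<partial>Mn)"
proof -
  note U = energy_spaceD[OF u] and V = energy_spaceD[OF v]
  note [measurable] = U(7,8) V(7,8)
  have 1: "(\<integral>x. grad_l u x \<bullet> grad_l v x \<partial>Ml) = (\<integral>x. grad_l u x \<bullet> grad v x \<partial>Ml)"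
  proof (rule integral_cong_AE_lebesgue_on[OF open_l])
    show "AE x in Ml. grad_l u x \<bullet> grad_l v x = grad_l u x \<bullet> grad v x"
      using smooth_H1(3)[OF open_l bounded_l s] by eventually_elim simp
  qed (intro borel_measurable_inner U V)
  have sq: "sqrt k * a * (sqrt k * b) = k * a * b" if "k \<ge> 0" for k a b :: real
    using that by (simp add: mult.assoc mult.left_commute[of a])
  have iN: "integrable Mnn (\<lambda>z. nonlocal_diff u z \<bullet> nonlocal_diff v z)"
    by (intro integrable_inner_if_square_integrable nonlocal_diff_measurable U V)
  have 2: "(\<integral>z. nonlocal_diff u z \<bullet> nonlocal_diff v z \<partial>Mnn) = (\<integral>x. (\<integral>y. kern x y * (u y - u x) * (v y - v x) \<partial>Mn) \<partial>Mn)"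
    using nn.integral_fst'[OF iN] by (simp add: nonlocal_diff_def sq[OF kern_nonneg])
  have iG: "integrable Mnl (\<lambda>z. coupling_diff u z \<bullet> coupling_diff v z)"
    by (intro integrable_inner_if_square_integrable coupling_diff_measurable U V)
  let ?I = "\<lambda>y x. coupling_diff u (y, x) \<bullet> coupling_diff v (y, x)"
  have I: "?I y x = G_borel (x, y) * (u y - u x) * (v y - v x)" for x y
    by (simp add: coupling_diff_def sq[OF G_borel_nonneg])
  have "(\<integral>z. coupling_diff u z \<bullet> coupling_diff v z \<partial>Mnl) = (\<integral>y. (\<integral>x. ?I y x \<partial>Ml) \<partial>Mn)"
    by (rule nl.integral_fst'[OF iG, symmetric])
  also have "\<dots> = (\<integral>y. (\<integral>x. G x y * (u y - u x) * (v y - v x) \<partial>Ml) \<partial>Mn)"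
  proof (rule integral_cong_AE_lebesgue_on[OF open_n])
    show "(\<lambda>y. \<integral>x. ?I y x \<partial>Ml) \<in> borel_measurable Mn"
      using nl.integrable_fst'[OF iG] by auto
    show "AE y in Mn. (\<integral>x. ?I y x \<partial>Ml) = (\<integral>x. G x y * (u y - u x) * (v y - v x) \<partial>Ml)"
      using AE_G_borel nl.AE_integrable_fst'[OF iG]
    proof eventually_elim
      case (elim y)
      show ?case
      proof (rule integral_cong_AE_lebesgue_on[OF open_l])
        show "?I y \<in> borel_measurable Ml"
          using elim(2) by auto
        show "AE x in Ml. ?I y x = G x y * (u y - u x) * (v y - v x)"
          using elim(1) by eventually_elim (simp only: I)
      qed
    qed
  qed
  finally show ?thesis
    unfolding bform_def 1 2 by simp
qed

theorem minimizer_weak_solution: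
  assumes f: "L2 \<Omega> f" and u: "u \<in> energy_space" "\<And>w. w \<in> energy_space \<Longrightarrow> energy f u \<le> energy f w"
  shows "weak_solution_Neu \<Omega> \<Omega>l \<Omega>nl s C G f u"
  unfolding weak_solution_Neu_def
proof (intro conjI allI impI)
  show "u \<in> H_N"
    using u(1) energy_space_iff by simp
  show "E_quad u < \<infinity>"
    by (simp add: quadratic_energy_eq_qform[OF u(1)])
  fix \<phi> assume \<phi>: "smooth \<phi> \<and> (\<integral>x. \<phi> x \<partial>M) = 0 \<and> E_quad \<phi> < \<infinity>"
  then have "\<phi> \<in> energy_space"
    by (intro smooth_energy_space) auto
  from Euler_Lagrange[OF f u this] bform_eq_iterated[OF u(1) this] \<phi>
  show "(\<integral>x. f x * \<phi> x \<partial>M) = (\<integral>x. grad_l u x \<bullet> grad \<phi> x \<partial>Ml)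
     + (\<integral>x. (\<integral>y. C / norm (x - y) powr (real DIM('a) + 2 * s) * (u y - u x) * (\<phi> y - \<phi> x) \<partial>Mn) \<partial>Mn)
     + (\<integral>y. (\<integral>x. G x y * (u y - u x) * (\<phi> y - \<phi> x) \<partial>Ml) \<partial>Mn)"
    by (simp add: kern_def)
qed

end

theorem theorem1p5:
  fixes \<Omega> \<Omega>l \<Omega>nl :: "'a::euclidean_space set"
    and \<delta> s C :: real
    and G :: "'a \<Rightarrow> 'a \<Rightarrow> real"
    and f :: "'a \<Rightarrow> real"
  assumes "open \<Omega>" and "bounded \<Omega>"
    and "open \<Omega>l" and "\<Omega>l \<noteq> {}" and "\<Omega>l \<subseteq> \<Omega>"
    and "open \<Omega>nl" and "\<Omega>nl \<noteq> {}" and "\<Omega>nl \<subseteq> \<Omega>"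
    and "\<Omega>l \<inter> \<Omega>nl = {}"
    and "\<Omega> = interior (closure \<Omega>l \<union> closure \<Omega>nl)"
    and interface_null: "negligible (\<Omega> - (\<Omega>l \<union> \<Omega>nl))"
    and "\<delta> > 0"
    and "connected \<Omega>l" and "lipschitz_boundary \<Omega>l"
    and "delta_connected \<delta> \<Omega>nl"
    and "\<And>x y. x \<in> \<Omega>l \<Longrightarrow> y \<in> \<Omega>nl \<Longrightarrow> 0 \<le> G x y"
    and "(\<lambda>(x, y). G x y) \<in> borel_measurable (lebesgue_on (\<Omega>l \<times> \<Omega>nl))"
    and "\<exists>c>0. \<forall>x\<in>\<Omega>l. \<forall>y\<in>\<Omega>nl. norm (x - y) \<le> 2 * \<delta> \<longrightarrow> c < G x y"
    and "setdist \<Omega>l \<Omega>nl < \<delta>"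
    and "0 < s" and "s < 1" and "C > 0"
    and "L2 \<Omega> f" and "(\<integral>x. f x \<partial>lebesgue_on \<Omega>) = 0"
  shows "(\<exists>u. is_arg_min (E_Neu \<Omega> \<Omega>l \<Omega>nl s C G f) (\<lambda>w. w \<in> H_Neu \<Omega> \<Omega>l \<Omega>nl s) u \<and>
             (\<forall>v. is_arg_min (E_Neu \<Omega> \<Omega>l \<Omega>nl s C G f) (\<lambda>w. w \<in> H_Neu \<Omega> \<Omega>l \<Omega>nl s) v \<longrightarrow>
                  (AE x in lebesgue_on \<Omega>. v x = u x))) \<and>
         (\<forall>u. is_arg_min (E_Neu \<Omega> \<Omega>l \<Omega>nl s C G f) (\<lambda>w. w \<in> H_Neu \<Omega> \<Omega>l \<Omega>nl s) u \<longrightarrow>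
             weak_solution_Neu \<Omega> \<Omega>l \<Omega>nl s C G f u)"
proof -
  interpret coupled_domain \<Omega> \<Omega>l \<Omega>nl \<delta> s C G
    by unfold_locales (use assms in auto)
  note f = \<open>L2 \<Omega> f\<close>
  obtain u where u: "u \<in> energy_space" "\<And>v. v \<in> energy_space \<Longrightarrow> energy f u \<le> energy f v"
    using ex_minimizer[OF f] by blast
  show ?thesis
    unfolding is_arg_min_E_Neu_iff
    using u minimizer_unique[OF f u] minimizer_weak_solution[OF f] by blast
qed

end
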